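(* Let $d,m$ be positive integers, let $\mathcal H$ be a separable complex Hilbert space and let $T=(T_1,\ldots,T_d)$ be a commuting $d$-tuple on $\mathcal H$. Let $\{f_j\}_{j\in I}$ be an orthonormal basis for the joint kernel $\ker T^*=\bigcap_{j=1}^d\ker T_j^*$ for some nonempty directed set $I$. Consider the Gramian matrix $\mathscr G=[\![\mathscr G_{\alpha,\beta}]\!]_{\alpha,\beta\in\mathbb Z_+^d}$ associated with $T$ given by $$\mathscr G_{\alpha,\beta}:=\big[\!\big[\langle T^\beta f_j,T^\alpha f_i\rangle\big]\!\big]_{i,j\in I},\qquad\alpha,\beta\in\mathbb Z_+^d.$$ Assume that $T$ admits the wandering subspace property. Then the following are equivalent: (i) $T$ is a joint $m$-isometry; (ii) $\triangle_{\mathscr G,m}=0$; (iii) $\sum_{|\gamma|=k}\frac{|\gamma|!}{\gamma!}\,\sigma^\gamma\mathscr G=\sum_{j=0}^{m-1}\binom kj\triangle_{\mathscr G,j}$ for every $k\in\mathbb Z_+$, with the convention $\binom kj=0$ if $k<j$; (iv) $\sum_{j=1}^d\sigma_j\triangle_{\mathscr G,m-1}=\triangle_{\mathscr G,m-1}$. Moreover, if (i) holds, then $\triangle_{\mathscr G,m-1}\geqslant0$, and there exists a $\mathcal B(\ell^2(I))$-valued semispectral measure $F$ on $\partial\mathbb B^d$ such that for every $\alpha,\beta\in\mathbb Z_+^d$, $$\sum_{j=0}^{m-1}(-1)^{j+m-1}\binom{m-1}{j}\sum_{|\gamma|=j}\frac{|\gamma|!}{\gamma!}\,\mathscr G_{\alpha+\gamma,\beta+\gamma}=\int_{\partial\mathbb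 B^d}\zeta^\alpha\overline\zeta^{\beta}\,dF(\zeta).$$
   Context: A commuting $d$-tuple on $\mathcal H$ consists of commuting operators $T_1,\ldots,T_d\in\mathcal B(\mathcal H)$; $T^\alpha=T_1^{\alpha_1}\cdots T_d^{\alpha_d}$ for $\alpha\in\mathbb Z_+^d$ ($\mathbb Z_+$ the non-negative integers); $|\gamma|=\sum_j\gamma_j$, $\gamma!=\prod_j\gamma_j!$; $\varepsilon_j$ is the $d$-tuple with $1$ in the $j$-th entry and zeros elsewhere; $\partial\mathbb B^d$ is the unit sphere of $\mathbb C^d$. $T$ is a joint $m$-isometry if $\sum_{n=0}^m(-1)^n\binom mn Q_T^n(I)=0$, where $Q_T(X)=\sum_{j=1}^dT_j^*XT_j$, $Q_T^0(X)=X$, $Q_T^n(X)=Q_T(Q_T^{n-1}(X))$. $T$ admits the wandering subspace property if $\mathcal H$ is the closed linear span of $\{T^\alpha h:h\in\ker T^*,\alpha\in\mathbb Z_+^d\}$. For a matrix array $\mathscr A=[\![\mathscr A_{\alpha,\beta}]\!]_{\alpha,\beta\in\mathbb Z_+^d}$, the matrix backward shifts are $\sigma_j\mathscr A=[\![\mathscr A_{\alpha+\varepsilon_j,\beta+\varepsilon_j}]\!]_{\alpha,\beta}$, $j=1,\ldots,d$; they commute and $\sigma^\gamma\mathscr A=[\![\mathscr A_{\alpha+\gamma,\beta+\gamma}]\!]_{\alpha,\beta}$. For $n\in\mathbb Z_+$, $$\triangle_{\mathscr A,n}:=\sum_{j=0}^n(-1)^{j+n}\binom nj\sum_{|\gamma|=j}\frac{|\gamma|!}{\gamma!}\,\sigma^\gamma\mathscr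 A.$$ Each $\mathscr G_{\alpha,\beta}$ (matrix with row index $i$, column index $j$) is regarded as an operator on $\ell^2(I)$. For such a block matrix $\mathscr A$, $\mathscr A\geqslant0$ means $\sum_{\alpha,\beta\in B}\langle\mathscr A_{\alpha,\beta}C_\beta,C_\alpha\rangle\geqslant0$ for all finite $B\subseteq\mathbb Z_+^d$ and all finitely supported $C_\alpha\in\ell^2(I)$ ($\alpha\in B$). A $\mathcal B(\mathcal M)$-valued semispectral measure on $\partial\mathbb B^d$ is a finitely additive set function $F$ on the Borel sets of $\partial\mathbb B^d$ with values positive operators in $\mathcal B(\mathcal M)$ such that $\langle F(\cdot)x,y\rangle$ is a complex regular Borel measure for all $x,y\in\mathcal M$; integrals against $F$ are in the weak sense. *)

theory Defs
  imports "HOL-Analysis.Analysis"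
begin

text \<open>The complex inner product is linear in its first argument; its real part is the
  library's real inner product, so the norm and topology are the library's.\<close>

class complex_inner = real_inner +
  fixes scaleC :: "complex \<Rightarrow> 'a \<Rightarrow> 'a"  (infixr \<open>*\<^sub>C\<close> 75)
    and cinner :: "'a \<Rightarrow> 'a \<Rightarrow> complex"
  assumes scaleC_add_right: "c *\<^sub>C (x + y) = c *\<^sub>C x + c *\<^sub>C y"
    and scaleC_add_left: "(b + c) *\<^sub>C x = b *\<^sub>C x + c *\<^sub>C x"
    and scaleC_scaleC: "b *\<^sub>C c *\<^sub>C x = (b * c) *\<^sub>C x"
    and scaleC_of_real: "complex_of_real r *\<^sub>C x = scaleR r x"
    and cinner_commute: "cinner x y = cnj (cinner y x)"
    and cinner_add_left: "cinner (x + y) z = cinner x z + cinner y z"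
    and cinner_scaleC_left: "cinner (c *\<^sub>C x) y = c * cinner x y"
    and Re_cinner: "Re (cinner x y) = inner x y"

class chilbert_space = complex_inner + complete_space

interpretation complex_vector: vector_space "scaleC :: complex \<Rightarrow> 'a \<Rightarrow> 'a::complex_inner"
proof
  fix x :: 'a
  show "1 *\<^sub>C x = x"
    using scaleC_of_real[of 1 x] by simp
qed (simp_all add: scaleC_add_right scaleC_add_left scaleC_scaleC)

abbreviation cspan :: "'a::complex_inner set \<Rightarrow> 'a set"
  where "cspan \<equiv> complex_vector.span"

definition bounded_clinear :: "('a::complex_inner \<Rightarrow> 'b::complex_inner) \<Rightarrow> bool"
  where "bounded_clinear A \<longleftrightarrow> bounded_linear A \<and> (\<forall>c x. A (c *\<^sub>C x) = c *\<^sub>C A x)"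

text \<open>As for the library's \<^const>\<open>adjoint\<close>; for bounded operators on a Hilbert space the
  adjoint exists by the Riesz representation theorem and is unique.\<close>

definition cadjoint :: "('a::complex_inner \<Rightarrow> 'b::complex_inner) \<Rightarrow> 'b \<Rightarrow> 'a"
  where "cadjoint A = (SOME A'. \<forall>x y. cinner (A x) y = cinner x (A' y))"

definition positive_operator :: "('a::complex_inner \<Rightarrow> 'a) \<Rightarrow> bool"
  where "positive_operator A \<longleftrightarrow> bounded_clinear A \<and> (\<forall>x. cinner (A x) x \<in> \<real>\<^sub>\<ge>\<^sub>0)"

definition orthonormal_basis_of :: "('i \<Rightarrow> 'a::complex_inner) \<Rightarrow> 'a set \<Rightarrow> bool"
  where "orthonormal_basis_of f M \<longleftrightarrow>
    (\<forall>i j. cinner (f i) (f j) = (if i = j then 1 else 0)) \<and> closure (cspan (range f)) = M"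

typedef 'i ell2 = "{x :: 'i \<Rightarrow> complex. (\<lambda>i. (cmod (x i))\<^sup>2) summable_on UNIV}"
  morphisms ell2_nth Abs_ell2
  by (rule exI[of _ "\<lambda>_. 0"]) simp

lemma ell2_summable: "(\<lambda>i. (cmod (ell2_nth x i))\<^sup>2) summable_on UNIV"
  using ell2_nth[of x] by simp

lemma ell2_eqI: "(\<And>i. ell2_nth x i = ell2_nth y i) \<Longrightarrow> x = y"
  by (metis ell2_nth_inject ext)

lemma ell2_add_summable:
  assumes "(\<lambda>i. (cmod (x i))\<^sup>2) summable_on UNIV" "(\<lambda>i. (cmod (y i))\<^sup>2) summable_on UNIV"
  shows "(\<lambda>i. (cmod (x i + y i))\<^sup>2) summable_on UNIV"
proof (rule summable_on_comparison_test)
  show "(\<lambda>i. 2 * (cmod (x i))\<^sup>2 + 2 * (cmod (y i))\<^sup>2) summable_on UNIV"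
    using assms by (intro summable_on_add summable_on_cmult_right)
  fix i
  have "(cmod (x i + y i))\<^sup>2 \<le> (cmod (x i) + cmod (y i))\<^sup>2"
    by (intro power_mono norm_triangle_ineq) simp
  also have "\<dots> \<le> 2 * (cmod (x i))\<^sup>2 + 2 * (cmod (y i))\<^sup>2"
    using sum_squares_bound[of "cmod (x i)" "cmod (y i)"] by (simp add: power2_sum)
  finally show "(cmod (x i + y i))\<^sup>2 \<le> 2 * (cmod (x i))\<^sup>2 + 2 * (cmod (y i))\<^sup>2" .
qed auto

lemma ell2_scale_summable:
  assumes "(\<lambda>i. (cmod (x i))\<^sup>2) summable_on UNIV"
  shows "(\<lambda>i. (cmod (c * x i))\<^sup>2) summable_on UNIV"
  using summable_on_cmult_right[OF assms, of "(cmod c)\<^sup>2"]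
  by (simp add: norm_mult power_mult_distrib)

lemma ell2_mult_summable:
  "(\<lambda>i. ell2_nth x i * cnj (ell2_nth y i)) summable_on UNIV"
proof (rule abs_summable_summable, rule summable_on_comparison_test)
  show "(\<lambda>i. (cmod (ell2_nth x i))\<^sup>2 + (cmod (ell2_nth y i))\<^sup>2) summable_on UNIV"
    by (intro summable_on_add ell2_summable)
  fix i
  have "cmod (ell2_nth x i) * cmod (ell2_nth y i)
      \<le> 2 * cmod (ell2_nth x i) * cmod (ell2_nth y i)" by simp
  also have "\<dots> \<le> (cmod (ell2_nth x i))\<^sup>2 + (cmod (ell2_nth y i))\<^sup>2"
    by (rule sum_squares_bound)
  finally show "norm (ell2_nth x i * cnj (ell2_nth y i))
      \<le> (cmod (ell2_nth x i))\<^sup>2 + (cmod (ell2_nth y i))\<^sup>2"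
    by (simp add: norm_mult)
qed auto

instantiation ell2 :: (type) complex_inner
begin

definition zero_ell2 :: "'a ell2" where "zero_ell2 = Abs_ell2 (\<lambda>_. 0)"
definition plus_ell2 :: "'a ell2 \<Rightarrow> 'a ell2 \<Rightarrow> 'a ell2"
  where "plus_ell2 x y = Abs_ell2 (\<lambda>i. ell2_nth x i + ell2_nth y i)"
definition uminus_ell2 :: "'a ell2 \<Rightarrow> 'a ell2" where "uminus_ell2 x = Abs_ell2 (\<lambda>i. - ell2_nth x i)"
definition minus_ell2 :: "'a ell2 \<Rightarrow> 'a ell2 \<Rightarrow> 'a ell2"
  where "minus_ell2 x y = Abs_ell2 (\<lambda>i. ell2_nth x i - ell2_nth y i)"
definition scaleR_ell2 :: "real \<Rightarrow> 'a ell2 \<Rightarrow> 'a ell2"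
  where "scaleR_ell2 r x = Abs_ell2 (\<lambda>i. complex_of_real r * ell2_nth x i)"
definition scaleC_ell2 :: "complex \<Rightarrow> 'a ell2 \<Rightarrow> 'a ell2"
  where "scaleC_ell2 c x = Abs_ell2 (\<lambda>i. c * ell2_nth x i)"
definition cinner_ell2 :: "'a ell2 \<Rightarrow> 'a ell2 \<Rightarrow> complex"
  where "cinner_ell2 x y = (\<Sum>\<^sub>\<infinity>i. ell2_nth x i * cnj (ell2_nth y i))"
definition inner_ell2 :: "'a ell2 \<Rightarrow> 'a ell2 \<Rightarrow> real" where "inner_ell2 x y = Re (cinner x y)"
definition norm_ell2 :: "'a ell2 \<Rightarrow> real" where "norm_ell2 x = sqrt (inner x x)"
definition sgn_ell2 :: "'a ell2 \<Rightarrow> 'a ell2" where "sgn_ell2 x = scaleR (inverse (norm x)) x"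
definition dist_ell2 :: "'a ell2 \<Rightarrow> 'a ell2 \<Rightarrow> real" where "dist_ell2 x y = norm (x - y)"
definition uniformity_ell2 :: "('a ell2 \<times> 'a ell2) filter"
  where "uniformity_ell2 = (INF e\<in>{0<..}. principal {(x, y). dist x y < e})"
definition open_ell2 :: "'a ell2 set \<Rightarrow> bool"
  where "open_ell2 U \<longleftrightarrow> (\<forall>x\<in>U. eventually (\<lambda>(x', y). x' = x \<longrightarrow> y \<in> U) uniformity)"

lemma ell2_nth_zero [simp]: "ell2_nth 0 i = 0"
  by (simp add: zero_ell2_def Abs_ell2_inverse)

lemma ell2_nth_add [simp]: "ell2_nth (x + y) i = ell2_nth x i + ell2_nth y i"
  by (simp add: plus_ell2_def Abs_ell2_inverse ell2_add_summable ell2_summable)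

lemma ell2_nth_uminus [simp]: "ell2_nth (- x) i = - ell2_nth x i"
  by (simp add: uminus_ell2_def Abs_ell2_inverse ell2_summable)

lemma ell2_nth_minus [simp]: "ell2_nth (x - y) i = ell2_nth x i - ell2_nth y i"
  using ell2_add_summable[of "ell2_nth x" "\<lambda>i. - ell2_nth y i"]
  by (simp add: minus_ell2_def Abs_ell2_inverse ell2_summable)

lemma ell2_nth_scaleR [simp]: "ell2_nth (r *\<^sub>R x) i = complex_of_real r * ell2_nth x i"
  by (simp only: scaleR_ell2_def Abs_ell2_inverse ell2_scale_summable ell2_summable mem_Collect_eq)

lemma ell2_nth_scaleC [simp]: "ell2_nth (c *\<^sub>C x) i = c * ell2_nth x i"
  by (simp only: scaleC_ell2_def Abs_ell2_inverse ell2_scale_summable ell2_summable mem_Collect_eq)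

lemma ell2_cinner_self: "cinner x x = complex_of_real (\<Sum>\<^sub>\<infinity>i. (cmod (ell2_nth x i))\<^sup>2)"
  for x :: "'a ell2"
  unfolding cinner_ell2_def complex_norm_square[symmetric]
  by (intro infsumI has_sum_of_real has_sum_infsum ell2_summable)

instance
proof
  fix x y z :: "'a ell2" and a b :: real and c d :: complex
  show "x + y + z = x + (y + z)" "x + y = y + x" "0 + x = x" "- x + x = 0" "x - y = x + - y"
    "a *\<^sub>R (x + y) = a *\<^sub>R x + a *\<^sub>R y" "(a + b) *\<^sub>R x = a *\<^sub>R x + b *\<^sub>R x"
    "a *\<^sub>R b *\<^sub>R x = (a * b) *\<^sub>R x" "1 *\<^sub>R x = x"
    "c *\<^sub>C (x + y) = c *\<^sub>C x + c *\<^sub>C y" "(c + d) *\<^sub>C x = c *\<^sub>C x + d *\<^sub>C x"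
    "c *\<^sub>C d *\<^sub>C x = (c * d) *\<^sub>C x" "complex_of_real a *\<^sub>C x = a *\<^sub>R x"
    by (auto intro!: ell2_eqI simp: algebra_simps)
  show "sgn x = inverse (norm x) *\<^sub>R x" "dist x y = norm (x - y)"
    "(uniformity :: ('a ell2 \<times> 'a ell2) filter) = (INF e\<in>{0<..}. principal {(x, y). dist x y < e})"
    "norm x = sqrt (inner x x)" "Re (cinner x y) = inner x y"
    by (simp_all add: sgn_ell2_def dist_ell2_def uniformity_ell2_def norm_ell2_def inner_ell2_def)
  show "open U \<longleftrightarrow> (\<forall>x\<in>U. eventually (\<lambda>(x', y). x' = x \<longrightarrow> y \<in> U) uniformity)" for U :: "'a ell2 set"
    by (simp add: open_ell2_def)
  show comm: "cinner x y = cnj (cinner y x)" for x y :: "'a ell2"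
    unfolding cinner_ell2_def infsum_cnj[symmetric] by (simp add: mult.commute)
  show "inner x y = inner y x"
    using comm[of x y] by (simp add: inner_ell2_def)
  show add: "cinner (x + y) z = cinner x z + cinner y z"
    by (simp add: cinner_ell2_def distrib_right infsum_add ell2_mult_summable)
  then show "inner (x + y) z = inner x z + inner y z"
    by (simp add: inner_ell2_def)
  show scale: "cinner (c *\<^sub>C x) y = c * cinner x y" for c
    by (simp add: cinner_ell2_def mult.assoc infsum_cmult_right ell2_mult_summable)
  have "a *\<^sub>R x = complex_of_real a *\<^sub>C x"
    by (auto intro!: ell2_eqI)
  with scale[of "complex_of_real a"] show "inner (a *\<^sub>R x) y = a * inner x y"
    by (simp add: inner_ell2_def)
  show "0 \<le> inner x x"
    by (simp add: inner_ell2_def ell2_cinner_self infsum_nonneg)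
  show "inner x x = 0 \<longleftrightarrow> x = 0"
  proof
    assume "inner x x = 0"
    then have "(\<Sum>\<^sub>\<infinity>i. (cmod (ell2_nth x i))\<^sup>2) = 0"
      by (simp add: inner_ell2_def ell2_cinner_self)
    then have "(cmod (ell2_nth x i))\<^sup>2 = 0" for i
      by (rule nonneg_infsum_le_0D[OF eq_refl]) (auto simp: ell2_summable)
    then show "x = 0"
      by (intro ell2_eqI) simp
  next
    assume "x = 0"
    then show "inner x x = 0"
      by (simp add: inner_ell2_def cinner_ell2_def)
  qed
qed

end

lemma ell2_sum_le_norm:
  assumes "finite F"
  shows "(\<Sum>i\<in>F. (cmod (ell2_nth x i))\<^sup>2) \<le> (norm x)\<^sup>2"
proof -
  have "(norm x)\<^sup>2 = (\<Sum>\<^sub>\<infinity>i. (cmod (ell2_nth x i))\<^sup>2)"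
    by (simp add: power2_norm_eq_inner inner_ell2_def ell2_cinner_self)
  then show ?thesis
    using finite_sum_le_infsum[OF ell2_summable assms] by simp
qed

lemma ell2_norm_leI:
  assumes "0 \<le> e" "\<And>F. finite F \<Longrightarrow> (\<Sum>i\<in>F. (cmod (ell2_nth x i))\<^sup>2) \<le> e\<^sup>2"
  shows "norm x \<le> e"
proof -
  have "(norm x)\<^sup>2 = (\<Sum>\<^sub>\<infinity>i. (cmod (ell2_nth x i))\<^sup>2)"
    by (simp add: power2_norm_eq_inner inner_ell2_def ell2_cinner_self)
  also have "\<dots> \<le> e\<^sup>2"
    by (rule infsum_le_finite_sums[OF ell2_summable]) (use assms in auto)
  finally show ?thesis
    using assms(1) by (rule power2_le_imp_le)
qed

instance ell2 :: (type) chilbert_space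
proof
  fix X :: "nat \<Rightarrow> 'a ell2"
  assume X: "Cauchy X"
  have le: "cmod (ell2_nth x i) \<le> norm x" for x :: "'a ell2" and i
    using ell2_sum_le_norm[of "{i}" x] by (intro power2_le_imp_le[OF _ norm_ge_zero]) simp
  have "Cauchy (\<lambda>n. ell2_nth (X n) i)" for i
    unfolding Cauchy_def
  proof (intro allI impI)
    fix e :: real
    assume "e > 0"
    then obtain M where "\<And>m n. m \<ge> M \<Longrightarrow> n \<ge> M \<Longrightarrow> dist (X m) (X n) < e"
      using X unfolding Cauchy_def by blast
    moreover have "dist (ell2_nth (X m) i) (ell2_nth (X n) i) \<le> dist (X m) (X n)" for m n
      using le[of "X m - X n" i] by (simp add: dist_norm)
    ultimately show "\<exists>M. \<forall>m\<ge>M. \<forall>n\<ge>M. dist (ell2_nth (X m) i) (ell2_nth (X n) i) < e"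
      by (meson le_less_trans)
  qed
  then have "\<forall>i. \<exists>l. (\<lambda>n. ell2_nth (X n) i) \<longlonglongrightarrow> l"
    using Cauchy_convergent_iff convergent_def by blast
  then obtain l where l: "\<And>i. (\<lambda>n. ell2_nth (X n) i) \<longlonglongrightarrow> l i"
    by metis
  have bound: "(\<Sum>i\<in>F. (cmod (ell2_nth (X n) i - l i))\<^sup>2) \<le> e\<^sup>2"
    if M: "\<And>m n. m \<ge> M \<Longrightarrow> n \<ge> M \<Longrightarrow> dist (X m) (X n) < e" and "n \<ge> M" and "finite F"
    for e M n and F :: "'a set"
  proof (rule LIMSEQ_le_const2)
    show "(\<lambda>m. \<Sum>i\<in>F. (cmod (ell2_nth (X n) i - ell2_nth (X m) i))\<^sup>2)
        \<longlonglongrightarrow> (\<Sum>i\<in>F. (cmod (ell2_nth (X n) i - l i))\<^sup>2)"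
      by (intro tendsto_intros l)
    show "\<exists>N. \<forall>m\<ge>N. (\<Sum>i\<in>F. (cmod (ell2_nth (X n) i - ell2_nth (X m) i))\<^sup>2) \<le> e\<^sup>2"
    proof (intro exI allI impI)
      fix m
      assume "m \<ge> M"
      then have "norm (X n - X m) < e"
        using M[of n m] \<open>n \<ge> M\<close> by (simp add: dist_norm)
      then have "(norm (X n - X m))\<^sup>2 \<le> e\<^sup>2"
        by (intro power_mono) auto
      then show "(\<Sum>i\<in>F. (cmod (ell2_nth (X n) i - ell2_nth (X m) i))\<^sup>2) \<le> e\<^sup>2"
        using ell2_sum_le_norm[OF \<open>finite F\<close>, of "X n - X m"] by simp
    qed
  qed
  obtain M where M: "\<And>m n. m \<ge> M \<Longrightarrow> n \<ge> M \<Longrightarrow> dist (X m) (X n) < 1"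
    using X unfolding Cauchy_def by (meson zero_less_one)
  have "(\<lambda>i. (cmod (ell2_nth (X M) i - l i))\<^sup>2) summable_on UNIV"
  proof (rule nonneg_bdd_above_summable_on)
    show "bdd_above (sum (\<lambda>i. (cmod (ell2_nth (X M) i - l i))\<^sup>2) ` {F. F \<subseteq> UNIV \<and> finite F})"
      by (rule bdd_aboveI2[where M = "1\<^sup>2"], rule bound[OF M]) auto
  qed auto
  then have "(\<lambda>i. (cmod (- 1 * (ell2_nth (X M) i - l i)))\<^sup>2) summable_on UNIV"
    by (rule ell2_scale_summable)
  from ell2_add_summable[OF this ell2_summable[of "X M"]]
  have "(\<lambda>i. (cmod (l i))\<^sup>2) summable_on UNIV"
    by simp
  then have L: "ell2_nth (Abs_ell2 l) = l"
    by (simp add: Abs_ell2_inverse)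
  have "X \<longlonglongrightarrow> Abs_ell2 l"
  proof (rule LIMSEQ_I)
    fix e :: real
    assume "e > 0"
    then obtain M where M: "\<And>m n. m \<ge> M \<Longrightarrow> n \<ge> M \<Longrightarrow> dist (X m) (X n) < e / 2"
      using X unfolding Cauchy_def by (meson half_gt_zero)
    have "norm (X n - Abs_ell2 l) \<le> e / 2" if "n \<ge> M" for n
      by (rule ell2_norm_leI) (use \<open>e > 0\<close> bound[OF M that] in \<open>auto simp: L\<close>)
    then show "\<exists>no. \<forall>n\<ge>no. norm (X n - Abs_ell2 l) < e"
      using \<open>e > 0\<close> by (intro exI[of _ M]) fastforce
  qed
  then show "convergent X"
    by (auto simp: convergent_def)
qed

text \<open>The first argument of a matrix is the row index. The definition is meaningful for matrices
  of bounded operators, for which the row sums converge and the result is square summable; the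
  blocks of a Gramian matrix and their linear combinations are of this kind.\<close>

definition matrix_operator :: "('i \<Rightarrow> 'i \<Rightarrow> complex) \<Rightarrow> 'i ell2 \<Rightarrow> 'i ell2"
  where "matrix_operator A x = Abs_ell2 (\<lambda>i. \<Sum>\<^sub>\<infinity>j. A i j * ell2_nth x j)"

text \<open>The index set \<open>{1,\<dots>,d}\<close> is a finite linearly ordered type \<open>'d\<close>; multi-indices are elements
  of \<^typ>\<open>nat ^ 'd\<close>, and \<open>\<epsilon>\<^sub>j\<close> is \<^term>\<open>axis j 1\<close>.\<close>

definition commuting_tuple :: "('d \<Rightarrow> 'h \<Rightarrow> 'h::complex_inner) \<Rightarrow> bool"
  where "commuting_tuple T \<longleftrightarrow>
    (\<forall>j. bounded_clinear (T j)) \<and> (\<forall>j k. T j \<circ> T k = T k \<circ> T j)"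

definition tuple_power ::
    "('d::{finite,linorder} \<Rightarrow> 'h \<Rightarrow> 'h) \<Rightarrow> nat ^ 'd::{finite,linorder} \<Rightarrow> 'h \<Rightarrow> 'h"
  where "tuple_power T \<alpha> =
    foldr (\<lambda>j S. (T j ^^ (\<alpha> $ j)) \<circ> S) (sorted_list_of_set UNIV) id"

definition joint_kernel_adjoint :: "('d \<Rightarrow> 'h \<Rightarrow> 'h::complex_inner) \<Rightarrow> 'h set"
  where "joint_kernel_adjoint T = (\<Inter>j. {h. cadjoint (T j) h = 0})"

definition Q_map :: "('d::finite \<Rightarrow> 'h \<Rightarrow> 'h::complex_inner) \<Rightarrow> ('h \<Rightarrow> 'h) \<Rightarrow> 'h \<Rightarrow> 'h"
  where "Q_map T X = (\<lambda>h. \<Sum>j\<in>UNIV. cadjoint (T j) (X (T j h)))"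

definition joint_isometry :: "nat \<Rightarrow> ('d::finite \<Rightarrow> 'h \<Rightarrow> 'h::complex_inner) \<Rightarrow> bool"
  where "joint_isometry m T \<longleftrightarrow>
    (\<forall>h. (\<Sum>n\<le>m. ((- 1) ^ n * of_nat (m choose n)) *\<^sub>C ((Q_map T ^^ n) id) h) = 0)"

definition wandering_subspace_property ::
    "('d::{finite,linorder} \<Rightarrow> 'h \<Rightarrow> 'h::complex_inner) \<Rightarrow> bool"
  where "wandering_subspace_property T \<longleftrightarrow>
    closure (cspan {tuple_power T \<alpha> h | \<alpha> h. h \<in> joint_kernel_adjoint T}) = UNIV"

type_synonym ('d, 'i) matrix_array = "nat ^ 'd \<Rightarrow> nat ^ 'd \<Rightarrow> 'i \<Rightarrow> 'i \<Rightarrow> complex"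

definition index_abs :: "nat ^ 'd::finite \<Rightarrow> nat"
  where "index_abs \<gamma> = (\<Sum>j\<in>UNIV. \<gamma> $ j)"

definition index_fact :: "nat ^ 'd::finite \<Rightarrow> nat"
  where "index_fact \<gamma> = (\<Prod>j\<in>UNIV. fact (\<gamma> $ j))"

lemma finite_index_abs_eq: "finite {\<gamma> :: nat ^ 'd::finite. index_abs \<gamma> = k}"
proof (rule finite_subset)
  have "\<gamma> $ j \<le> index_abs \<gamma>" for \<gamma> :: "nat ^ 'd" and j
    unfolding index_abs_def by (rule member_le_sum) auto
  then show "{\<gamma> :: nat ^ 'd. index_abs \<gamma> = k} \<subseteq> vec_lambda ` (UNIV \<rightarrow>\<^sub>E {..k})"
    by (auto intro!: image_eqI[of _ _ "vec_nth _"])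
  show "finite (vec_lambda ` ((UNIV :: 'd set) \<rightarrow>\<^sub>E {..k}))"
    by (intro finite_imageI finite_PiE) auto
qed

definition backward_shift :: "'d::finite \<Rightarrow> ('d, 'i) matrix_array \<Rightarrow> ('d, 'i) matrix_array"
  where "backward_shift j A = (\<lambda>\<alpha> \<beta>. A (\<alpha> + axis j 1) (\<beta> + axis j 1))"

definition backward_shift_power ::
    "nat ^ 'd::finite \<Rightarrow> ('d, 'i) matrix_array \<Rightarrow> ('d, 'i) matrix_array"
  where "backward_shift_power \<gamma> A = (\<lambda>\<alpha> \<beta>. A (\<alpha> + \<gamma>) (\<beta> + \<gamma>))"

definition shift_sum :: "nat \<Rightarrow> ('d::finite, 'i) matrix_array \<Rightarrow> ('d, 'i) matrix_array"
  where "shift_sum k A = (\<lambda>\<alpha> \<beta> i l. \<Sum>\<gamma> | index_abs \<gamma> = k.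
    of_nat (fact (index_abs \<gamma>)) / of_nat (index_fact \<gamma>) * backward_shift_power \<gamma> A \<alpha> \<beta> i l)"

text \<open>Matrix arrays are kept as families of scalar entries, so linear combinations and equality
  of arrays are entrywise.\<close>

definition triangle :: "('d::finite, 'i) matrix_array \<Rightarrow> nat \<Rightarrow> ('d, 'i) matrix_array"
  where "triangle A n = (\<lambda>\<alpha> \<beta> i l. \<Sum>j\<le>n.
    (- 1) ^ (j + n) * of_nat (n choose j) * shift_sum j A \<alpha> \<beta> i l)"

definition gramian ::
    "('d::{finite,linorder} \<Rightarrow> 'h \<Rightarrow> 'h::complex_inner) \<Rightarrow> ('i \<Rightarrow> 'h) \<Rightarrow> ('d, 'i) matrix_array"
  where "gramian T f = (\<lambda>\<alpha> \<beta> i j. cinner (tuple_power T \<beta> (f j)) (tuple_power T \<alpha> (f i)))"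

definition nonneg_array :: "('d, 'i) matrix_array \<Rightarrow> bool"
  where "nonneg_array A \<longleftrightarrow>
    (\<forall>B C. finite B \<and> (\<forall>\<alpha>\<in>B. finite {i. ell2_nth (C \<alpha>) i \<noteq> 0}) \<longrightarrow>
      (\<Sum>\<alpha>\<in>B. \<Sum>\<beta>\<in>B. cinner (matrix_operator (A \<alpha> \<beta>) (C \<beta>)) (C \<alpha>)) \<in> \<real>\<^sub>\<ge>\<^sub>0)"

abbreviation borel_on :: "'a::topological_space set \<Rightarrow> 'a measure"
  where "borel_on S \<equiv> restrict_space borel S"

text \<open>Countable additivity on the Borel subsets of \<open>S\<close> (applied to the constant sequence of empty
  sets it gives \<open>\<mu> {} = 0\<close>), together with regularity in the sense of Dunford and Schwartz. The
  latter is equivalent to regularity of the total variation, which is at most four times the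
  supremum of the moduli of the values on subsets.\<close>

definition regular_complex_measure :: "'a::topological_space set \<Rightarrow> ('a set \<Rightarrow> complex) \<Rightarrow> bool"
  where "regular_complex_measure S \<mu> \<longleftrightarrow>
    (\<forall>A :: nat \<Rightarrow> 'a set. range A \<subseteq> sets (borel_on S) \<and> disjoint_family A \<longrightarrow>
      (\<lambda>n. \<mu> (A n)) sums \<mu> (\<Union>n. A n)) \<and>
    (\<forall>E\<in>sets (borel_on S). \<forall>\<epsilon>>0. \<exists>K U. compact K \<and> openin (top_of_set S) U \<and> K \<subseteq> E \<and> E \<subseteq> U \<and>
      (\<forall>A\<in>sets (borel_on S). A \<subseteq> U - K \<longrightarrow> cmod (\<mu> A) < \<epsilon>))"

text \<open>The integral of \<open>g\<close> against a complex measure \<open>\<mu> = \<nu>\<^sub>0 + i \<nu>\<^sub>1 - \<nu>\<^sub>2 - i \<nu>\<^sub>3\<close> with finite positive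
  measures \<open>\<nu>\<^sub>k\<close>. By the uniqueness lemma below the value does not depend on the
  decomposition; the Jordan decomposition is one possible choice.\<close>

definition has_complex_measure_integral ::
    "'a::topological_space set \<Rightarrow> ('a set \<Rightarrow> complex) \<Rightarrow> ('a \<Rightarrow> complex) \<Rightarrow> complex \<Rightarrow> bool"
  where "has_complex_measure_integral S \<mu> g L \<longleftrightarrow>
    (\<exists>\<nu> :: nat \<Rightarrow> 'a measure.
      (\<forall>k<4. finite_measure (\<nu> k) \<and> sets (\<nu> k) = sets (borel_on S) \<and> integrable (\<nu> k) g) \<and>
      (\<forall>A\<in>sets (borel_on S). \<mu> A = (\<Sum>k<4. \<i> ^ k * complex_of_real (measure (\<nu> k) A))) \<and>
      L = (\<Sum>k<4. \<i> ^ k * (\<integral>z. g z \<partial>\<nu> k)))"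

lemma nn_integral_sum_eq:
  assumes "\<And>k. k \<in> {M1, M2, N1, N2} \<Longrightarrow> sets k = sets M"
    and "\<And>A. A \<in> sets M \<Longrightarrow> emeasure M1 A + emeasure M2 A = emeasure N1 A + emeasure N2 A"
    and "g \<in> borel_measurable M"
  shows "(\<integral>\<^sup>+x. g x \<partial>M1) + (\<integral>\<^sup>+x. g x \<partial>M2) = (\<integral>\<^sup>+x. g x \<partial>N1) + (\<integral>\<^sup>+x. g x \<partial>N2)"
proof -
  have [measurable_cong]: "sets M1 = sets M" "sets M2 = sets M" "sets N1 = sets M" "sets N2 = sets M"
    using assms(1) by auto
  have sp: "space M1 = space M" "space M2 = space M" "space N1 = space M" "space N2 = space M"
    by (auto intro!: sets_eq_imp_space_eq assms(1))
  show ?thesis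
    using assms(3)
  proof (induction rule: borel_measurable_induct)
    case (cong f g)
    then show ?case by (metis (no_types, lifting) nn_integral_cong sp)
  next
    case (set A)
    then show ?case using assms(2) by simp
  next
    case (mult u c)
    then show ?case by (simp add: nn_integral_cmult flip: distrib_left)
  next
    case (add u v)
    then show ?case by (simp add: nn_integral_add) (metis (no_types, lifting) add.assoc add.commute)
  next
    case (seq U)
    have inc: "incseq (\<lambda>i. \<integral>\<^sup>+x. U i x \<partial>K)" for K :: "'a measure"
      using seq(3) by (auto simp: incseq_def le_fun_def intro!: nn_integral_mono)
    have *: "(\<integral>\<^sup>+x. (SUP i. U i) x \<partial>K) = (SUP i. \<integral>\<^sup>+x. U i x \<partial>K)"
      if [measurable_cong]: "sets K = sets M" for K
    proof -
      have "U i \<in> borel_measurable K" for i using seq(1)[of i] by measurable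
      then show ?thesis unfolding SUP_apply using seq(3) by (intro nn_integral_monotone_convergence_SUP)
    qed
    show ?case
      unfolding *[OF \<open>sets M1 = sets M\<close>] *[OF \<open>sets M2 = sets M\<close>]
        *[OF \<open>sets N1 = sets M\<close>] *[OF \<open>sets N2 = sets M\<close>]
      by (simp add: ennreal_SUP_add[OF inc inc, symmetric] seq.IH)
  qed
qed

lemma integral_sum_eq_real:
  fixes g :: "'a \<Rightarrow> real"
  assumes "\<And>k. k \<in> {M1, M2, N1, N2} \<Longrightarrow> sets k = sets M \<and> integrable k g"
    and "\<And>A. A \<in> sets M \<Longrightarrow> emeasure M1 A + emeasure M2 A = emeasure N1 A + emeasure N2 A"
  shows "(\<integral>x. g x \<partial>M1) + (\<integral>x. g x \<partial>M2) = (\<integral>x. g x \<partial>N1) + (\<integral>x. g x \<partial>N2)"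
proof -
  have g: "g \<in> borel_measurable M"
    using assms(1)[of M1] measurable_cong_sets[of M1 M borel borel] by auto
  have fin: "(\<integral>\<^sup>+x. ennreal (g x) \<partial>k) < \<infinity>" "(\<integral>\<^sup>+x. ennreal (- g x) \<partial>k) < \<infinity>"
    if "k \<in> {M1, M2, N1, N2}" for k
    using assms(1)[OF that] by (auto simp: real_integrable_def top.not_eq_extremum)
  have "(\<integral>\<^sup>+x. ennreal (g x) \<partial>M1) + (\<integral>\<^sup>+x. ennreal (g x) \<partial>M2)
      = (\<integral>\<^sup>+x. ennreal (g x) \<partial>N1) + (\<integral>\<^sup>+x. ennreal (g x) \<partial>N2)"
    using assms g by (intro nn_integral_sum_eq[where M = M]) auto
  from arg_cong[OF this, of enn2real]
  have "enn2real (\<integral>\<^sup>+x. ennreal (g x) \<partial>M1) + enn2real (\<integral>\<^sup>+x. ennreal (g x) \<partial>M2)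
      = enn2real (\<integral>\<^sup>+x. ennreal (g x) \<partial>N1) + enn2real (\<integral>\<^sup>+x. ennreal (g x) \<partial>N2)"
    using fin by (simp add: enn2real_plus)
  moreover have "(\<integral>\<^sup>+x. ennreal (- g x) \<partial>M1) + (\<integral>\<^sup>+x. ennreal (- g x) \<partial>M2)
      = (\<integral>\<^sup>+x. ennreal (- g x) \<partial>N1) + (\<integral>\<^sup>+x. ennreal (- g x) \<partial>N2)"
    using assms g by (intro nn_integral_sum_eq[where M = M]) auto
  from arg_cong[OF this, of enn2real]
  have "enn2real (\<integral>\<^sup>+x. ennreal (- g x) \<partial>M1) + enn2real (\<integral>\<^sup>+x. ennreal (- g x) \<partial>M2)
      = enn2real (\<integral>\<^sup>+x. ennreal (- g x) \<partial>N1) + enn2real (\<integral>\<^sup>+x. ennreal (- g x) \<partial>N2)"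
    using fin by (simp add: enn2real_plus)
  ultimately show ?thesis
    using assms(1) by (simp add: real_lebesgue_integral_def)
qed

lemma integral_sum_eq_complex:
  fixes g :: "'a \<Rightarrow> complex"
  assumes "\<And>k. k \<in> {M1, M2, N1, N2} \<Longrightarrow> finite_measure k \<and> sets k = sets M \<and> integrable k g"
    and "\<And>A. A \<in> sets M \<Longrightarrow> measure M1 A + measure M2 A = measure N1 A + measure N2 A"
  shows "(\<integral>x. g x \<partial>M1) + (\<integral>x. g x \<partial>M2) = (\<integral>x. g x \<partial>N1) + (\<integral>x. g x \<partial>N2)"
proof -
  have em: "emeasure k A = ennreal (measure k A)" if "k \<in> {M1, M2, N1, N2}" for k A
    using assms(1)[OF that] by (simp add: finite_measure.emeasure_eq_measure)
  have eq: "emeasure M1 A + emeasure M2 A = emeasure N1 A + emeasure N2 A" if "A \<in> sets M" for A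
    using assms(2)[OF that] by (simp add: em flip: ennreal_plus)
  have "(\<integral>x. Re (g x) \<partial>M1) + (\<integral>x. Re (g x) \<partial>M2) = (\<integral>x. Re (g x) \<partial>N1) + (\<integral>x. Re (g x) \<partial>N2)"
    by (rule integral_sum_eq_real[where M = M]) (use assms(1) eq in auto)
  moreover
  have "(\<integral>x. Im (g x) \<partial>M1) + (\<integral>x. Im (g x) \<partial>M2) = (\<integral>x. Im (g x) \<partial>N1) + (\<integral>x. Im (g x) \<partial>N2)"
    by (rule integral_sum_eq_real[where M = M]) (use assms(1) eq in auto)
  ultimately show ?thesis
    using assms(1) by (simp add: complex_eq_iff)
qed

lemma has_complex_measure_integral_unique:
  assumes "has_complex_measure_integral S \<mu> g L" "has_complex_measure_integral S \<mu> g L'"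
  shows "L = L'"
proof -
  obtain \<nu> where \<nu>: "\<And>k. k < 4 \<Longrightarrow> finite_measure (\<nu> k) \<and> sets (\<nu> k) = sets (borel_on S) \<and> integrable (\<nu> k) g"
    "\<And>A. A \<in> sets (borel_on S) \<Longrightarrow> \<mu> A = (\<Sum>k<4. \<i> ^ k * complex_of_real (measure (\<nu> k) A))"
    "L = (\<Sum>k<4. \<i> ^ k * (\<integral>z. g z \<partial>\<nu> k))"
    using assms(1) unfolding has_complex_measure_integral_def by blast
  obtain \<nu>' where \<nu>': "\<And>k. k < 4 \<Longrightarrow> finite_measure (\<nu>' k) \<and> sets (\<nu>' k) = sets (borel_on S) \<and> integrable (\<nu>' k) g"
    "\<And>A. A \<in> sets (borel_on S) \<Longrightarrow> \<mu> A = (\<Sum>k<4. \<i> ^ k * complex_of_real (measure (\<nu>' k) A))"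
    "L' = (\<Sum>k<4. \<i> ^ k * (\<integral>z. g z \<partial>\<nu>' k))"
    using assms(2) unfolding has_complex_measure_integral_def by blast
  have sum4: "(\<Sum>k<4. \<i> ^ k * h k) = h 0 + \<i> * h 1 - h 2 - \<i> * h 3" for h :: "nat \<Rightarrow> complex"
    by (simp add: eval_nat_numeral algebra_simps)
  have 1: "measure (\<nu> k) A + measure (\<nu>' (k + 2)) A = measure (\<nu>' k) A + measure (\<nu> (k + 2)) A"
    if "A \<in> sets (borel_on S)" "k = 0 \<or> k = 1" for k A
  proof -
    have "(\<Sum>k<4. \<i> ^ k * complex_of_real (measure (\<nu> k) A))
        = (\<Sum>k<4. \<i> ^ k * complex_of_real (measure (\<nu>' k) A))"
      using \<nu>(2) \<nu>'(2) that(1) by metis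
    then show ?thesis
      using that(2) unfolding sum4 by (auto simp: complex_eq_iff eval_nat_numeral)
  qed
  have 2: "(\<integral>z. g z \<partial>\<nu> k) + (\<integral>z. g z \<partial>\<nu>' (k + 2)) = (\<integral>z. g z \<partial>\<nu>' k) + (\<integral>z. g z \<partial>\<nu> (k + 2))"
    if "k = 0 \<or> k = 1" for k
    by (rule integral_sum_eq_complex[where M = "borel_on S"])
      (use that \<nu>(1) \<nu>'(1) 1[OF _ that] in auto)
  from 2[of 0] 2[of 1] show ?thesis
    unfolding \<nu>(3) \<nu>'(3) sum4 by (simp add: eval_nat_numeral algebra_simps) algebra
qed

definition semispectral_measure ::
    "'a::topological_space set \<Rightarrow> ('a set \<Rightarrow> 'm \<Rightarrow> 'm::chilbert_space) \<Rightarrow> bool"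
  where "semispectral_measure S F \<longleftrightarrow>
    (\<forall>A\<in>sets (borel_on S). positive_operator (F A)) \<and>
    (\<forall>A\<in>sets (borel_on S). \<forall>B\<in>sets (borel_on S). A \<inter> B = {} \<longrightarrow>
      (\<forall>x. F (A \<union> B) x = F A x + F B x)) \<and>
    (\<forall>x y. regular_complex_measure S (\<lambda>A. cinner (F A x) y))"

definition has_weak_integral ::
    "'a::topological_space set \<Rightarrow> ('a set \<Rightarrow> 'm \<Rightarrow> 'm::chilbert_space) \<Rightarrow> ('a \<Rightarrow> complex) \<Rightarrow>
      ('m \<Rightarrow> 'm) \<Rightarrow> bool"
  where "has_weak_integral S F g R \<longleftrightarrow>
    (\<forall>x y. has_complex_measure_integral S (\<lambda>A. cinner (F A x) y) g (cinner (R x) y))"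

end

theory Submission
  imports Defs "HOL-Library.Poly_Mapping" "HOL-Library.Multiset"
begin

text \<open>Since the backward shifts commute, \<open>\<triangle>\<^sub>n\<close> is the \<open>n\<close>-th binomial difference of the sequence of shift
  sums, so (ii), (iii) and (iv) are equivalent for every array. Each entry of \<open>\<triangle>\<^sub>m\<close> of the Gramian is
  a value of the \<open>m\<close>-th defect form of \<open>T\<close> at vectors \<open>T\<^sup>\<beta> f\<^sub>l\<close> and \<open>T\<^sup>\<alpha> f\<^sub>i\<close>, and these vectors are total by the
  wandering subspace property, which gives (i).

  If \<open>T\<close> is a joint \<open>m\<close>-isometry, the defect form \<open>B\<close> of order \<open>m - 1\<close> is the leading coefficient of the
  nonnegative polynomials \<open>k \<mapsto> \<langle>Q\<^sup>k(I)x, x\<rangle>\<close>, hence positive, and \<open>T\<close> is a spherical isometry for \<open>B\<close>. The formal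
  real coordinates of the sphere act on sesquilinear forms; \<open>(1 + c)/2\<close> and \<open>(1 - c)/2\<close> preserve the positive
  \<open>T\<close>-invariant forms for each coordinate \<open>c\<close>, because
  \<open>2 + 2 Re z\<^sub>j = |1 + z\<^sub>j|\<^sup>2 + \<Sum>\<^sub>k\<^sub>\<noteq>\<^sub>j |z\<^sub>k|\<^sup>2\<close> on the sphere. So the moments of \<open>B(x, x)\<close> are completely monotone, and
  the Hausdorff moment problem on a cube (Bernstein sums and the Riesz-Markov theorem) yields a representing
  measure; it lives on the sphere because it annihilates \<open>(|z|\<^sup>2 - 1)\<^sup>2\<close>. Its moments determine it, so these
  measures depend quadratically on \<open>x\<close>, and polarization gives \<open>F\<close>.\<close>

section \<open>Bounded sesquilinear forms on Hilbert spaces\<close>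

text \<open>The form \<open>B\<close> may be degenerate, and \<open>T j\<close> need not have an
  adjoint with respect to it on the given space. The usual road would pass to a quotient, complete
  it, and extend the spherical isometry found there to a normal tuple. Acting on forms avoids all of
  this: multiplication by a coordinate becomes an application of \<open>T j\<close> in the second
  argument, multiplication by its conjugate an application in the first, and such operations commute
  although no adjoint is ever formed. Complete monotonicity speaks of real variables in [0, 1];
  hence the 2d real coordinates c and their normalisation (1 + c)/2, which is undone by the affine
  map \<open>scaled\<close> once a measure on the unit cube is found. The link between the space and
  \<open>ell2\<close> is the synthesis map V that sends the unit vectors to the basis
  \<open>f\<close>. The block of the triangle of order m - 1 at \<alpha>, \<beta> is the operator of
  the form B(T^\<beta> V x, T^\<alpha> V y), so positivity of the array and the integral formula are
  both read off from \<open>B\<close>.\<close>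

lemma cinner_add_right: "cinner x (y + z) = cinner x y + cinner x z"
  using cinner_add_left[of y z x] cinner_commute by (metis complex_cnj_add)

lemma cinner_scaleC_right: "cinner x (c *\<^sub>C y) = cnj c * cinner x y"
  using cinner_scaleC_left[of c y x] cinner_commute by (metis complex_cnj_mult)

lemma cinner_zero_left [simp]: "cinner 0 y = 0"
  using cinner_add_left[of 0 0 y] by simp

lemma cinner_zero_right [simp]: "cinner x 0 = 0"
  using cinner_add_right[of x 0 0] by simp

lemma scaleC_minus_one: "(- 1) *\<^sub>C x = - x"
  using scaleC_of_real[of "- 1" x] by simp

lemma cinner_minus_left: "cinner (- x) y = - cinner x y"
  using cinner_scaleC_left[of "- 1" x y] by (simp add: scaleC_minus_one)

lemma cinner_minus_right: "cinner x (- y) = - cinner x y"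
  using cinner_scaleC_right[of x "- 1" y] by (simp add: scaleC_minus_one)

lemma cinner_diff_left: "cinner (x - y) z = cinner x z - cinner y z"
  using cinner_add_left[of x "- y" z] by (simp add: cinner_minus_left)

lemma cinner_diff_right: "cinner x (y - z) = cinner x y - cinner x z"
  using cinner_add_right[of x y "- z"] by (simp add: cinner_minus_right)

lemma cinner_sum_left: "cinner (\<Sum>i\<in>I. f i) y = (\<Sum>i\<in>I. cinner (f i) y)"
  by (induction I rule: infinite_finite_induct) (auto simp: cinner_add_left)

lemma cinner_sum_right: "cinner x (\<Sum>i\<in>I. f i) = (\<Sum>i\<in>I. cinner x (f i))"
  by (induction I rule: infinite_finite_induct) (auto simp: cinner_add_right)

lemma cinner_self: "cinner x x = complex_of_real ((norm x)\<^sup>2)"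
proof -
  have "Im (cinner x x) = 0" using arg_cong[OF cinner_commute[of x x], of Im] by simp
  then show ?thesis by (simp add: complex_eq_iff Re_cinner power2_norm_eq_inner)
qed

lemma norm_scaleC: "norm (c *\<^sub>C x) = cmod c * norm x"
proof -
  have "complex_of_real ((norm (c *\<^sub>C x))\<^sup>2) = c * cnj c * complex_of_real ((norm x)\<^sup>2)"
    by (simp only: cinner_self[symmetric] cinner_scaleC_left cinner_scaleC_right mult_ac)
  also have "\<dots> = complex_of_real ((cmod c * norm x)\<^sup>2)"
    by (simp add: complex_norm_square[symmetric] power_mult_distrib)
  finally have "(norm (c *\<^sub>C x))\<^sup>2 = (cmod c * norm x)\<^sup>2" by (simp only: of_real_eq_iff)
  then show ?thesis by (simp add: power2_eq_iff_nonneg)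
qed

lemma cmod_cinner_le: "cmod (cinner x y) \<le> norm x * norm y"
proof (cases "cinner x y = 0")
  case False
  \<comment> \<open>A unimodular factor that rotates the inner product onto the positive real axis,
    where the real Cauchy-Schwarz inequality applies.\<close>
  define u where "u = cnj (cinner x y) / cmod (cinner x y)"
  have "complex_of_real (cmod (cinner x y)) = u * cinner x y"
    using False by (simp add: u_def mult.commute complex_norm_square[symmetric] power2_eq_square)
  also have "\<dots> = cinner (u *\<^sub>C x) y" by (simp add: cinner_scaleC_left)
  finally have "cmod (cinner x y) = Re (cinner (u *\<^sub>C x) y)" by (metis Re_complex_of_real)
  also have "\<dots> \<le> norm (u *\<^sub>C x) * norm y" by (simp add: Re_cinner norm_cauchy_schwarz)
  also have "norm (u *\<^sub>C x) = norm x" using False by (simp add: norm_scaleC u_def norm_divide)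
  finally show ?thesis .
qed simp

lemma cinner_ext:
  assumes "\<And>y. cinner x y = cinner x' y"
  shows "x = x'"
proof -
  have "cinner (x - x') (x - x') = 0" using assms by (simp add: cinner_diff_left)
  then show ?thesis by (simp add: cinner_self)
qed

text \<open>If u represents \<open>\<phi>\<close>, then \<open>J x\<close> is |x - u|^2 - |u|^2, so
  u is sought as the minimiser of \<open>J\<close>; completeness supplies the limit of a minimising
  sequence.\<close>

lemma riesz_representation:
  fixes \<phi> :: "'a::{real_inner, complete_space} \<Rightarrow> real"
  assumes "bounded_linear \<phi>"
  shows "\<exists>u. \<forall>x. \<phi> x = x \<bullet> u"
proof -
  interpret bounded_linear \<phi> by fact
  obtain K where K: "\<And>x. norm (\<phi> x) \<le> norm x * K" using bounded by blast
  define J where "J x = x \<bullet> x - 2 * \<phi> x" for x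
  have lower: "- K\<^sup>2 \<le> J x" for x
  proof -
    have "0 \<le> (norm x - K)\<^sup>2" by simp
    then show ?thesis using K[of x] by (simp add: J_def power2_diff flip: power2_norm_eq_inner)
  qed
  then have bdd: "bdd_below (range J)" by (rule bdd_belowI2)
  define d where "d = (INF x. J x)"
  have dJ: "d \<le> J x" for x unfolding d_def using bdd by (rule cINF_lower) simp
  \<comment> \<open>The parallelogram identity at the midpoint, where \<open>J\<close> is still at
    least \<open>d\<close>, makes every minimising sequence Cauchy.\<close>
  have par: "(norm (x - y))\<^sup>2 \<le> 2 * (J x - d) + 2 * (J y - d)" for x y
  proof -
    define q where "q = J ((1/2) *\<^sub>R (x + y))"
    have "2 * J x + 2 * J y - 4 * q = (norm (x - y))\<^sup>2"
      by (simp add: q_def J_def add scaleR inner_add inner_commute[of y x] power2_norm_eq_inner inner_diff field_simps)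
    moreover have "d \<le> q" unfolding q_def by (rule dJ)
    ultimately show ?thesis by (simp add: algebra_simps)
  qed
  have "\<exists>x. J x < d + inverse (real (Suc n))" for n
  proof -
    have "(INF x. J x) < d + inverse (real (Suc n))" unfolding d_def by simp
    then show ?thesis using bdd by (simp add: cINF_less_iff)
  qed
  then obtain X where X: "\<And>n. J (X n) < d + inverse (real (Suc n))" by metis
  have "Cauchy X"
  proof (rule CauchyI)
    fix e :: real assume e: "0 < e"
    then obtain M where M: "inverse (real (Suc M)) < e\<^sup>2 / 4" using reals_Archimedean[of "e\<^sup>2/4"] by auto
    show "\<exists>M. \<forall>m\<ge>M. \<forall>n\<ge>M. norm (X m - X n) < e"
    proof (intro exI allI impI)
      fix m n assume "M \<le> m" "M \<le> n"
      then have "inverse (real (Suc m)) \<le> inverse (real (Suc M))" "inverse (real (Suc n)) \<le> inverse (real (Suc M))"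
        by (auto intro!: le_imp_inverse_le)
      then have "J (X m) < d + e\<^sup>2 / 4" "J (X n) < d + e\<^sup>2 / 4"
        using X[of m] X[of n] M by (meson add_left_mono less_le_trans less_imp_le le_less_trans order_less_trans)+
      then have "(norm (X m - X n))\<^sup>2 < e\<^sup>2"
        using par[of "X m" "X n"] by (simp add: field_simps)
      then show "norm (X m - X n) < e" using e by (simp add: power2_less_imp_less)
    qed
  qed
  then obtain u where u: "X \<longlonglongrightarrow> u" using Cauchy_convergent convergent_def by blast
  have "(\<lambda>n. J (X n)) \<longlonglongrightarrow> J u" unfolding J_def by (intro tendsto_intros u tendsto)
  moreover have "(\<lambda>n. d + inverse (real (Suc n))) \<longlonglongrightarrow> d + 0"
    by (intro tendsto_intros LIMSEQ_inverse_real_of_nat)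
  ultimately have "J u \<le> d + 0"
    using X by (intro LIMSEQ_le) (auto intro: less_imp_le exI[of _ 0])
  then have Ju: "J u \<le> J x" for x using dJ[of x] by simp
  have "\<phi> v = v \<bullet> u" for v
  proof -
    define s where "s = u \<bullet> v - \<phi> v"
    \<comment> \<open>First variation at the minimiser: a quadratic in \<open>t\<close> without
      constant term stays nonnegative, so its linear coefficient must vanish.\<close>
    have quad: "0 \<le> t\<^sup>2 * (v \<bullet> v) + 2 * t * s" for t
      using Ju[of "u + t *\<^sub>R v"]
      by (simp add: J_def s_def add scaleR inner_add inner_commute power2_eq_square algebra_simps)
    have "s = 0"
    proof (cases "v \<bullet> v = 0")
      case True
      then show ?thesis using quad[of "- s"] by (auto simp: mult_le_0_iff)
    next
      case False
      then have p: "v \<bullet> v > 0" by (simp add: less_le)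
      have "0 \<le> - (s\<^sup>2 / (v \<bullet> v))"
        using quad[of "- s / (v \<bullet> v)"] p by (simp add: power2_eq_square power_divide)
      then show ?thesis using p by (simp add: divide_le_0_iff)
    qed
    then show ?thesis by (simp add: s_def inner_commute)
  qed
  then show ?thesis by blast
qed

section \<open>Sesquilinear forms and the operators that represent them\<close>

definition sesquilinear :: "('a::complex_inner \<Rightarrow> 'b::complex_inner \<Rightarrow> complex) \<Rightarrow> bool" where
  "sesquilinear b \<longleftrightarrow>
    (\<forall>x x' y. b (x + x') y = b x y + b x' y) \<and> (\<forall>c x y. b (c *\<^sub>C x) y = c * b x y) \<and>
    (\<forall>x y y'. b x (y + y') = b x y + b x y') \<and> (\<forall>c x y. b x (c *\<^sub>C y) = cnj c * b x y)"

lemma sesquilinearI: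
  assumes "\<And>x x' y. b (x + x') y = b x y + b x' y" "\<And>c x y. b (c *\<^sub>C x) y = c * b x y"
    "\<And>x y y'. b x (y + y') = b x y + b x y'" "\<And>c x y. b x (c *\<^sub>C y) = cnj c * b x y"
  shows "sesquilinear b"
  using assms by (simp add: sesquilinear_def)

lemma sesquilinear_simps:
  assumes "sesquilinear b"
  shows "b (x + x') y = b x y + b x' y" "b (c *\<^sub>C x) y = c * b x y"
    "b x (y + y') = b x y + b x y'" "b x (c *\<^sub>C y) = cnj c * b x y"
    "b 0 y = 0" "b x 0 = 0" "b (- x) y = - b x y" "b x (- y) = - b x y"
    "b (x - x') y = b x y - b x' y" "b x (y - y') = b x y - b x y'"
proof -
  note 1 = assms[unfolded sesquilinear_def]
  show "b (x + x') y = b x y + b x' y" "b (c *\<^sub>C x) y = c * b x y"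
    "b x (y + y') = b x y + b x y'" "b x (c *\<^sub>C y) = cnj c * b x y" for x x' y y' c
    using 1 by auto
  then have 2: "b (x - x') y = b x y + (-1) * b x' y" "b x (y - y') = b x y + cnj (-1) * b x y'" for x x' y y'
    by (metis scaleC_minus_one diff_conv_add_uminus)+
  then show "b (x - x') y = b x y - b x' y" "b x (y - y') = b x y - b x y'" for x x' y y' by auto
  from this(1)[of 0 0] this(2)[of _ 0 0] show 3: "b 0 y = 0" "b x 0 = 0" for x y by auto
  show "b (- x) y = - b x y" "b x (- y) = - b x y" using 2(1)[of 0 x y] 2(2)[of x 0 y] 3 by auto
qed

lemma sesquilinear_sum:
  assumes "sesquilinear b"
  shows "b (\<Sum>i\<in>I. f i) y = (\<Sum>i\<in>I. b (f i) y)" "b x (\<Sum>i\<in>I. g i) = (\<Sum>i\<in>I. b x (g i))"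
  by (induction I rule: infinite_finite_induct; simp add: sesquilinear_simps[OF assms])+

lemma sesquilinear_cinner: "sesquilinear cinner"
  by (intro sesquilinearI) (simp_all add: cinner_add_left cinner_scaleC_left cinner_add_right cinner_scaleC_right)

definition bounded_sesquilinear :: "('a::complex_inner \<Rightarrow> 'b::complex_inner \<Rightarrow> complex) \<Rightarrow> bool" where
  "bounded_sesquilinear b \<longleftrightarrow> sesquilinear b \<and> (\<exists>K. \<forall>x y. cmod (b x y) \<le> K * (norm x * norm y))"

lemma bounded_sesquilinear_bound:
  assumes "bounded_sesquilinear b"
  obtains K where "K > 0" "\<And>x y. cmod (b x y) \<le> K * (norm x * norm y)"
proof -
  obtain K where K: "\<And>x y. cmod (b x y) \<le> K * (norm x * norm y)"
    using assms by (auto simp: bounded_sesquilinear_def)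
  have "cmod (b x y) \<le> max K 1 * (norm x * norm y)" for x y
    by (rule order_trans[OF K mult_right_mono]) auto
  then show ?thesis using that[of "max K 1"] by auto
qed

lemma bounded_sesquilinear_cinner: "bounded_sesquilinear cinner"
  unfolding bounded_sesquilinear_def
  using sesquilinear_cinner cmod_cinner_le by (auto intro!: exI[of _ 1])

text \<open>Polarization yields bounds of this additive kind. On unit vectors the right-hand side is
  4 \<open>K\<close>, and homogeneity carries that constant to all vectors.\<close>

lemma bounded_sesquilinearI:
  assumes b: "sesquilinear b" and K: "\<And>x y. cmod (b x y) \<le> K * (norm x + norm y)\<^sup>2"
  shows "bounded_sesquilinear b"
  unfolding bounded_sesquilinear_def
proof (intro conjI exI allI b)
  fix x y
  note bs = sesquilinear_simps[OF b]
  show "cmod (b x y) \<le> (4 * K) * (norm x * norm y)"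
  proof (cases "x = 0 \<or> y = 0")
    case True
    then show ?thesis by (auto simp: bs)
  next
    case False
    define x' where "x' = complex_of_real (inverse (norm x)) *\<^sub>C x"
    define y' where "y' = complex_of_real (inverse (norm y)) *\<^sub>C y"
    have "norm x' = 1" "norm y' = 1" using False by (auto simp: x'_def y'_def norm_scaleC norm_inverse)
    moreover have "b x' y' = complex_of_real (inverse (norm x) * inverse (norm y)) * b x y"
      by (simp only: x'_def y'_def bs complex_cnj_complex_of_real of_real_mult mult_ac)
    ultimately have "inverse (norm x) * inverse (norm y) * cmod (b x y) \<le> K * 4"
      using K[of x' y'] by (simp add: norm_mult norm_inverse)
    then show ?thesis using False by (simp add: field_simps)
  qed
qed

lemma bounded_clinearD:
  assumes "bounded_clinear A"
  shows "A (x + y) = A x + A y" "A (c *\<^sub>C x) = c *\<^sub>C A x" "\<exists>K>0. \<forall>x. norm (A x) \<le> K * norm x"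
proof -
  interpret bounded_linear A using assms by (simp add: bounded_clinear_def)
  show "A (x + y) = A x + A y" by (rule add)
  show "A (c *\<^sub>C x) = c *\<^sub>C A x" using assms by (simp add: bounded_clinear_def)
  show "\<exists>K>0. \<forall>x. norm (A x) \<le> K * norm x" using pos_bounded by (auto simp: mult.commute)
qed

lemma bounded_clinearI:
  assumes add: "\<And>x y. A (x + y) = A x + A y" and scale: "\<And>c x. A (c *\<^sub>C x) = c *\<^sub>C A x"
    and bound: "\<And>x. norm (A x) \<le> K * norm x"
  shows "bounded_clinear A"
  unfolding bounded_clinear_def
proof (intro conjI allI scale bounded_linear_intro[of _ K])
  fix r x show "A (r *\<^sub>R x) = r *\<^sub>R A x" using scale[of "complex_of_real r" x] by (simp add: scaleC_of_real)
  show "norm (A x) \<le> norm x * K" using bound[of x] by (simp add: mult.commute)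
qed (rule add)

lemma bounded_sesquilinear_compose:
  assumes b: "bounded_sesquilinear b" and A: "bounded_clinear A" and B: "bounded_clinear B"
  shows "bounded_sesquilinear (\<lambda>x y. b (A x) (B y))"
proof -
  obtain K where K: "K > 0" "\<And>x y. cmod (b x y) \<le> K * (norm x * norm y)"
    using bounded_sesquilinear_bound[OF b] by blast
  obtain KA KB where KA: "KA > 0" "\<And>x. norm (A x) \<le> KA * norm x" and KB: "KB > 0" "\<And>x. norm (B x) \<le> KB * norm x"
    using bounded_clinearD(3)[OF A] bounded_clinearD(3)[OF B] by blast
  have "cmod (b (A x) (B y)) \<le> K * KA * KB * (norm x * norm y)" for x y
  proof -
    have "cmod (b (A x) (B y)) \<le> K * ((KA * norm x) * (KB * norm y))"
      using K KA KB by (intro order_trans[OF K(2)] mult_left_mono mult_mono) auto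
    then show ?thesis by (simp add: algebra_simps)
  qed
  moreover have "sesquilinear (\<lambda>x y. b (A x) (B y))"
    using b unfolding bounded_sesquilinear_def
    by (intro sesquilinearI) (auto simp: bounded_clinearD[OF A] bounded_clinearD[OF B] sesquilinear_simps)
  ultimately show ?thesis by (auto simp: bounded_sesquilinear_def)
qed

text \<open>Real Riesz representation gives the real part of \<open>b x\<close>; replacing y by iy
  turns the real part into the imaginary part, so the same vector represents \<open>b x\<close>
  completely.\<close>

lemma bounded_sesquilinear_operator:
  fixes b :: "'a::complex_inner \<Rightarrow> 'b::chilbert_space \<Rightarrow> complex"
  assumes b: "bounded_sesquilinear b"
  shows "\<exists>M. bounded_clinear M \<and> (\<forall>x y. b x y = cinner (M x) y)"
proof -
  obtain K where K: "K > 0" "\<And>x y. cmod (b x y) \<le> K * (norm x * norm y)"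
    using bounded_sesquilinear_bound[OF b] by blast
  note bs = sesquilinear_simps[OF b[unfolded bounded_sesquilinear_def, THEN conjunct1]]
  have "\<exists>u. \<forall>y. b x y = cinner u y" for x
  proof -
    have "bounded_linear (\<lambda>y. Re (b x y))"
    proof (rule bounded_linear_intro)
      fix y z and r :: real
      show "Re (b x (y + z)) = Re (b x y) + Re (b x z)" by (simp add: bs)
      show "Re (b x (r *\<^sub>R y)) = r *\<^sub>R Re (b x y)" using bs(4)[of x "complex_of_real r" y] by (simp add: scaleC_of_real)
      have "\<bar>Re (b x y)\<bar> \<le> cmod (b x y)" by (rule abs_Re_le_cmod)
      also have "\<dots> \<le> K * (norm x * norm y)" by (rule K)
      finally show "norm (Re (b x y)) \<le> norm y * (K * norm x)" by (simp add: algebra_simps)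
    qed
    then obtain u where u: "\<And>y. Re (b x y) = y \<bullet> u" using riesz_representation by blast
    have Re: "Re (b x y) = Re (cinner u y)" for y by (simp add: u Re_cinner inner_commute)
    have "Im (b x y) = Im (cinner u y)" for y
      using Re[of "\<i> *\<^sub>C y"] by (simp add: bs cinner_scaleC_right)
    then show ?thesis using Re by (auto simp: complex_eq_iff)
  qed
  then obtain M where M: "\<And>x y. b x y = cinner (M x) y" by metis
  have "bounded_clinear M"
  proof (rule bounded_clinearI)
    show "M (x + y) = M x + M y" for x y
      by (rule cinner_ext) (simp add: M[symmetric] bs cinner_add_left)
    show "M (c *\<^sub>C x) = c *\<^sub>C M x" for c x
      by (rule cinner_ext) (simp add: M[symmetric] bs cinner_scaleC_left)
    show "norm (M x) \<le> K * norm x" for x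
    proof (cases "M x = 0")
      case False
      have "(norm (M x))\<^sup>2 = cmod (b x (M x))" by (simp add: M cinner_self norm_power)
      then have "norm (M x) * norm (M x) \<le> (K * norm x) * norm (M x)"
        using K(2)[of x "M x"] by (simp add: power2_eq_square algebra_simps)
      then show ?thesis using False by simp
    qed (use K in simp)
  qed
  then show ?thesis using M by blast
qed

text \<open>The choice in \<open>cadjoint\<close> has a witness: the operator that represents the
  bounded form sending y, x to the inner product of y with \<open>A x\<close>.\<close>

lemma cadjoint:
  fixes A :: "'a::chilbert_space \<Rightarrow> 'b::complex_inner"
  assumes "bounded_clinear A"
  shows "cinner (A x) y = cinner x (cadjoint A y)"
proof -
  have "bounded_clinear (\<lambda>x :: 'b. x)" by (rule bounded_clinearI[of _ 1]) auto
  then obtain M where M: "\<And>y x. cinner y (A x) = cinner (M y) x"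
    using bounded_sesquilinear_operator[OF bounded_sesquilinear_compose[OF bounded_sesquilinear_cinner _ assms]] by blast
  have "\<forall>x y. cinner (A x) y = cinner x (M y)"
    using M by (metis cinner_commute)
  then have "\<forall>x y. cinner (A x) y = cinner x (cadjoint A y)"
    unfolding cadjoint_def
    using someI[of "\<lambda>A'. \<forall>x y. cinner (A x) y = cinner x (A' y)" M] by blast
  then show ?thesis by blast
qed

section \<open>The Riesz-Markov theorem on compact metric spaces\<close>

lemma AE_mem_compact:
  fixes K :: "'a::metric_space set"
  assumes "sets M = sets borel" "emeasure M (- K) = 0" "compact K"
  shows "AE x in M. x \<in> K"
  using assms borel_closed[OF compact_imp_closed[OF assms(3)]] by (intro AE_I[of _ _ "- K"]) auto

text \<open>All measures here live on the whole space and are concentrated on a compact set, so a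
  continuous integrand is bounded almost everywhere.\<close>

lemma integrable_continuous:
  fixes K :: "'a::metric_space set" and f :: "'a \<Rightarrow> 'b::{banach, second_countable_topology}"
  assumes M: "finite_measure M" "sets M = sets borel" "emeasure M (- K) = 0" "compact K"
    and f: "continuous_on UNIV f"
  shows "integrable M f"
proof -
  interpret finite_measure M by (rule M)
  obtain B where B: "\<And>x. x \<in> K \<Longrightarrow> norm (f x) \<le> B"
    using compact_imp_bounded[OF compact_continuous_image[OF continuous_on_subset[OF f] M(4)]]
    by (auto simp: bounded_iff)
  have "AE x in M. norm (f x) \<le> B"
    using AE_mem_compact[OF M(2-4)] B by (auto elim: eventually_mono)
  moreover have "f \<in> borel_measurable M"
    using borel_measurable_continuous_onI[OF f] measurable_cong_sets[OF M(2) refl] by blast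
  ultimately show ?thesis by (intro integrable_const_bound)
qed

text \<open>Functions are continuous on the whole space while positivity is tested on
  \<open>K\<close> only. Thus \<open>L f\<close> depends only on the values of \<open>f\<close> on
  \<open>K\<close>, and no function has to be extended from \<open>K\<close>.\<close>

locale positive_functional =
  fixes K :: "'a::metric_space set" and L :: "('a \<Rightarrow> real) \<Rightarrow> real"
  assumes compact_K: "compact K"
    and L_add: "\<lbrakk>continuous_on UNIV f; continuous_on UNIV g\<rbrakk> \<Longrightarrow> L (\<lambda>x. f x + g x) = L f + L g"
    and L_scale: "continuous_on UNIV f \<Longrightarrow> L (\<lambda>x. c * f x) = c * L f"
    and L_nonneg: "\<lbrakk>continuous_on UNIV f; \<And>x. x \<in> K \<Longrightarrow> 0 \<le> f x\<rbrakk> \<Longrightarrow> 0 \<le> L f"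
begin

lemma L_diff:
  assumes "continuous_on UNIV f" "continuous_on UNIV g"
  shows "L (\<lambda>x. f x - g x) = L f - L g"
  using L_add[OF assms(1) continuous_on_mult_left[OF assms(2), of "-1"]] L_scale[OF assms(2), of "-1"]
  by simp

lemma L_mono:
  assumes "continuous_on UNIV f" "continuous_on UNIV g" "\<And>x. x \<in> K \<Longrightarrow> f x \<le> g x"
  shows "L f \<le> L g"
  using L_nonneg[of "\<lambda>x. g x - f x"] L_diff[OF assms(2,1)] assms by (simp add: continuous_on_diff)

lemma L_const: "L (\<lambda>x. c) = c * L (\<lambda>x. 1)"
  using L_scale[of "\<lambda>x. 1" c] by simp

lemma L_sum:
  assumes "finite I" "\<And>i. i \<in> I \<Longrightarrow> continuous_on UNIV (f i)"
  shows "L (\<lambda>x. \<Sum>i\<in>I. f i x) = (\<Sum>i\<in>I. L (f i))"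
  using assms
proof (induction I rule: finite_induct)
  case empty
  then show ?case using L_const[of 0] by simp
next
  case (insert i I)
  then have "L (\<lambda>x. f i x + (\<Sum>i\<in>I. f i x)) = L (f i) + L (\<lambda>x. \<Sum>i\<in>I. f i x)"
    by (intro L_add continuous_on_sum) auto
  with insert show ?case by simp
qed

section \<open>The outer measure induced by a positive functional\<close>

definition minorants :: "'a set \<Rightarrow> ('a \<Rightarrow> real) set" where
  "minorants U = {f. continuous_on UNIV f \<and> (\<forall>x. 0 \<le> f x \<and> f x \<le> indicator U x)}"

lemma minorantsD:
  assumes "f \<in> minorants U"
  shows "continuous_on UNIV f" "0 \<le> f x" "f x \<le> 1" "x \<notin> U \<Longrightarrow> f x = 0" "f x \<le> indicator U x"
  using assms by (auto simp: minorants_def indicator_def intro: order_trans antisym dest: spec[of _ x] split: if_splits)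

lemma minorantsI:
  assumes "continuous_on UNIV f" "\<And>x. 0 \<le> f x" "\<And>x. f x \<le> 1" "\<And>x. x \<notin> U \<Longrightarrow> f x \<le> 0"
  shows "f \<in> minorants U"
  using assms by (auto simp: minorants_def indicator_def)

text \<open>The value that a representing measure has to give to an open set.\<close>

definition content :: "'a set \<Rightarrow> ennreal" where
  "content U = (SUP f\<in>minorants U. ennreal (L f))"

definition outer :: "'a set \<Rightarrow> ennreal" where
  "outer A = (INF U\<in>{U. open U \<and> A \<subseteq> U}. content U)"

lemma minorants_mono: "U \<subseteq> V \<Longrightarrow> minorants U \<subseteq> minorants V"
  by (auto intro!: minorantsI dest: minorantsD)

lemma content_mono: "U \<subseteq> V \<Longrightarrow> content U \<le> content V"
  unfolding content_def by (intro SUP_subset_mono minorants_mono) auto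

lemma outer_open: "open U \<Longrightarrow> outer U = content U"
  unfolding outer_def by (intro antisym INF_lower INF_greatest content_mono) auto

lemma outer_mono: "A \<subseteq> B \<Longrightarrow> outer A \<le> outer B"
  unfolding outer_def by (intro INF_superset_mono) auto

lemma minorants_empty: "minorants {} = {\<lambda>x. 0}"
  by (auto simp: minorants_def intro: antisym)

lemma content_empty: "content {} = 0"
  using L_const[of 0] by (simp add: content_def minorants_empty)

lemma L_one_nonneg: "0 \<le> L (\<lambda>x. 1)"
  by (rule L_nonneg) auto

lemma content_finite: "content U \<le> ennreal (L (\<lambda>x. 1))"
  unfolding content_def
proof (intro SUP_least ennreal_leI)
  fix f assume "f \<in> minorants U"
  note minorantsD[OF this]
  then show "L f \<le> L (\<lambda>x. 1)" by (intro L_mono) auto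
qed

lemma enn2real_content: "ennreal (enn2real (content U)) = content U"
  using content_finite[of U] by (intro ennreal_enn2real) (auto intro: le_less_trans)

text \<open>A minorant of the union is, up to a small loss, a finite sum of minorants of the single
  sets, by compactness and a partition of unity built from distance functions.\<close>

lemma content_UN_le:
  fixes U :: "nat \<Rightarrow> 'a set"
  assumes U: "\<And>n. open (U n)"
  shows "content (\<Union>n. U n) \<le> suminf (\<lambda>n. content (U n))"
  unfolding content_def[of "\<Union>n. U n"]
proof (rule SUP_least, rule ennreal_le_epsilon)
  fix f and e :: real assume f: "f \<in> minorants (\<Union>n. U n)" and e: "0 < e"
  define d where "d = e / (L (\<lambda>x. 1) + 1)"
  have d: "d > 0" "d * L (\<lambda>x. 1) \<le> e"
    using e L_one_nonneg by (auto simp: d_def field_simps)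
  have cf: "continuous_on UNIV f" and f0: "\<And>x. 0 \<le> f x" and f1: "\<And>x. f x \<le> 1"
    and fU: "\<And>x. x \<notin> (\<Union>n. U n) \<Longrightarrow> f x = 0"
    using minorantsD(1-4)[OF f] by simp_all
  \<comment> \<open>Lowering \<open>f\<close> by \<open>d\<close> costs at most \<open>e\<close> in
    \<open>L\<close>, and on \<open>K\<close> it leaves a function that vanishes off the compact set
    \<open>C\<close>, which finitely many \<open>U n\<close> cover.\<close>
  define f' where "f' x = max 0 (f x - d)" for x
  have cf': "continuous_on UNIV f'" unfolding f'_def by (intro continuous_intros cf)
  define C where "C = K \<inter> {x. d \<le> f x}"
  have "closed {x. d \<le> f x}"
    by (intro closed_Collect_le cf continuous_intros)
  then have C: "compact C" unfolding C_def using compact_K by auto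
  have "C \<subseteq> (\<Union>n. U n)"
    using fU d(1) by (force simp: C_def)
  then obtain N' where N': "finite N'" "C \<subseteq> (\<Union>n\<in>N'. U n)"
    using compactE_image[OF C, of UNIV U] U by auto
  then obtain N where N: "N' \<subseteq> {..<N}" using finite_nat_iff_bounded by blast
  have CN: "C \<subseteq> (\<Union>n<N. U n)" using N' N by auto
  define \<phi> where "\<phi> n x = (if U n = UNIV then 1 else infdist x (- U n))" for n x
  have c\<phi>: "continuous_on UNIV (\<phi> n)" for n
    unfolding \<phi>_def by (cases "U n = UNIV") (auto intro!: continuous_intros)
  have \<phi>0: "0 \<le> \<phi> n x" for n x by (simp add: \<phi>_def infdist_nonneg)
  have \<phi>z: "x \<notin> U n \<Longrightarrow> \<phi> n x = 0" for n x by (auto simp: \<phi>_def)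
  have \<phi>p: "\<phi> n x > 0" if "x \<in> U n" for n x
  proof (cases "U n = UNIV")
    case False
    then have "infdist x (- U n) \<noteq> 0"
      using that in_closed_iff_infdist_zero[of "- U n" x] U[of n] by auto
    then show ?thesis using False infdist_nonneg[of x "- U n"] by (simp add: \<phi>_def)
  qed (simp add: \<phi>_def)
  define s where "s x = (\<Sum>n<N. \<phi> n x)" for x
  have cs: "continuous_on UNIV s" unfolding s_def by (intro continuous_intros c\<phi>)
  have sp: "s x > 0" if x: "x \<in> C" for x
  proof -
    obtain n where "n < N" "x \<in> U n" using CN x by auto
    then show ?thesis unfolding s_def by (intro sum_pos2[of _ n]) (auto simp: \<phi>p \<phi>0)
  qed
  obtain c where c: "c > 0" "\<And>x. x \<in> C \<Longrightarrow> c \<le> s x"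
  proof (cases "C = {}")
    case True
    then show ?thesis using that[of 1] by auto
  next
    case False
    then obtain x where "x \<in> C" "\<forall>y\<in>C. s x \<le> s y"
      using continuous_attains_inf[OF C] continuous_on_subset[OF cs] by blast
    then show ?thesis using that[of "s x"] sp by auto
  qed
  have mp: "max (s x) c > 0" for x using c by auto
  \<comment> \<open>On \<open>C\<close> the denominator is \<open>s\<close> itself; elsewhere the
    maximum with \<open>c\<close> keeps it positive, so \<open>g n\<close> is continuous everywhere
    and the \<open>g n\<close> still add up to \<open>f'\<close> on \<open>K\<close>.\<close>
  define g where "g n x = f' x * (\<phi> n x / max (s x) c)" for n x
  have cg: "continuous_on UNIV (g n)" for n
    unfolding g_def using mp less_imp_neq[OF mp, symmetric]
    by (intro continuous_on_mult continuous_on_divide continuous_on_max cf' c\<phi> cs continuous_on_const ballI)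
  have g: "g n \<in> minorants (U n)" if n: "n < N" for n
  proof -
    have "\<phi> n x \<le> s x" for x
      unfolding s_def using n by (intro member_le_sum) (auto simp: \<phi>0)
    then have "\<phi> n x / max (s x) c \<le> 1" for x
      using mp[of x] by (simp add: divide_le_eq_1 le_max_iff_disj)
    moreover have "0 \<le> \<phi> n x / max (s x) c" for x using mp[of x] \<phi>0[of n x] by (intro divide_nonneg_pos) auto
    moreover have "0 \<le> f' x" "f' x \<le> 1" for x using f1[of x] d(1) by (auto simp: f'_def)
    ultimately have "0 \<le> g n x" "g n x \<le> 1" for x
      unfolding g_def by (blast intro: mult_nonneg_nonneg mult_le_one)+
    moreover have "x \<notin> U n \<Longrightarrow> g n x = 0" for x by (simp add: g_def \<phi>z)
    ultimately show ?thesis using cg[of n] by (intro minorantsI) auto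
  qed
  have "L f' \<le> L (\<lambda>x. \<Sum>n<N. g n x)"
  proof (rule L_mono[OF cf'])
    show "continuous_on UNIV (\<lambda>x. \<Sum>n<N. g n x)" by (intro continuous_intros cg)
    fix x assume x: "x \<in> K"
    have eq: "(\<Sum>n<N. g n x) = f' x * (s x / max (s x) c)"
      by (simp add: g_def s_def sum_distrib_left sum_divide_distrib)
    show "f' x \<le> (\<Sum>n<N. g n x)"
    proof (cases "d \<le> f x")
      case True
      then have "c \<le> s x" using c(2) x by (auto simp: C_def)
      then show ?thesis using eq c by simp
    next
      case False
      then show ?thesis using eq by (simp add: f'_def)
    qed
  qed
  also have "\<dots> = (\<Sum>n<N. L (g n))" by (intro L_sum cg) auto
  finally have "L f' \<le> (\<Sum>n<N. L (g n))" .
  moreover have "L f \<le> L (\<lambda>x. f' x + d)"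
    by (intro L_mono cf continuous_intros cf') (auto simp: f'_def)
  moreover have "L (\<lambda>x. f' x + d) = L f' + d * L (\<lambda>x. 1)"
    using L_add[OF cf', of "\<lambda>x. d"] L_const[of d] by simp
  ultimately have "L f \<le> (\<Sum>n<N. L (g n)) + e" using d(2) by linarith
  moreover have g0: "0 \<le> L (g n)" if "n < N" for n
    using g[OF that] by (intro L_nonneg) (auto simp: minorants_def)
  ultimately have "ennreal (L f) \<le> (\<Sum>n<N. ennreal (L (g n))) + ennreal e"
    using e ennreal_leI[of "L f" "(\<Sum>n<N. L (g n)) + e"] sum_nonneg[of "{..<N}" "\<lambda>n. L (g n)"]
    by (subst sum_ennreal) (auto simp: ennreal_plus)
  also have "(\<Sum>n<N. ennreal (L (g n))) \<le> (\<Sum>n<N. content (U n))"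
    unfolding content_def using g by (intro sum_mono SUP_upper) auto
  also have "\<dots> \<le> suminf (\<lambda>n. content (U n))" by (intro sum_le_suminf) auto
  finally show "ennreal (L f) \<le> suminf (\<lambda>n. content (U n)) + ennreal e" by simp
qed

lemma outer_approx:
  assumes "0 < (e :: ennreal)"
  obtains U where "open U" "A \<subseteq> U" "content U \<le> outer A + e"
proof -
  have "outer A \<le> ennreal (L (\<lambda>x. 1))"
    using INF_lower[of UNIV "{U. open U \<and> A \<subseteq> U}" content] content_finite[of UNIV] unfolding outer_def by (auto intro: order_trans)
  then have "outer A < outer A + e"
    using assms ennreal_add_left_cancel_less[of "outer A" 0 e] le_less_trans[OF _ ennreal_less_top, of "outer A" "L (\<lambda>x. 1)"] by auto
  then obtain U where "open U" "A \<subseteq> U" "content U < outer A + e"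
    unfolding outer_def by (auto simp: INF_less_iff)
  then show ?thesis using that by auto
qed

lemma outer_UN_le: "outer (\<Union>n. A n) \<le> suminf (\<lambda>n. outer (A n))"
proof (rule ennreal_le_epsilon)
  fix e :: real assume e: "0 < e"
  have "\<exists>U. open U \<and> A n \<subseteq> U \<and> content U \<le> outer (A n) + ennreal (e * (1/2)^Suc n)" for n
    using outer_approx[of "ennreal (e * (1/2)^Suc n)" "A n"] e by (metis ennreal_less_zero_iff mult_pos_pos zero_less_power half_gt_zero_iff zero_less_one)
  then obtain U where U: "\<And>n. open (U n)" "\<And>n. A n \<subseteq> U n" "\<And>n. content (U n) \<le> outer (A n) + ennreal (e * (1/2)^Suc n)"
    by metis
  have s: "suminf (\<lambda>n. ennreal (e * (1/2)^Suc n)) = ennreal e"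
  proof (rule suminf_ennreal_eq)
    show "(\<lambda>n. e * (1/2)^Suc n) sums e" using sums_mult[OF power_half_series, of e] by simp
  qed (use e in auto)
  have "outer (\<Union>n. A n) \<le> content (\<Union>n. U n)"
    using U unfolding outer_def by (intro INF_lower) auto
  also have "\<dots> \<le> suminf (\<lambda>n. content (U n))" by (rule content_UN_le[OF U(1)])
  also have "\<dots> \<le> suminf (\<lambda>n. outer (A n) + ennreal (e * (1/2)^Suc n))" by (intro suminf_le U) auto
  also have "\<dots> = suminf (\<lambda>n. outer (A n)) + ennreal e" by (simp only: suminf_add[symmetric, OF summableI summableI] s)
  finally show "outer (\<Union>n. A n) \<le> suminf (\<lambda>n. outer (A n)) + ennreal e" .
qed

text \<open>Given a minorant \<open>f\<close> of the intersection, the part of \<open>V\<close>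
  where \<open>f\<close> is below \<open>d\<close> is an open neighbourhood of \<open>V - U\<close>.
  Any minorant \<open>g\<close> of it satisfies f + g \<le> 1 + d, so dividing by 1 + d gives a
  minorant of \<open>V\<close>.\<close>

lemma content_split:
  assumes U: "open U" and V: "open V"
  shows "content (V \<inter> U) + outer (V - U) \<le> content V"
proof -
  have key: "ennreal (L f) + outer (V - U) \<le> content V" if f: "f \<in> minorants (V \<inter> U)" for f
  proof (rule ennreal_le_epsilon)
    fix e :: real assume e: "0 < e"
    define d where "d = e / (L (\<lambda>x. 1) + 1)"
    have d: "d > 0" "d * L (\<lambda>x. 1) \<le> e"
      using e L_one_nonneg by (auto simp: d_def field_simps)
    have cf: "continuous_on UNIV f" and f0: "\<And>x. 0 \<le> f x" and fU: "\<And>x. f x \<le> indicator (V \<inter> U) x"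
      using f by (auto simp: minorants_def)
    have Lf0: "0 \<le> L f" using f0 cf by (intro L_nonneg) auto
    define W where "W = V \<inter> {x. f x < d}"
    have W: "open W" unfolding W_def by (intro open_Int V open_Collect_less cf continuous_intros)
    have sub: "V - U \<subseteq> W"
    proof
      fix x assume "x \<in> V - U"
      then have "f x = 0" "x \<in> V" using fU[of x] f0[of x] by auto
      then show "x \<in> W" using d by (auto simp: W_def)
    qed
    have g: "L f + L g \<le> enn2real (content V) + e" if g: "g \<in> minorants W" for g
    proof -
      have cg: "continuous_on UNIV g" and g0: "\<And>x. 0 \<le> g x" and gW: "\<And>x. g x \<le> indicator W x"
        using g by (auto simp: minorants_def)
      define h where "h x = inverse (1 + d) * (f x + g x)" for x
      have ch: "continuous_on UNIV h" unfolding h_def by (intro continuous_intros cf cg)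
      have f1: "f x \<le> 1" for x using minorantsD(3)[OF f] .
      have "f x + g x \<le> (1 + d) * indicator V x" for x
        using fU[of x] gW[of x] d(1) f1[of x] by (cases "x \<in> V"; cases "f x < d") (auto simp: W_def)
      then have "h x \<le> indicator V x" for x
        unfolding h_def using d(1) by (simp add: field_simps)
      moreover have "0 \<le> h x" for x unfolding h_def using f0[of x] g0[of x] d(1) by auto
      ultimately have "h \<in> minorants V" using ch by (auto simp: minorants_def)
      then have "ennreal (L h) \<le> content V" unfolding content_def by (rule SUP_upper)
      then have Lh: "L h \<le> enn2real (content V)"
        using enn2real_content[of V] by (metis enn2real_nonneg ennreal_le_iff)
      have "L h = inverse (1 + d) * (L f + L g)"
        unfolding h_def using L_scale[of "\<lambda>x. f x + g x" "inverse (1+d)"] L_add[OF cf cg] cf cg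
        by (simp add: continuous_on_add)
      then have "L f + L g = (1 + d) * L h" using d(1) by simp
      also have "\<dots> = L h + d * L h" by (simp add: algebra_simps)
      also have "d * L h \<le> e"
      proof -
        have "L h \<le> L (\<lambda>x. 1)"
          using minorantsD(3)[OF \<open>h \<in> minorants V\<close>] ch by (intro L_mono) auto
        then have "d * L h \<le> d * L (\<lambda>x. 1)" using d(1) by (intro mult_left_mono) auto
        with d(2) show ?thesis by linarith
      qed
      finally show ?thesis using Lh by simp
    qed
    have "ennreal (L f) + outer (V - U) \<le> ennreal (L f) + content W"
      using sub W by (intro add_left_mono) (auto simp: outer_def intro: INF_lower)
    also have "\<dots> = (SUP g\<in>minorants W. ennreal (L f) + ennreal (L g))"
      unfolding content_def
      by (rule ennreal_SUP_add_right) (auto simp: minorants_def intro!: exI[of _ "\<lambda>x. 0"])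
    also have "\<dots> \<le> content V + ennreal e"
    proof (rule SUP_least)
      fix g assume g': "g \<in> minorants W"
      have "0 \<le> L g" using g' by (intro L_nonneg) (auto simp: minorants_def)
      then have "ennreal (L f) + ennreal (L g) \<le> ennreal (enn2real (content V) + e)"
        using g[OF g'] Lf0 by (simp flip: ennreal_plus add: ennreal_leI)
      also have "\<dots> = content V + ennreal e"
        using e by (simp add: ennreal_plus enn2real_content)
      finally show "ennreal (L f) + ennreal (L g) \<le> content V + ennreal e" .
    qed
    finally show "ennreal (L f) + outer (V - U) \<le> content V + ennreal e" .
  qed
  have "content (V \<inter> U) + outer (V - U) = (SUP f\<in>minorants (V \<inter> U). ennreal (L f) + outer (V - U))"
    unfolding content_def
    by (rule ennreal_SUP_add_left[symmetric]) (auto simp: minorants_def intro!: exI[of _ "\<lambda>x. 0"])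
  also have "\<dots> \<le> content V" by (intro SUP_least key)
  finally show ?thesis .
qed

lemma open_lambda_system:
  assumes U: "open U"
  shows "U \<in> lambda_system UNIV UNIV outer"
proof -
  have "outer (A \<inter> U) + outer (A - U) = outer A" for A
  proof (rule antisym)
    show "outer (A \<inter> U) + outer (A - U) \<le> outer A"
      unfolding outer_def[of A]
    proof (rule INF_greatest)
      fix V assume "V \<in> {V. open V \<and> A \<subseteq> V}"
      then have V: "open V" "A \<subseteq> V" by auto
      have "outer (A \<inter> U) + outer (A - U) \<le> outer (V \<inter> U) + outer (V - U)"
        using V by (intro add_mono outer_mono) auto
      also have "outer (V \<inter> U) = content (V \<inter> U)" using U V by (intro outer_open) auto
      also have "content (V \<inter> U) + outer (V - U) \<le> content V" by (rule content_split[OF U V(1)])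
      finally show "outer (A \<inter> U) + outer (A - U) \<le> content V" .
    qed
    have "outer A \<le> outer (\<Union>n. (case n of 0 \<Rightarrow> A \<inter> U | Suc 0 \<Rightarrow> A - U | _ \<Rightarrow> {}))"
    proof (intro outer_mono subsetI)
      fix x assume "x \<in> A"
      then show "x \<in> (\<Union>n. (case n of 0 \<Rightarrow> A \<inter> U | Suc 0 \<Rightarrow> A - U | _ \<Rightarrow> {}))"
        by (intro UN_I[of "if x \<in> U then 0 else Suc 0"]) auto
    qed
    also have "\<dots> \<le> suminf (\<lambda>n. outer (case n of 0 \<Rightarrow> A \<inter> U | Suc 0 \<Rightarrow> A - U | _ \<Rightarrow> {}))"
      by (rule outer_UN_le)
    also have "\<dots> = (\<Sum>n\<in>{0, Suc 0}. outer (case n of 0 \<Rightarrow> A \<inter> U | Suc 0 \<Rightarrow> A - U | _ \<Rightarrow> {}))"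
      by (rule suminf_finite) (auto simp: outer_open content_empty split: nat.splits)
    finally show "outer A \<le> outer (A \<inter> U) + outer (A - U)" by simp
  qed
  then show ?thesis by (simp add: lambda_system_def Int_commute Diff_eq)
qed

section \<open>The Borel measure and its integral\<close>

definition M :: "'a measure" where "M = measure_of UNIV (sets borel) outer"

lemma outer_measure_space_outer: "outer_measure_space UNIV outer"
  unfolding outer_measure_space_def positive_def increasing_def countably_subadditive_def
  using outer_UN_le outer_mono outer_open[of "{}"] content_empty by auto

text \<open>The sets that split \<open>outer\<close> additively form a sigma-algebra on which it is
  a measure (Caratheodory); this algebra contains the open sets, hence the Borel sets.\<close>

lemma measure_space_outer: "measure_space UNIV (sets borel) outer"
proof -
  interpret sigma_algebra UNIV "UNIV :: 'a set set"
    using sigma_algebra_Pow[of "UNIV :: 'a set"] by simp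
  have ms: "measure_space UNIV (lambda_system UNIV UNIV outer) outer"
    by (rule caratheodory_lemma[OF outer_measure_space_outer])
  have "sets borel \<subseteq> lambda_system UNIV UNIV outer"
    unfolding borel_def
  proof (subst sets_measure_of)
    have "sigma_algebra UNIV (lambda_system UNIV UNIV outer)" using ms by (simp add: measure_space_def)
    then show "sigma_sets UNIV {S. open S} \<subseteq> lambda_system UNIV UNIV outer"
      by (rule sigma_algebra.sigma_sets_subset) (auto intro: open_lambda_system)
  qed auto
  then show ?thesis
    using measure_down[OF ms] sets.sigma_algebra_axioms[of "borel :: 'a measure"] by simp
qed

lemma sets_M: "sets M = sets borel"
  by (simp add: M_def sets.sigma_sets_eq[of borel, simplified])

lemma emeasure_M: "A \<in> sets borel \<Longrightarrow> emeasure M A = outer A"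
  using measure_space_outer
  by (intro emeasure_measure_of[OF M_def]) (auto simp: sets_M measure_space_def)

lemma space_M: "space M = UNIV"
  using sets_eq_imp_space_eq[OF sets_M] by simp

lemma finite_measure_M: "finite_measure M"
  using content_finite[of UNIV] by (intro finite_measureI) (auto simp: space_M emeasure_M outer_open top_unique)

lemma measure_M_UNIV: "measure M UNIV = L (\<lambda>x. 1)"
proof -
  have "content UNIV = ennreal (L (\<lambda>x. 1))"
    using content_finite[of UNIV] unfolding content_def
    by (intro antisym SUP_upper) (auto simp: minorants_def)
  then show ?thesis by (simp add: measure_def emeasure_M outer_open L_one_nonneg)
qed

lemma M_compl_K: "emeasure M (- K) = 0"
proof -
  have K: "open (- K)" using compact_K compact_imp_closed by auto
  have "L f = 0" if "f \<in> minorants (- K)" for f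
  proof -
    have "continuous_on UNIV f" "\<And>x. x \<in> K \<Longrightarrow> f x = 0"
      using minorantsD[OF that] by auto
    then show ?thesis
      using L_mono[of f "\<lambda>x. 0"] L_mono[of "\<lambda>x. 0" f] L_const[of 0] by force
  qed
  then have "content (- K) \<le> 0" unfolding content_def
    by (intro SUP_least) simp
  then show ?thesis using K by (simp add: emeasure_M outer_open)
qed

lemma integrable_M:
  fixes f :: "'a \<Rightarrow> real"
  assumes "continuous_on UNIV f"
  shows "integrable M f"
  using integrable_continuous[OF finite_measure_M sets_M M_compl_K compact_K assms] .

text \<open>Horizontal slicing: N f is the sum of the slices \<open>f' i\<close>, each a minorant of
  the superlevel set \<open>U i\<close>, while the indicators of these sets add up to at most N f +
  1. The error after division by N is L(1)/N.\<close>

lemma L_le_integral: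
  assumes cf: "continuous_on UNIV f" and f01: "\<And>x. 0 \<le> f x" "\<And>x. f x \<le> 1"
  shows "L f \<le> (\<integral>x. f x \<partial>M)"
proof (rule field_le_epsilon)
  fix e :: real assume e: "0 < e"
  interpret finite_measure M by (rule finite_measure_M)
  obtain N :: nat where N: "N > 0" "inverse (real N) < e / (L (\<lambda>x. 1) + 1)"
    using e L_one_nonneg reals_Archimedean[of "e / (L (\<lambda>x. 1) + 1)"] by (metis add_nonneg_pos divide_pos_pos zero_less_Suc zero_less_one)
  define f' where "f' i x = max 0 (min 1 (real N * f x - real i))" for i :: nat and x
  have cf': "continuous_on UNIV (f' i)" for i unfolding f'_def by (intro continuous_intros cf)
  have fsum: "(\<Sum>i<n. f' i x) = min (real n) (real N * f x)" for x and n :: nat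
    using f01[of x] by (induction n) (auto simp: f'_def max_def min_def)
  have Nf: "(\<Sum>i<N. f' i x) = real N * f x" for x
    using fsum[of x N] f01[of x] N(1) by (auto simp: min_def mult_left_le)
  define U where "U i = {x. real i < real N * f x}" for i :: nat
  have U: "open (U i)" for i unfolding U_def by (intro open_Collect_less continuous_intros cf)
  have Us: "U i \<in> sets M" for i using U[of i] by (simp add: sets_M)
  have ind: "(\<Sum>i<n. indicator (U i) x) \<le> min (real n) (real N * f x + 1)" for x and n :: nat
  proof (induction n)
    case 0
    show ?case using f01[of x] by simp
  next
    case (Suc n)
    moreover have "indicator (U n) x = (if real n < real N * f x then 1 else 0 :: real)"
      by (simp add: U_def)
    ultimately show ?case by (simp del: sum_indicator_eq_card add: min_def split: if_splits)
  qed
  have "real N * L f = L (\<lambda>x. \<Sum>i<N. f' i x)" using L_scale[OF cf, of "real N"] Nf by simp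
  also have "\<dots> = (\<Sum>i<N. L (f' i))" by (intro L_sum cf') auto
  also have "\<dots> \<le> (\<Sum>i<N. measure M (U i))"
  proof (rule sum_mono)
    fix i
    have "f' i \<in> minorants (U i)"
      using cf'[of i] by (auto simp: minorants_def f'_def U_def indicator_def)
    then have "ennreal (L (f' i)) \<le> content (U i)" unfolding content_def by (rule SUP_upper)
    also have "\<dots> = ennreal (measure M (U i))"
      using U[of i] by (simp add: emeasure_eq_measure[symmetric] emeasure_M outer_open)
    finally show "L (f' i) \<le> measure M (U i)" by simp
  qed
  also have "\<dots> = (\<integral>x. (\<Sum>i<N. indicator (U i) x) \<partial>M)"
    using Us by (subst Bochner_Integration.integral_sum) (auto simp: integrable_indicator_iff emeasure_eq_measure space_M)
  also have "\<dots> \<le> (\<integral>x. real N * f x + 1 \<partial>M)"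
    using Us integrable_M[OF cf] ind[of _ N] by (intro integral_mono Bochner_Integration.integrable_sum)
      (auto simp: integrable_indicator_iff emeasure_eq_measure)
  also have "\<dots> = real N * (\<integral>x. f x \<partial>M) + L (\<lambda>x. 1)"
    using integrable_M[OF cf] measure_M_UNIV by (simp add: space_M)
  finally have "L f \<le> (\<integral>x. f x \<partial>M) + L (\<lambda>x. 1) * inverse (real N)"
    using N(1) by (simp add: field_simps)
  also have "L (\<lambda>x. 1) * inverse (real N) \<le> L (\<lambda>x. 1) * (e / (L (\<lambda>x. 1) + 1))"
    using N(2) L_one_nonneg by (intro mult_left_mono) auto
  also have "\<dots> \<le> e" using e L_one_nonneg by (simp add: field_simps)
  finally show "L f \<le> (\<integral>x. f x \<partial>M) + e" by simp
qed

text \<open>The inequality for a function \<open>g\<close> with values in [0, 1] and for 1 - g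
  together force equality; an affine change reduces \<open>f\<close> on \<open>K\<close> to such a
  \<open>g\<close>.\<close>

lemma L_eq_integral:
  assumes cf: "continuous_on UNIV f"
  shows "L f = (\<integral>x. f x \<partial>M)"
proof -
  interpret finite_measure M by (rule finite_measure_M)
  obtain B where B: "B > 0" "\<And>x. x \<in> K \<Longrightarrow> norm (f x) \<le> B"
    using compact_imp_bounded[OF compact_continuous_image[OF continuous_on_subset[OF cf] compact_K]]
    by (auto simp: bounded_pos)
  define g where "g x = max 0 (min 1 ((f x + B) / (2 * B)))" for x
  have cg: "continuous_on UNIV g" unfolding g_def using B(1) by (intro continuous_intros cf) auto
  have "L g \<le> (\<integral>x. g x \<partial>M)" by (rule L_le_integral[OF cg]) (auto simp: g_def)
  moreover have "L (\<lambda>x. 1 - g x) \<le> (\<integral>x. 1 - g x \<partial>M)"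
    by (rule L_le_integral) (auto simp: g_def intro!: continuous_intros cf B(1) less_imp_neq[symmetric])
  moreover have "L (\<lambda>x. 1 - g x) = L (\<lambda>x. 1) - L g" by (intro L_diff cg continuous_intros)
  moreover have "(\<integral>x. 1 - g x \<partial>M) = L (\<lambda>x. 1) - (\<integral>x. g x \<partial>M)"
    using integrable_M[OF cg] measure_M_UNIV by (simp add: space_M)
  ultimately have g: "L g = (\<integral>x. g x \<partial>M)" by linarith
  define h where "h x = 2 * B * g x - B" for x
  have ch: "continuous_on UNIV h" unfolding h_def by (intro continuous_intros cg)
  have hf: "h x = f x" if "x \<in> K" for x
    using B(2)[OF that] B(1) by (auto simp: h_def g_def max_def min_def field_simps)
  have "L f = L h" using hf by (intro antisym L_mono cf ch) auto
  also have "L h = 2 * B * L g - B * L (\<lambda>x. 1)"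
    unfolding h_def using L_diff[of "\<lambda>x. 2 * B * g x" "\<lambda>x. B"] L_scale[OF cg, of "2*B"] L_const[of B] cg
    by (simp add: continuous_on_mult_left)
  also have "\<dots> = (\<integral>x. h x \<partial>M)"
    unfolding h_def using integrable_M[OF cg] g measure_M_UNIV by (simp add: space_M)
  also have "\<dots> = (\<integral>x. f x \<partial>M)"
  proof (rule integral_cong_AE)
    show "AE x in M. h x = f x"
      using M_compl_K compact_imp_closed[OF compact_K] hf
      by (intro AE_I[of _ _ "- K"]) (auto simp: sets_M)
  qed (use integrable_M[OF ch] integrable_M[OF cf] in auto)
  finally show ?thesis .
qed

theorem riesz_markov:
  "\<exists>M. finite_measure M \<and> sets M = sets borel \<and> emeasure M (- K) = 0 \<and>
    (\<forall>f. continuous_on UNIV f \<longrightarrow> L f = (\<integral>x. f x \<partial>M))"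
  using finite_measure_M sets_M M_compl_K L_eq_integral by blast

end

section \<open>The multidimensional Hausdorff moment problem\<close>

text \<open>The factorial moments of the binomial distribution. A commutative ring is allowed
  because \<open>x\<close> will be a formal variable.\<close>

lemma sum_choose_binomial:
  fixes x :: "'a::comm_ring_1"
  shows "(\<Sum>k\<le>N. of_nat (N choose k) * of_nat (k choose a) * (x ^ k * (1 - x) ^ (N - k)))
    = of_nat (N choose a) * x ^ a"
proof (cases "a \<le> N")
  case True
  have "(\<Sum>k\<le>N. of_nat (N choose k) * of_nat (k choose a) * (x ^ k * (1 - x) ^ (N - k)))
      = (\<Sum>k\<in>{a..N}. of_nat (N choose k) * of_nat (k choose a) * (x ^ k * (1 - x) ^ (N - k)))"
    by (rule sum.mono_neutral_right) (auto simp: binomial_eq_0)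
  also have "\<dots> = (\<Sum>j\<le>N - a. of_nat (N choose (j + a)) * of_nat ((j + a) choose a) * (x ^ (j + a) * (1 - x) ^ (N - (j + a))))"
    using True by (intro sum.reindex_bij_witness[of _ "\<lambda>j. j + a" "\<lambda>k. k - a"]) auto
  also have "\<dots> = (\<Sum>j\<le>N - a. of_nat (N choose a) * x ^ a * (of_nat ((N - a) choose j) * x ^ j * (1 - x) ^ (N - a - j)))"
  proof (rule sum.cong[OF refl])
    fix j assume "j \<in> {..N - a}"
    then have "(N choose (j + a)) * ((j + a) choose a) = (N choose a) * ((N - a) choose j)"
      using choose_mult[of a "j + a" N] True by auto
    then have c: "(of_nat (N choose (j + a)) * of_nat ((j + a) choose a) :: 'a) = of_nat (N choose a) * of_nat ((N - a) choose j)"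
      by (metis of_nat_mult)
    have e: "N - (j + a) = N - a - j" by simp
    show "of_nat (N choose (j + a)) * of_nat ((j + a) choose a) * (x ^ (j + a) * (1 - x) ^ (N - (j + a)))
      = of_nat (N choose a) * x ^ a * (of_nat ((N - a) choose j) * x ^ j * (1 - x) ^ (N - a - j))"
      unfolding c e by (simp add: power_add algebra_simps)
  qed
  also have "\<dots> = of_nat (N choose a) * x ^ a * (x + (1 - x)) ^ (N - a)"
    by (simp only: binomial_ring sum_distrib_left)
  finally show ?thesis by simp
next
  case False
  then show ?thesis by (auto simp: binomial_eq_0 intro!: sum.neutral)
qed

text \<open>The ratio is the product of the factors (k - i)/(N - i) for i < a. Exchanging the factor
  with index i for k/N costs at most i/N, and these costs add up to at most a^2/N.\<close>

lemma choose_ratio_approx: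
  fixes a k N :: nat
  assumes "a \<le> N" "k \<le> N" "0 < N"
  shows "\<bar>(k choose a) / (N choose a) - (k / N) ^ a\<bar> \<le> (real a)\<^sup>2 / N"
  using assms(1)
proof (induction a)
  case (Suc a)
  define e where "e i = real (k choose i) / real (N choose i)" for i
  have e01: "0 \<le> e i \<and> e i \<le> 1" if "i \<le> N" for i
    using that binomial_right_mono[of k N i] assms(2) by (auto simp: e_def divide_le_eq_1 zero_less_binomial_iff)
  define r where "r = real k / real N"
  have r: "0 \<le> r" "r \<le> 1" using assms by (auto simp: r_def)
  have 1: "real (Suc a) * real (n choose Suc a) = (real n - real a) * real (n choose a)" for n
  proof (cases "a \<le> n")
    case True
    have "Suc a * (n choose Suc a) = (n - a) * (n choose a)"
      using binomial_absorb_comp[of n a] binomial_absorption[of a n] by linarith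
    then show ?thesis using True by (metis of_nat_diff of_nat_mult)
  qed (simp add: binomial_eq_0)
  have eS: "e (Suc a) * (real N - real a) = (real k - real a) * e a"
  proof -
    have p: "real (N choose Suc a) > 0" "real (N choose a) > 0" using Suc.prems by (auto simp: zero_less_binomial_iff)
    have "real (Suc a) * (e (Suc a) * (real N - real a)) * real (N choose a) =
        real (Suc a) * ((real k - real a) * e a) * real (N choose a)"
    proof -
      have "real (Suc a) * (e (Suc a) * (real N - real a)) * real (N choose a)
          = e (Suc a) * real (Suc a) * ((real N - real a) * real (N choose a))" by (simp add: algebra_simps)
      also have "\<dots> = real (Suc a) * (real (Suc a) * real (k choose Suc a))"
        unfolding 1[symmetric] e_def using p by (simp del: of_nat_Suc)
      also have "\<dots> = real (Suc a) * ((real k - real a) * e a) * real (N choose a)"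
        unfolding 1 e_def using p by simp
      finally show ?thesis .
    qed
    then show ?thesis using p(2) by (simp del: of_nat_Suc)
  qed
  \<comment> \<open>A rearrangement of the recursion \<open>eS\<close>; the difference on the right
    is at most 1 in modulus since both ratios lie in [0, 1].\<close>
  have "r * e a - e (Suc a) = (real a / real N) * (e a - e (Suc a))"
    using eS assms(3) by (simp add: r_def field_simps)
  then have "\<bar>r * e a - e (Suc a)\<bar> = (real a / real N) * \<bar>e a - e (Suc a)\<bar>" by (simp add: abs_mult)
  also have "\<dots> \<le> real a / real N * 1"
    using e01[of a] e01[of "Suc a"] Suc.prems by (intro mult_left_mono) auto
  finally have 2: "\<bar>r * e a - e (Suc a)\<bar> \<le> real a / real N" by simp
  have "\<bar>r * e a - r * r ^ a\<bar> = r * \<bar>e a - r ^ a\<bar>" using r by (simp add: abs_mult flip: right_diff_distrib)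
  also have "\<dots> \<le> 1 * ((real a)\<^sup>2 / N)"
    using Suc r by (intro mult_mono) (auto simp: e_def r_def)
  finally have "\<bar>e (Suc a) - r ^ Suc a\<bar> \<le> real a / real N + (real a)\<^sup>2 / N"
    using 2 by simp
  also have "\<dots> \<le> (real (Suc a))\<^sup>2 / N"
    using assms(3) by (simp add: field_simps power2_eq_square)
  finally show ?case by (simp add: e_def r_def)
qed simp

section \<open>Formal polynomials and the functional of a moment sequence\<close>

definition linear_extension :: "('k \<Rightarrow> real) \<Rightarrow> ('k \<Rightarrow>\<^sub>0 real) \<Rightarrow> real" where
  "linear_extension m P = (\<Sum>k\<in>Poly_Mapping.keys P. Poly_Mapping.lookup P k * m k)"

lemma linear_extension_add: "linear_extension m (P + Q) = linear_extension m P + linear_extension m Q"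
  unfolding linear_extension_def
  by (rule setsum_keys_plus_distrib) (auto simp: distrib_right)

lemma linear_extension_single: "linear_extension m (Poly_Mapping.single k c) = c * m k"
  by (simp add: linear_extension_def)

lemma linear_extension_zero: "linear_extension m 0 = 0"
  by (simp add: linear_extension_def)

lemma linear_extension_sum: "linear_extension m (sum P I) = (\<Sum>i\<in>I. linear_extension m (P i))"
  by (induction I rule: infinite_finite_induct) (auto simp: linear_extension_zero linear_extension_add)

lemma poly_mapping_single_induct:
  fixes P :: "'k \<Rightarrow>\<^sub>0 'c::comm_monoid_add"
  assumes "Q 0" "\<And>P k c. Q P \<Longrightarrow> Q (Poly_Mapping.single k c + P)"
  shows "Q P"
proof (induction P rule: update_induct)
  case (update f a b)
  have "Poly_Mapping.update a b f = Poly_Mapping.single a b + f"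
    using update(1) by (intro poly_mapping_eqI) (auto simp: lookup_add lookup_single lookup_update when_def in_keys_iff)
  then show ?case using assms(2)[OF update(3)] by simp
qed (rule assms)

text \<open>Multiplying a polynomial by a monomial amounts to shifting the moment sequence; this
  translates the closure properties of a class of sequences into positivity of polynomials.\<close>

lemma linear_extension_mult_single:
  fixes m :: "'k::comm_monoid_add \<Rightarrow> real"
  shows "linear_extension m (Poly_Mapping.single k c * P) = c * linear_extension (\<lambda>l. m (k + l)) P"
proof (induction P rule: poly_mapping_single_induct)
  case (2 P l d)
  then show ?case by (simp add: distrib_left linear_extension_add mult_single linear_extension_single)
qed (simp add: linear_extension_zero)

lemma linear_extension_diff: "linear_extension (\<lambda>k. m k - n k) P = linear_extension m P - linear_extension n P"
  by (simp add: linear_extension_def right_diff_distrib sum_subtractf)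

lemma linear_extension_of_nat_mult:
  fixes m :: "'k::comm_monoid_add \<Rightarrow> real"
  shows "linear_extension m (of_nat n * P) = real n * linear_extension m P"
  using linear_extension_mult_single[of m 0 "of_nat n" P] by simp

text \<open>A moment is indexed by the multiset of the coordinates that occur in its monomial.\<close>

locale completely_monotone =
  fixes \<C> :: "('e::euclidean_space multiset \<Rightarrow> real) set"
  assumes nonneg: "m \<in> \<C> \<Longrightarrow> 0 \<le> m {#}"
    and shift: "\<lbrakk>m \<in> \<C>; b \<in> Basis\<rbrakk> \<Longrightarrow> (\<lambda>a. m (add_mset b a)) \<in> \<C>"
    and difference: "\<lbrakk>m \<in> \<C>; b \<in> Basis\<rbrakk> \<Longrightarrow> (\<lambda>a. m a - m (add_mset b a)) \<in> \<C>"
begin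

definition var :: "'e \<Rightarrow> 'e multiset \<Rightarrow>\<^sub>0 real" where
  "var b = Poly_Mapping.single {#b#} 1"

text \<open>Positivity is asked for the whole class \<C> at once: a factor x or 1 - x is then
  absorbed by passing to another member of \<C>, which gives nonnegative values on all Bernstein
  polynomials.\<close>

definition positive_polynomial :: "('e multiset \<Rightarrow>\<^sub>0 real) \<Rightarrow> bool" where
  "positive_polynomial P \<longleftrightarrow> (\<forall>m\<in>\<C>. 0 \<le> linear_extension m P)"

lemma linear_extension_one: "linear_extension m 1 = m {#}" for m :: "'e multiset \<Rightarrow> real"
  using linear_extension_single[of m 0 1] by simp

lemma positive_polynomial_one: "positive_polynomial 1"
  by (simp add: positive_polynomial_def linear_extension_one nonneg)

lemma positive_polynomial_var:
  assumes "positive_polynomial P" "b \<in> Basis"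
  shows "positive_polynomial (var b * P)"
  using assms shift by (auto simp: positive_polynomial_def var_def linear_extension_mult_single)

lemma positive_polynomial_one_minus_var:
  assumes "positive_polynomial P" "b \<in> Basis"
  shows "positive_polynomial ((1 - var b) * P)"
proof -
  have "linear_extension m ((1 - var b) * P) = linear_extension (\<lambda>a. m a - m (add_mset b a)) P" for m
  proof -
    have "(1 - var b) * P = P + Poly_Mapping.single {#b#} (-1) * P"
      by (simp add: var_def algebra_simps single_uminus)
    then show ?thesis
      by (simp add: linear_extension_add linear_extension_mult_single linear_extension_diff)
  qed
  then show ?thesis using assms difference by (auto simp: positive_polynomial_def)
qed

lemma positive_polynomial_power:
  assumes "positive_polynomial P" "\<And>P. positive_polynomial P \<Longrightarrow> positive_polynomial (v * P)"
  shows "positive_polynomial (v ^ n * P)"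
  using assms(1) by (induction n) (simp_all add: assms(2) mult.assoc)

lemma positive_polynomial_bernstein:
  "positive_polynomial (\<Prod>b\<in>Basis. var b ^ k b * (1 - var b) ^ l b)"
proof -
  have "positive_polynomial (\<Prod>b\<in>A. var b ^ k b * (1 - var b) ^ l b)" if "finite A" "A \<subseteq> Basis" for A
    using that
  proof (induction A rule: finite_induct)
    case (insert b A)
    then show ?case
      by (simp add: mult.assoc positive_polynomial_power positive_polynomial_var positive_polynomial_one_minus_var)
  qed (simp add: positive_polynomial_one)
  then show ?thesis by auto
qed

text \<open>The functional of \<open>m\<close> at a Bernstein basis polynomial. The point masses
  \<open>weight m N k\<close> at \<open>node N k\<close> form the N-th discrete approximation of the
  measure sought.\<close>

definition weight :: "('e multiset \<Rightarrow> real) \<Rightarrow> nat \<Rightarrow> ('e \<Rightarrow> nat) \<Rightarrow> real" where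
  "weight m N k = (\<Prod>b\<in>Basis. real (N choose k b)) *
    linear_extension m (\<Prod>b\<in>Basis. var b ^ k b * (1 - var b) ^ (N - k b))"

definition node :: "nat \<Rightarrow> ('e \<Rightarrow> nat) \<Rightarrow> 'e" where
  "node N k = (\<Sum>b\<in>Basis. (real (k b) / real N) *\<^sub>R b)"

definition bernstein_sum :: "('e multiset \<Rightarrow> real) \<Rightarrow> nat \<Rightarrow> ('e \<Rightarrow> real) \<Rightarrow> real" where
  "bernstein_sum m N g = (\<Sum>k\<in>Basis \<rightarrow>\<^sub>E {..N}. weight m N k * g (node N k))"

definition monomial :: "'e multiset \<Rightarrow> 'e \<Rightarrow> real" where
  "monomial a u = (\<Prod>b\<in>#a. u \<bullet> b)"

lemma weight_nonneg: "m \<in> \<C> \<Longrightarrow> 0 \<le> weight m N k"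
  unfolding weight_def using positive_polynomial_bernstein[of k "\<lambda>b. N - k b"]
  by (auto simp: positive_polynomial_def intro!: mult_nonneg_nonneg prod_nonneg)

text \<open>For products of binomial coefficients, instead of powers, the Bernstein sum reproduces
  the moments of \<open>m\<close> exactly and not merely in the limit.\<close>

lemma weight_choose:
  "(\<Sum>k\<in>Basis \<rightarrow>\<^sub>E {..N}. weight m N k * (\<Prod>b\<in>Basis. real (k b choose a b)))
    = (\<Prod>b\<in>Basis. real (N choose a b)) * linear_extension m (\<Prod>b\<in>Basis. var b ^ a b)"
proof -
  have "weight m N k * (\<Prod>b\<in>Basis. real (k b choose a b)) = linear_extension m
     (\<Prod>b\<in>Basis. of_nat (N choose k b) * of_nat (k b choose a b) * (var b ^ k b * (1 - var b) ^ (N - k b)))" for k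
  proof -
    have "(\<Prod>b\<in>Basis. of_nat (N choose k b) * of_nat (k b choose a b) * (var b ^ k b * (1 - var b) ^ (N - k b)))
      = of_nat (\<Prod>b\<in>Basis. (N choose k b) * (k b choose a b)) * (\<Prod>b\<in>Basis. var b ^ k b * (1 - var b) ^ (N - k b))"
      by (simp add: prod.distrib mult.assoc)
    then show ?thesis
      by (simp only: linear_extension_of_nat_mult) (simp add: weight_def prod.distrib)
  qed
  then have "(\<Sum>k\<in>Basis \<rightarrow>\<^sub>E {..N}. weight m N k * (\<Prod>b\<in>Basis. real (k b choose a b)))
    = linear_extension m (\<Sum>k\<in>Basis \<rightarrow>\<^sub>E {..N}.
     (\<Prod>b\<in>Basis. of_nat (N choose k b) * of_nat (k b choose a b) * (var b ^ k b * (1 - var b) ^ (N - k b))))"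
    by (simp add: linear_extension_sum)
  also have "\<dots> = linear_extension m (\<Prod>b\<in>Basis. of_nat (N choose a b) * var b ^ a b)"
    by (subst prod_sum_PiE[symmetric]) (auto simp: sum_choose_binomial)
  also have "(\<Prod>b\<in>Basis. of_nat (N choose a b) * var b ^ a b) = of_nat (\<Prod>b\<in>Basis. N choose a b) * (\<Prod>b\<in>Basis. var b ^ a b)"
    by (simp add: prod.distrib)
  finally show ?thesis by (simp only: linear_extension_of_nat_mult) simp
qed

lemma linear_extension_var_power:
  assumes "set_mset a \<subseteq> Basis"
  shows "linear_extension m (\<Prod>b\<in>Basis. var b ^ count a b) = m a"
proof -
  have pow: "var b ^ n = Poly_Mapping.single (replicate_mset n b) 1" for b n
    by (induction n) (auto simp: var_def mult_single)
  have "(\<Prod>b\<in>A. Poly_Mapping.single (f b) 1) = Poly_Mapping.single (sum f A) (1::real)" if "finite A" for A and f :: "'e \<Rightarrow> 'e multiset"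
    using that by (induction A rule: finite_induct) (auto simp: mult_single)
  then have "(\<Prod>b\<in>Basis. var b ^ count a b) = Poly_Mapping.single (\<Sum>b\<in>Basis. replicate_mset (count a b) b) 1"
    by (simp add: pow)
  also have "(\<Sum>b\<in>Basis. replicate_mset (count a b) b) = a"
    using assms by (intro multiset_eqI) (auto simp: count_sum not_in_iff)
  finally show ?thesis by (simp add: linear_extension_single)
qed

lemma sum_weight: "(\<Sum>k\<in>Basis \<rightarrow>\<^sub>E {..N}. weight m N k) = m {#}"
  using weight_choose[where a = "\<lambda>_. 0"] by (simp add: linear_extension_one)

lemma node_inner: "b \<in> Basis \<Longrightarrow> node N k \<bullet> b = real (k b) / real N"
  by (simp add: node_def inner_sum_left inner_Basis if_distrib cong: if_cong)

lemma node_mem: "k \<in> Basis \<rightarrow>\<^sub>E {..N} \<Longrightarrow> node N k \<in> cbox 0 One"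
  by (force simp: mem_box node_inner divide_le_eq_1 PiE_iff)

lemma monomial_eq:
  assumes "set_mset a \<subseteq> Basis"
  shows "monomial a u = (\<Prod>b\<in>Basis. (u \<bullet> b) ^ count a b)"
  unfolding monomial_def image_prod_mset_multiplicity
  using assms by (intro prod.mono_neutral_left) (auto simp: not_in_iff)

text \<open>With \<open>e k b\<close> in place of the powers of the node coordinates the sum is
  exactly \<open>m a\<close>. The exchange changes each value by at most \<open>s / N\<close>, and
  the weights are nonnegative with total \<open>m {#}\<close>.\<close>

lemma bernstein_sum_monomial:
  assumes m: "m \<in> \<C>" and a: "set_mset a \<subseteq> Basis"
  shows "(\<lambda>N. bernstein_sum m N (monomial a)) \<longlonglongrightarrow> m a"
proof (rule LIM_zero_cancel, rule Lim_null_comparison)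
  define s where "s = (\<Sum>b\<in>(Basis :: 'e set). (real (count a b))\<^sup>2)"
  show "(\<lambda>N. m {#} * (s / real N)) \<longlonglongrightarrow> 0"
    by (intro tendsto_mult_right_zero tendsto_divide_0[OF tendsto_const] filterlim_real_sequentially[THEN filterlim_at_top_imp_at_infinity])
  show "\<forall>\<^sub>F N in sequentially. norm (bernstein_sum m N (monomial a) - m a) \<le> m {#} * (s / real N)"
  proof (rule eventually_sequentiallyI)
    fix N assume N: "Suc (size a) \<le> N"
    then have "N > 0" by simp
    have ca: "count a b \<le> N" for b using N by (metis Suc_leD count_le_size order_trans)
    define e where "e k b = real (k b choose count a b) / real (N choose count a b)" for k b
    have e01: "0 \<le> e k b" "e k b \<le> 1" if "k \<in> Basis \<rightarrow>\<^sub>E {..N}" "b \<in> Basis" for k b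
      using that ca[of b] binomial_right_mono[of "k b" N "count a b"]
      by (auto simp: e_def divide_le_eq_1 zero_less_binomial_iff PiE_iff)
    have ma: "m a = (\<Sum>k\<in>Basis \<rightarrow>\<^sub>E {..N}. weight m N k * (\<Prod>b\<in>Basis. e k b))"
    proof -
      have p: "(\<Prod>b\<in>(Basis::'e set). real (N choose count a b)) > 0"
        using ca by (intro prod_pos) (auto simp: zero_less_binomial_iff)
      have "(\<Sum>k\<in>Basis \<rightarrow>\<^sub>E {..N}. weight m N k * (\<Prod>b\<in>Basis. e k b))
         = (\<Sum>k\<in>Basis \<rightarrow>\<^sub>E {..N}. weight m N k * (\<Prod>b\<in>Basis. real (k b choose count a b))) / (\<Prod>b\<in>(Basis::'e set). real (N choose count a b))"
        by (simp add: e_def prod_dividef sum_divide_distrib)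
      also have "\<dots> = m a"
        unfolding weight_choose linear_extension_var_power[OF a] by (rule nonzero_mult_div_cancel_left) (use p in linarith)
      finally show ?thesis by simp
    qed
    have "norm (bernstein_sum m N (monomial a) - m a)
       = \<bar>\<Sum>k\<in>Basis \<rightarrow>\<^sub>E {..N}. weight m N k * (monomial a (node N k) - (\<Prod>b\<in>Basis. e k b))\<bar>"
      unfolding ma bernstein_sum_def by (simp add: sum_subtractf right_diff_distrib)
    also have "\<dots> \<le> (\<Sum>k\<in>Basis \<rightarrow>\<^sub>E {..N}. \<bar>weight m N k * (monomial a (node N k) - (\<Prod>b\<in>Basis. e k b))\<bar>)"
      by (rule sum_abs)
    also have "\<dots> \<le> (\<Sum>k\<in>Basis \<rightarrow>\<^sub>E {..N}. weight m N k * (s / real N))"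
    proof (rule sum_mono)
      fix k assume k: "k \<in> (Basis :: 'e set) \<rightarrow>\<^sub>E {..N}"
      then have kN: "k b \<le> N" if "b \<in> Basis" for b using that by (auto simp: PiE_iff)
      have "norm (monomial a (node N k) - (\<Prod>b\<in>Basis. e k b)) =
          norm ((\<Prod>b\<in>Basis. (real (k b) / real N) ^ count a b) - (\<Prod>b\<in>Basis. e k b))"
        by (simp add: monomial_eq[OF a] node_inner)
      also have "\<dots> \<le> (\<Sum>b\<in>Basis. norm ((real (k b) / real N) ^ count a b - e k b))"
        using e01[OF k] kN by (intro norm_prod_diff) (auto intro!: power_le_one divide_le_eq_1[THEN iffD2])
      also have "\<dots> \<le> (\<Sum>b\<in>Basis. (real (count a b))\<^sup>2 / N)"
      proof (rule sum_mono)
        fix b :: 'e assume "b \<in> Basis"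
        then show "norm ((real (k b) / real N) ^ count a b - e k b) \<le> (real (count a b))\<^sup>2 / N"
          using choose_ratio_approx[OF ca[of b] kN, of b] \<open>N > 0\<close> by (simp add: e_def abs_minus_commute)
      qed
      also have "\<dots> = s / N" by (simp add: s_def sum_divide_distrib)
      finally show "\<bar>weight m N k * (monomial a (node N k) - (\<Prod>b\<in>Basis. e k b))\<bar> \<le> weight m N k * (s / real N)"
        using weight_nonneg[OF m, of N k] by (simp add: abs_mult mult_left_mono del: times_divide_eq_right)
    qed
    also have "\<dots> = m {#} * (s / real N)" by (simp only: sum_distrib_right[symmetric] sum_weight)
    finally show "norm (bernstein_sum m N (monomial a) - m a) \<le> m {#} * (s / real N)" .
  qed
qed

section \<open>Convergence of Bernstein sums for continuous functions\<close>

lemma bernstein_sum_add: "bernstein_sum m N (\<lambda>u. f u + g u) = bernstein_sum m N f + bernstein_sum m N g"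
  by (simp add: bernstein_sum_def distrib_left sum.distrib)

lemma bernstein_sum_scale: "bernstein_sum m N (\<lambda>u. c * f u) = c * bernstein_sum m N f"
  by (simp add: bernstein_sum_def sum_distrib_left algebra_simps)

lemma bernstein_sum_bound:
  assumes "m \<in> \<C>" "\<And>u. u \<in> cbox 0 One \<Longrightarrow> \<bar>f u\<bar> \<le> e"
  shows "\<bar>bernstein_sum m N f\<bar> \<le> m {#} * e"
proof -
  have "\<bar>bernstein_sum m N f\<bar> \<le> (\<Sum>k\<in>Basis \<rightarrow>\<^sub>E {..N}. \<bar>weight m N k * f (node N k)\<bar>)"
    unfolding bernstein_sum_def by (rule sum_abs)
  also have "\<dots> \<le> (\<Sum>k\<in>Basis \<rightarrow>\<^sub>E {..N}. weight m N k * e)"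
    using weight_nonneg[OF assms(1), of N] assms(2)[OF node_mem]
    by (intro sum_mono) (auto simp: abs_mult intro!: mult_left_mono)
  also have "\<dots> = m {#} * e" by (simp only: sum_distrib_right[symmetric] sum_weight)
  finally show ?thesis .
qed

lemma convergent_bernstein_sum_polynomial:
  assumes m: "m \<in> \<C>" and P: "real_polynomial_function P"
  shows "convergent (\<lambda>N. bernstein_sum m N P)"
proof -
  \<comment> \<open>An arbitrary monomial factor is built in, since convergence for two polynomials
    separately would say nothing about their product.\<close>
  define good where "good g \<longleftrightarrow> (\<forall>a. set_mset a \<subseteq> Basis \<longrightarrow> convergent (\<lambda>N. bernstein_sum m N (\<lambda>u. g u * monomial a u)))" for g
  have add: "good (\<lambda>u. f u + g u)" if "good f" "good g" for f g
    using that by (auto simp: good_def distrib_right bernstein_sum_add intro: convergent_add)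
  have scale: "good (\<lambda>u. c * f u)" if "good f" for c f
    using that by (auto simp: good_def mult.assoc bernstein_sum_scale intro!: convergent_mult convergent_const)
  have "good (\<lambda>u. P u * g u)" if "good g" for g
    using P that
  proof (induction P arbitrary: g)
    case (linear f)
    have coord: "good (\<lambda>u. (u \<bullet> b) * g u)" if "b \<in> Basis" for b
      unfolding good_def
    proof (intro allI impI)
      fix a :: "'e multiset" assume "set_mset a \<subseteq> Basis"
      then have "convergent (\<lambda>N. bernstein_sum m N (\<lambda>u. g u * monomial (add_mset b a) u))"
        using \<open>good g\<close> that by (simp add: good_def)
      then show "convergent (\<lambda>N. bernstein_sum m N (\<lambda>u. (u \<bullet> b) * g u * monomial a u))"
        by (simp add: monomial_def algebra_simps)
    qed
    have *: "f u = (\<Sum>b\<in>Basis. f b * (u \<bullet> b))" for u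
    proof -
      interpret bounded_linear f by (rule linear)
      have "f (\<Sum>b\<in>Basis. (u \<bullet> b) *\<^sub>R b) = (\<Sum>b\<in>Basis. f b * (u \<bullet> b))"
        unfolding sum scaleR by (simp only: real_scaleR_def mult.commute)
      then show ?thesis unfolding euclidean_representation .
    qed
    have **: "f u * g u = (\<Sum>b\<in>Basis. f b * ((u \<bullet> b) * g u))" for u
      using arg_cong[OF *, of "\<lambda>t. t * g u" u] by (simp add: sum_distrib_right mult.assoc)
    have "good (\<lambda>u. \<Sum>b\<in>A. f b * ((u \<bullet> b) * g u))" if "finite A" "A \<subseteq> Basis" for A
      using that
    proof (induction A rule: finite_induct)
      case empty
      then show ?case by (simp add: good_def bernstein_sum_def convergent_const)
    next
      case (insert b A)
      then show ?case using add[OF scale[OF coord[of b], of "f b"], of "\<lambda>u. \<Sum>b\<in>A. f b * ((u \<bullet> b) * g u)"] by simp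
    qed
    then show ?case unfolding ** by auto
  next
    case (const c)
    then show ?case by (rule scale)
  next
    case (add f f')
    then show ?case using \<open>\<And>f g. good f \<Longrightarrow> good g \<Longrightarrow> good (\<lambda>u. f u + g u)\<close>[of "\<lambda>u. f u * g u" "\<lambda>u. f' u * g u"]
      by (simp add: distrib_right)
  next
    case (mult f f')
    then show ?case using mult.IH(1)[OF mult.IH(2)[OF mult.prems]] by (simp add: mult.assoc)
  qed
  moreover have "good (\<lambda>u. 1)"
    unfolding good_def using bernstein_sum_monomial[OF m] by (auto simp: convergent_def)
  ultimately have "good (\<lambda>u. P u * 1)" .
  then show ?thesis unfolding good_def by (auto simp: monomial_def dest: spec[of _ "{#}"])
qed

text \<open>Uniform approximation by polynomials: the sums are bounded by \<open>m {#}\<close> times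
  the supremum over the cube, uniformly in \<open>N\<close>, so the Cauchy property passes to
  uniform limits.\<close>

lemma convergent_bernstein_sum:
  assumes m: "m \<in> \<C>" and f: "continuous_on (cbox 0 One) f"
  shows "convergent (\<lambda>N. bernstein_sum m N f)"
proof (rule Cauchy_convergent, rule CauchyI)
  fix e :: real assume e: "0 < e"
  define d where "d = e / (4 * (m {#} + 1))"
  have d: "d > 0" "m {#} * d \<le> e / 4"
    using e nonneg[OF m] by (auto simp: d_def field_simps)
  obtain p where p: "real_polynomial_function p" "\<And>u. u \<in> cbox 0 One \<Longrightarrow> \<bar>f u - p u\<bar> < d"
    using Stone_Weierstrass_real_polynomial_function[OF compact_cbox f d(1)] by blast
  have close: "\<bar>bernstein_sum m N f - bernstein_sum m N p\<bar> \<le> e / 4" for N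
  proof -
    have "bernstein_sum m N f - bernstein_sum m N p = bernstein_sum m N (\<lambda>u. f u - p u)"
      by (simp add: bernstein_sum_def sum_subtractf right_diff_distrib)
    then show ?thesis
      using bernstein_sum_bound[OF m, of "\<lambda>u. f u - p u" d N] p(2) d(2) by (force intro: less_imp_le)
  qed
  obtain N where N: "\<And>k l. k \<ge> N \<Longrightarrow> l \<ge> N \<Longrightarrow> \<bar>bernstein_sum m k p - bernstein_sum m l p\<bar> < e / 4"
    using CauchyD[OF convergent_Cauchy[OF convergent_bernstein_sum_polynomial[OF m p(1)]], of "e/4"] e by auto
  show "\<exists>M. \<forall>k\<ge>M. \<forall>l\<ge>M. norm (bernstein_sum m k f - bernstein_sum m l f) < e"
  proof (intro exI allI impI)
    fix k l assume "N \<le> k" "N \<le> l"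
    from N[OF this] close[of k] close[of l] e show "norm (bernstein_sum m k f - bernstein_sum m l f) < e"
      unfolding real_norm_def by linarith
  qed
qed

theorem hausdorff_moment_problem:
  assumes m: "m \<in> \<C>"
  shows "\<exists>M. finite_measure M \<and> sets M = sets borel \<and> emeasure M (- cbox 0 One) = 0 \<and>
    (\<forall>a. set_mset a \<subseteq> Basis \<longrightarrow> (\<integral>u. (\<Prod>b\<in>#a. u \<bullet> b) \<partial>M) = m a)"
proof -
  define L where "L f = lim (\<lambda>N. bernstein_sum m N f)" for f
  have L: "(\<lambda>N. bernstein_sum m N f) \<longlonglongrightarrow> L f" if "continuous_on UNIV f" for f
    unfolding L_def using convergent_bernstein_sum[OF m continuous_on_subset[OF that]]
    by (simp add: convergent_LIMSEQ_iff)
  interpret positive_functional "cbox 0 One" L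
  proof
    show "compact (cbox (0::'e) One)" by (rule compact_cbox)
    fix f g :: "'e \<Rightarrow> real" and c :: real
    assume f: "continuous_on UNIV f"
    show "L (\<lambda>x. c * f x) = c * L f"
      using LIMSEQ_unique[OF L[OF continuous_on_mult_left[OF f], of c]] tendsto_mult_left[OF L[OF f], of c]
      unfolding bernstein_sum_scale by blast
    show "0 \<le> L f" if "\<And>x. x \<in> cbox 0 One \<Longrightarrow> 0 \<le> f x"
      using that weight_nonneg[OF m] node_mem
      by (intro LIMSEQ_le_const[OF L[OF f]]) (auto simp: bernstein_sum_def intro!: sum_nonneg mult_nonneg_nonneg)
    assume g: "continuous_on UNIV g"
    show "L (\<lambda>x. f x + g x) = L f + L g"
      using LIMSEQ_unique[OF L[OF continuous_on_add[OF f g]]] tendsto_add[OF L[OF f] L[OF g]]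
      unfolding bernstein_sum_add by blast
  qed
  obtain M where M: "finite_measure M" "sets M = sets borel" "emeasure M (- cbox 0 One) = 0"
    "\<And>f. continuous_on UNIV f \<Longrightarrow> L f = (\<integral>x. f x \<partial>M)"
    using riesz_markov by blast
  have "(\<integral>u. monomial a u \<partial>M) = m a" if a: "set_mset a \<subseteq> Basis" for a
  proof -
    have c: "continuous_on UNIV (monomial a)"
      unfolding monomial_eq[OF a] by (intro continuous_intros)
    show ?thesis
      using LIMSEQ_unique[OF L[OF c] bernstein_sum_monomial[OF m a]] M(4)[OF c] by simp
  qed
  then show ?thesis using M unfolding monomial_def by blast
qed

end

section \<open>Positive forms invariant under a commuting tuple\<close>

lemma index_induct:
  fixes \<alpha> :: "nat ^ 'd::finite"
  assumes zero: "P 0" and step: "\<And>\<alpha> j. P \<alpha> \<Longrightarrow> P (\<alpha> + axis j 1)"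
  shows "P \<alpha>"
proof (induction "index_abs \<alpha>" arbitrary: \<alpha>)
  case 0
  then have "\<alpha> = 0" by (auto simp: index_abs_def vec_eq_iff)
  then show ?case using zero by simp
next
  case (Suc n)
  have "\<exists>j. \<alpha> $ j \<noteq> 0"
  proof (rule ccontr)
    assume "\<nexists>j. \<alpha> $ j \<noteq> 0"
    then have "index_abs \<alpha> = 0" by (simp add: index_abs_def)
    with Suc(2) show False by simp
  qed
  then obtain j where j: "\<alpha> $ j \<noteq> 0" by blast
  define \<beta> where "\<beta> = (\<chi> k. if k = j then \<alpha> $ j - 1 else \<alpha> $ k)"
  have ab: "\<alpha> = \<beta> + axis j 1" using j by (auto simp: \<beta>_def vec_eq_iff axis_def)
  have "index_abs \<alpha> = index_abs \<beta> + 1"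
    unfolding ab by (simp add: index_abs_def sum.distrib axis_def)
  then show ?case using Suc step[of \<beta> j] ab by simp
qed

lemma commuting_tupleD:
  assumes "commuting_tuple T"
  shows "bounded_clinear (T j)" "T j (T k x) = T k (T j x)"
    "T j (x + y) = T j x + T j y" "T j (c *\<^sub>C x) = c *\<^sub>C T j x"
  using assms bounded_clinearD(1,2)[of "T j"] by (auto simp: commuting_tuple_def fun_eq_iff)

lemma tuple_power_zero [simp]:
  fixes T :: "'d::{finite,linorder} \<Rightarrow> 'h \<Rightarrow> 'h"
  shows "tuple_power T 0 x = x"
proof -
  have "foldr (\<lambda>j S. (T j ^^ ((0 :: nat ^ 'd::{finite,linorder}) $ j)) \<circ> S) js id = id" for js
    by (induction js) auto
  then show ?thesis by (simp add: tuple_power_def)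
qed

text \<open>The powers are composed in the fixed order of the index type; commutation carries the
  additional factor to the front. Inductions along \<open>index_induct\<close> rest on this
  rule.\<close>

lemma tuple_power_axis:
  assumes T: "commuting_tuple T"
  shows "tuple_power T (\<alpha> + axis j 1) x = T j (tuple_power T \<alpha> x)"
proof -
  have comm: "(T k ^^ n) (T j x) = T j ((T k ^^ n) x)" for k n x
    by (induction n) (auto simp: commuting_tupleD(2)[OF T, of k j])
  have "foldr (\<lambda>k S. (T k ^^ ((\<alpha> + axis j 1) $ k)) \<circ> S) js id x
      = (if j \<in> set js then T j else id) (foldr (\<lambda>k S. (T k ^^ (\<alpha> $ k)) \<circ> S) js id x)"
    if "distinct js" for js
    using that by (induction js) (auto simp: axis_def comm)
  from this[of "sorted_list_of_set UNIV"] show ?thesis by (simp add: tuple_power_def)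
qed

lemma bounded_clinear_tuple_power:
  assumes T: "commuting_tuple T"
  shows "bounded_clinear (tuple_power T \<alpha>)"
proof (induction \<alpha> rule: index_induct)
  case 1
  show ?case using bounded_clinearI[of "\<lambda>x. x" 1] by (simp cong: arg_cong[where f = bounded_clinear] add: fun_eq_iff)
next
  case (2 \<alpha> j)
  have "tuple_power T (\<alpha> + axis j 1) = (\<lambda>x. T j (tuple_power T \<alpha> x))"
    using tuple_power_axis[OF T] by blast
  then show ?case
    using 2 commuting_tupleD(1)[OF T, of j] bounded_linear_compose[of "T j" "tuple_power T \<alpha>"]
    by (auto simp: bounded_clinear_def)
qed

section \<open>Invariant forms and the action of the real coordinates\<close>

definition positive_form :: "('h::complex_inner \<Rightarrow> 'h \<Rightarrow> complex) \<Rightarrow> bool" where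
  "positive_form B \<longleftrightarrow> sesquilinear B \<and> (\<forall>x. B x x \<in> \<real>\<^sub>\<ge>\<^sub>0)"

definition invariant_form :: "('d::finite \<Rightarrow> 'h \<Rightarrow> 'h) \<Rightarrow> ('h::complex_inner \<Rightarrow> 'h \<Rightarrow> complex) \<Rightarrow> bool" where
  "invariant_form T B \<longleftrightarrow> positive_form B \<and> (\<forall>x y. (\<Sum>j\<in>UNIV. B (T j x) (T j y)) = B x y)"

definition combination :: "('d::finite \<Rightarrow> 'h \<Rightarrow> 'h::complex_inner) \<Rightarrow> complex ^ 'd \<Rightarrow> 'h \<Rightarrow> 'h" where
  "combination T b x = (\<Sum>j\<in>UNIV. b $ j *\<^sub>C T j x)"

text \<open>If \<open>B\<close> has a representing measure \<open>\<mu>\<close> on the sphere, so that \<open>B x (T\<^sub>j y)\<close> and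
  \<open>B (T\<^sub>j x) y\<close> correspond to \<open>\<zeta>\<^sub>j \<mu>\<close> and to the conjugate of \<open>\<zeta>\<^sub>j\<close> times \<open>\<mu>\<close>, then this form is
  represented by \<open>(1 + \<langle>\<zeta>, b\<rangle>) / 2 \<cdot> \<mu>\<close> with the real inner product.\<close>

definition coordinate_form ::
    "('d::finite \<Rightarrow> 'h \<Rightarrow> 'h::complex_inner) \<Rightarrow> complex ^ 'd \<Rightarrow> ('h \<Rightarrow> 'h \<Rightarrow> complex) \<Rightarrow> 'h \<Rightarrow> 'h \<Rightarrow> complex" where
  "coordinate_form T b B = (\<lambda>x y. B x y / 2 + (B x (combination T b y) + B (combination T b x) y) / 4)"

lemma combination_axis: "combination T (axis j c) x = c *\<^sub>C T j x"
  unfolding combination_def axis_def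
  by (simp add: if_distrib[of "\<lambda>c. c *\<^sub>C _"] cong: if_cong)

lemma combination_minus: "combination T (- b) x = - combination T b x"
  by (simp add: combination_def sum_negf)

lemma combination_commute_T:
  assumes T: "commuting_tuple T"
  shows "T k (combination T b x) = combination T b (T k x)"
proof -
  have "T k (\<Sum>j\<in>J. b $ j *\<^sub>C T j x) = (\<Sum>j\<in>J. b $ j *\<^sub>C T j (T k x))" if "finite J" for J
    using that
  proof (induction J rule: finite_induct)
    case empty
    show ?case using commuting_tupleD(4)[OF T, of k 0 0] by simp
  next
    case (insert j J)
    then show ?case by (simp add: commuting_tupleD(3,4)[OF T] commuting_tupleD(2)[OF T, of k j])
  qed
  then show ?thesis by (simp add: combination_def)
qed

lemma combination_commute:
  assumes T: "commuting_tuple T"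
  shows "combination T b (combination T c x) = combination T c (combination T b x)"
proof -
  have "combination T b (combination T c x) = (\<Sum>j\<in>UNIV. b $ j *\<^sub>C combination T c (T j x))"
    unfolding combination_def[of T b] combination_commute_T[OF T] ..
  also have "\<dots> = (\<Sum>j\<in>UNIV. \<Sum>k\<in>UNIV. (b $ j * c $ k) *\<^sub>C T k (T j x))"
    by (simp add: combination_def complex_vector.scale_sum_right)
  also have "\<dots> = (\<Sum>k\<in>UNIV. \<Sum>j\<in>UNIV. (c $ k * b $ j) *\<^sub>C T j (T k x))"
    by (subst sum.swap) (simp add: mult.commute commuting_tupleD(2)[OF T])
  also have "\<dots> = (\<Sum>k\<in>UNIV. c $ k *\<^sub>C combination T b (T k x))"
    by (simp add: combination_def complex_vector.scale_sum_right)
  also have "\<dots> = combination T c (combination T b x)"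
    unfolding combination_def[of T c] combination_commute_T[OF T] ..
  finally show ?thesis .
qed

lemma combination_linear:
  assumes T: "commuting_tuple T"
  shows "combination T b (x + y) = combination T b x + combination T b y"
    "combination T b (c *\<^sub>C x) = c *\<^sub>C combination T b x"
  by (simp_all add: combination_def commuting_tupleD[OF T] sum.distrib scaleC_add_right
      complex_vector.scale_sum_right mult.commute)

text \<open>Operations on different arguments of a form commute trivially, those on the same
  argument because \<open>T\<close> does; so folding the coordinates over a multiset is well
  defined.\<close>

lemma comp_fun_commute_coordinate_form:
  assumes T: "commuting_tuple T"
  shows "comp_fun_commute (coordinate_form T)"
proof
  show "coordinate_form T b \<circ> coordinate_form T c = coordinate_form T c \<circ> coordinate_form T b" for b c
    by (intro ext) (simp add: coordinate_form_def combination_commute[OF T, of b c] field_simps)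
qed

lemma sesquilinear_coordinate_form:
  assumes T: "commuting_tuple T" and B: "sesquilinear B"
  shows "sesquilinear (coordinate_form T b B)"
  by (intro sesquilinearI)
    (simp_all add: coordinate_form_def combination_linear[OF T] sesquilinear_simps[OF B] field_simps)

lemma complex_nonneg_Reals_add: "x \<in> \<real>\<^sub>\<ge>\<^sub>0 \<Longrightarrow> y \<in> \<real>\<^sub>\<ge>\<^sub>0 \<Longrightarrow> x + y \<in> \<real>\<^sub>\<ge>\<^sub>0" for x y :: complex
  by (auto simp: complex_nonneg_Reals_iff)

lemma complex_nonneg_Reals_sum: "(\<And>i. i \<in> I \<Longrightarrow> f i \<in> \<real>\<^sub>\<ge>\<^sub>0) \<Longrightarrow> sum f I \<in> \<real>\<^sub>\<ge>\<^sub>0" for f :: "'a \<Rightarrow> complex"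
  by (auto simp: complex_nonneg_Reals_iff intro: sum_nonneg)

text \<open>A unimodular \<open>c\<close> treats real and imaginary coordinates together with their
  negatives; the negatives are what the complementary forms require.\<close>

lemma invariant_coordinate_form:
  assumes T: "commuting_tuple T" and B: "invariant_form T B" and c: "cmod c = 1"
  shows "invariant_form T (coordinate_form T (axis j c) B)"
proof -
  have sB: "sesquilinear B" and pB: "\<And>x. B x x \<in> \<real>\<^sub>\<ge>\<^sub>0" and iB: "\<And>x y. (\<Sum>j\<in>UNIV. B (T j x) (T j y)) = B x y"
    using B by (auto simp: invariant_form_def positive_form_def)
  have "coordinate_form T (axis j c) B x x \<in> \<real>\<^sub>\<ge>\<^sub>0" for x
  proof -
    define w where "w = c *\<^sub>C T j x"
    have "c * cnj c = 1" using complex_norm_square[of c] c by simp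
    then have "B w w = B (T j x) (T j x)"
      by (simp add: w_def sesquilinear_simps[OF sB] mult.assoc[symmetric] mult.commute)
    moreover have "B x x = B (T j x) (T j x) + (\<Sum>k\<in>UNIV - {j}. B (T k x) (T k x))"
      by (subst iB[symmetric]) (rule sum.remove, auto)
    \<comment> \<open>Of the two copies of \<open>B x x\<close>, one completes the square and the
      other is expanded by invariance; its j-th summand is \<open>B w w\<close>.\<close>
    ultimately have "2 * B x x + B x w + B w x = B (x + w) (x + w) + (\<Sum>k\<in>UNIV - {j}. B (T k x) (T k x))"
      by (simp add: sesquilinear_simps[OF sB])
    moreover have "\<dots> \<in> \<real>\<^sub>\<ge>\<^sub>0"
      by (intro complex_nonneg_Reals_add complex_nonneg_Reals_sum pB)
    ultimately have "2 * B x x + B x w + B w x \<in> \<real>\<^sub>\<ge>\<^sub>0" by simp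
    moreover have "coordinate_form T (axis j c) B x x = (2 * B x x + B x w + B w x) / 4"
      by (simp add: coordinate_form_def combination_axis w_def field_simps)
    ultimately show ?thesis by (simp only:) (auto simp: complex_nonneg_Reals_iff)
  qed
  moreover have "(\<Sum>k\<in>UNIV. coordinate_form T b B (T k x) (T k y)) = coordinate_form T b B x y" for b x y
    unfolding coordinate_form_def combination_commute_T[OF T, symmetric] sum.distrib
      sum_divide_distrib[symmetric] iB ..
  ultimately show ?thesis
    using sesquilinear_coordinate_form[OF T sB] by (auto simp: invariant_form_def positive_form_def)
qed

text \<open>The identity 1 - (1 + c)/2 = (1 - c)/2, where passing from c to -c replaces
  \<open>b\<close> by \<open>- b\<close>.\<close>

lemma coordinate_form_complement:
  assumes "sesquilinear B"
  shows "(\<lambda>x y. B x y - coordinate_form T b B x y) = coordinate_form T (- b) B"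
  by (intro ext) (simp add: coordinate_form_def combination_minus sesquilinear_simps[OF assms] field_simps)

lemma Basis_complex_vec: "b \<in> Basis \<longleftrightarrow> (\<exists>j. b = axis j 1 \<or> b = axis j \<i>)" for b :: "complex ^ 'd"
  by (auto simp: Basis_vec_def Basis_complex_def)

lemma invariant_form_Basis:
  assumes T: "commuting_tuple T" and B: "invariant_form T B" and b: "b \<in> Basis"
  shows "invariant_form T (coordinate_form T b B)"
    "invariant_form T (\<lambda>x y. B x y - coordinate_form T b B x y)"
proof -
  have sB: "sesquilinear B" using B by (auto simp: invariant_form_def positive_form_def)
  obtain j c where jc: "b = axis j c" "cmod c = 1" using b by (auto simp: Basis_complex_vec)
  then show "invariant_form T (coordinate_form T b B)"
    using invariant_coordinate_form[OF T B] by simp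
  have "- b = axis j (- c)" by (auto simp: jc axis_def vec_eq_iff)
  then show "invariant_form T (\<lambda>x y. B x y - coordinate_form T b B x y)"
    unfolding coordinate_form_complement[OF sB] using invariant_coordinate_form[OF T B] jc by simp
qed

lemma coordinate_form_diff:
  "coordinate_form T b (\<lambda>x y. B x y - B' x y) = (\<lambda>x y. coordinate_form T b B x y - coordinate_form T b B' x y)"
  by (simp add: coordinate_form_def field_simps fun_eq_iff)

locale commuting =
  fixes T :: "'d::{finite,linorder} \<Rightarrow> 'h::complex_inner \<Rightarrow> 'h"
  assumes T: "commuting_tuple T"
begin

sublocale coordinate: comp_fun_commute "coordinate_form T"
  by (rule comp_fun_commute_coordinate_form[OF T])

abbreviation moment_form :: "('h \<Rightarrow> 'h \<Rightarrow> complex) \<Rightarrow> (complex ^ 'd::{finite,linorder}) multiset \<Rightarrow> 'h \<Rightarrow> 'h \<Rightarrow> complex" where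
  "moment_form \<equiv> fold_mset (coordinate_form T)"

lemma moment_form_diff:
  "moment_form (\<lambda>x y. B x y - B' x y) a = (\<lambda>x y. moment_form B a x y - moment_form B' a x y)"
  by (induction a) (simp_all add: coordinate_form_diff)

lemma invariant_moment_form:
  "invariant_form T B \<Longrightarrow> set_mset a \<subseteq> Basis \<Longrightarrow> invariant_form T (moment_form B a)"
  by (induction a) (simp_all add: invariant_form_Basis[OF T])

text \<open>The vector \<open>x\<close> is fixed and the form varies: a shift or a difference of the
  moments of \<open>B\<close> is the moment sequence of another invariant form at the same
  \<open>x\<close>.\<close>

lemma completely_monotone_moments:
  "completely_monotone {\<lambda>a. Re (moment_form B a x x) | B. invariant_form T B}"
proof
  fix m b assume "m \<in> {\<lambda>a. Re (moment_form B a x x) | B. invariant_form T B}"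
  then obtain B where m: "m = (\<lambda>a. Re (moment_form B a x x))" and B: "invariant_form T B" by blast
  show "0 \<le> m {#}"
    using B by (auto simp: m invariant_form_def positive_form_def complex_nonneg_Reals_iff)
  assume b: "b \<in> (Basis :: (complex ^ 'd::{finite,linorder}) set)"
  \<comment> \<open>The fold applies the new coordinate last; commutativity lets it act on
    \<open>B\<close> first.\<close>
  have shift: "moment_form B (add_mset b a) = moment_form (coordinate_form T b B) a" for a
    by (simp add: coordinate.fold_mset_fun_left_comm)
  show "(\<lambda>a. m (add_mset b a)) \<in> {\<lambda>a. Re (moment_form B a x x) | B. invariant_form T B}"
    unfolding m shift using invariant_form_Basis(1)[OF T B b] by blast
  have "(\<lambda>a. m a - m (add_mset b a)) = (\<lambda>a. Re (moment_form (\<lambda>x y. B x y - coordinate_form T b B x y) a x x))"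
    unfolding m shift moment_form_diff by simp
  then show "(\<lambda>a. m a - m (add_mset b a)) \<in> {\<lambda>a. Re (moment_form B a x x) | B. invariant_form T B}"
    using invariant_form_Basis(2)[OF T B b] by blast
qed

end

section \<open>Mixed monomials and the passage from the cube to the sphere\<close>

definition mixed_monomial :: "nat ^ 'd::finite \<Rightarrow> nat ^ 'd \<Rightarrow> complex ^ 'd \<Rightarrow> complex" where
  "mixed_monomial \<alpha> \<beta> \<zeta> = (\<Prod>j\<in>UNIV. (\<zeta> $ j) ^ (\<alpha> $ j)) * (\<Prod>j\<in>UNIV. cnj (\<zeta> $ j) ^ (\<beta> $ j))"

lemma mixed_monomial_zero: "mixed_monomial 0 0 \<zeta> = 1"
  by (simp add: mixed_monomial_def)

lemma prod_power_axis:
  fixes z :: "'d::finite \<Rightarrow> complex"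
  shows "(\<Prod>k\<in>UNIV. z k ^ ((\<alpha> + axis j 1) $ k)) = z j * (\<Prod>k\<in>UNIV. z k ^ (\<alpha> $ k))"
proof -
  have "(\<Prod>k\<in>UNIV. z k ^ ((\<alpha> + axis j 1) $ k)) = (\<Prod>k\<in>UNIV. z k ^ (\<alpha> $ k) * (if k = j then z k else 1))"
    by (rule prod.cong) (auto simp: axis_def)
  then show ?thesis by (simp add: prod.distrib mult.commute)
qed

lemma mixed_monomial_axis:
  "mixed_monomial (\<alpha> + axis j 1) \<beta> \<zeta> = \<zeta> $ j * mixed_monomial \<alpha> \<beta> \<zeta>"
  "mixed_monomial \<alpha> (\<beta> + axis j 1) \<zeta> = cnj (\<zeta> $ j) * mixed_monomial \<alpha> \<beta> \<zeta>"
  by (simp_all only: mixed_monomial_def prod_power_axis mult_ac)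

lemma continuous_mixed_monomial [continuous_intros]:
  "continuous_on S f \<Longrightarrow> continuous_on S (\<lambda>x. mixed_monomial \<alpha> \<beta> (f x))"
  unfolding mixed_monomial_def by (intro continuous_intros)

text \<open>The inverse of the normalisation (1 + c)/2, taken in all real coordinates at once; it
  maps the unit cube onto the cube of side 2 around the origin.\<close>

definition scaled :: "complex ^ 'd::finite \<Rightarrow> complex ^ 'd" where
  "scaled u = 2 *\<^sub>R u - One"

lemma One_nth: "(One :: complex ^ 'd) $ j = 1 + \<i>"
proof -
  have "Re ((One :: complex ^ 'd) $ j) = One \<bullet> (axis j 1 :: complex ^ 'd)" "Im ((One :: complex ^ 'd) $ j) = One \<bullet> (axis j \<i> :: complex ^ 'd)"
    by (simp_all add: inner_axis inner_complex_def del: inner_sum_left_Basis)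
  moreover have "One \<bullet> (axis j 1 :: complex ^ 'd) = 1"
    by (rule inner_sum_Basis) (auto simp: Basis_complex_vec)
  moreover have "One \<bullet> (axis j \<i> :: complex ^ 'd) = 1"
    by (rule inner_sum_Basis) (auto simp: Basis_complex_vec)
  ultimately show ?thesis by (simp add: complex_eq_iff)
qed

lemma scaled_nth: "scaled u $ j = complex_of_real (2 * (u \<bullet> axis j 1) - 1) + \<i> * complex_of_real (2 * (u \<bullet> axis j \<i>) - 1)"
  unfolding scaled_def vector_minus_component vector_scaleR_component One_nth
  by (simp add: inner_axis inner_complex_def complex_eq_iff)

context commuting begin

text \<open>The operation 2p - 1 recovers the coordinate c from p = (1 + c)/2; real part plus or
  minus i times imaginary part then leaves a single \<open>T j\<close> in one argument.\<close>

lemma coordinate_form_raise: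
  assumes B: "sesquilinear B"
  shows "(2 * coordinate_form T (axis j 1) B x y - B x y) + \<i> * (2 * coordinate_form T (axis j \<i>) B x y - B x y) = B x (T j y)"
    "(2 * coordinate_form T (axis j 1) B x y - B x y) - \<i> * (2 * coordinate_form T (axis j \<i>) B x y - B x y) = B (T j x) y"
  by (simp_all add: coordinate_form_def combination_axis sesquilinear_simps[OF B] field_simps)

text \<open>Turns moments in the real variables u into moments in \<zeta> and its conjugate. The
  multiset \<open>a\<close> stays general because raising an exponent by one step adds real
  coordinates to it.\<close>

lemma moment_integral:
  assumes B: "invariant_form T B"
    and M: "finite_measure M" "sets M = sets borel" "emeasure M (- cbox 0 One) = 0"
    and moments: "\<And>a. set_mset a \<subseteq> Basis \<Longrightarrow> (\<integral>u. (\<Prod>b\<in>#a. u \<bullet> b) \<partial>M) = Re (moment_form B a x x)"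
    and a: "set_mset a \<subseteq> Basis"
  shows "(\<integral>u. mixed_monomial \<alpha> \<beta> (scaled u) * complex_of_real (\<Prod>b\<in>#a. u \<bullet> b) \<partial>M)
    = moment_form B a (tuple_power T \<beta> x) (tuple_power T \<alpha> x)"
proof -
  have cont: "continuous_on UNIV (\<lambda>u :: complex ^ 'd::{finite,linorder}. \<Prod>b\<in>#a. u \<bullet> b)" for a :: "(complex ^ 'd::{finite,linorder}) multiset"
    by (induction a) (auto intro!: continuous_intros)
  have int: "integrable M (\<lambda>u. mixed_monomial \<alpha> \<beta> (scaled u) * complex_of_real (\<Prod>b\<in>#a. u \<bullet> b))" for \<alpha> \<beta> a
    unfolding scaled_def by (intro integrable_continuous[OF M compact_cbox] continuous_intros cont)
  let ?I = "\<lambda>\<alpha> \<beta> a. \<integral>u. mixed_monomial \<alpha> \<beta> (scaled u) * complex_of_real (\<Prod>b\<in>#a. u \<bullet> b) \<partial>M"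
  have sq: "sesquilinear (moment_form B a)" if "set_mset a \<subseteq> Basis" for a
    using invariant_moment_form[OF B that] by (auto simp: invariant_form_def positive_form_def)
  have step: "(\<integral>u. scaled u $ j * (mixed_monomial \<alpha> \<beta> (scaled u) * complex_of_real (\<Prod>b\<in>#a. u \<bullet> b)) \<partial>M)
      = (2 * ?I \<alpha> \<beta> (add_mset (axis j 1) a) - ?I \<alpha> \<beta> a) + \<i> * (2 * ?I \<alpha> \<beta> (add_mset (axis j \<i>) a) - ?I \<alpha> \<beta> a)"
    "(\<integral>u. cnj (scaled u $ j) * (mixed_monomial \<alpha> \<beta> (scaled u) * complex_of_real (\<Prod>b\<in>#a. u \<bullet> b)) \<partial>M)
      = (2 * ?I \<alpha> \<beta> (add_mset (axis j 1) a) - ?I \<alpha> \<beta> a) - \<i> * (2 * ?I \<alpha> \<beta> (add_mset (axis j \<i>) a) - ?I \<alpha> \<beta> a)" for \<alpha> \<beta> j a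
  proof -
    let ?f = "\<lambda>a u. mixed_monomial \<alpha> \<beta> (scaled u) * complex_of_real (\<Prod>b\<in>#a. u \<bullet> b)"
    have "scaled u $ j * ?f a u = (2 * ?f (add_mset (axis j 1) a) u - ?f a u) + \<i> * (2 * ?f (add_mset (axis j \<i>) a) u - ?f a u)"
       "cnj (scaled u $ j) * ?f a u = (2 * ?f (add_mset (axis j 1) a) u - ?f a u) - \<i> * (2 * ?f (add_mset (axis j \<i>) a) u - ?f a u)" for u
      by (simp_all add: scaled_nth algebra_simps)
    note eqs = this
    have lin: "(\<integral>u. (2 * g u - f u) + \<i> * (2 * h u - f u) \<partial>M) = (2 * integral\<^sup>L M g - integral\<^sup>L M f) + \<i> * (2 * integral\<^sup>L M h - integral\<^sup>L M f)"
      "(\<integral>u. (2 * g u - f u) - \<i> * (2 * h u - f u) \<partial>M) = (2 * integral\<^sup>L M g - integral\<^sup>L M f) - \<i> * (2 * integral\<^sup>L M h - integral\<^sup>L M f)"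
      if "integrable M f" "integrable M g" "integrable M h" for f g h :: "complex ^ 'd::{finite,linorder} \<Rightarrow> complex"
      using that by simp_all
    show "(\<integral>u. scaled u $ j * ?f a u \<partial>M) = (2 * ?I \<alpha> \<beta> (add_mset (axis j 1) a) - ?I \<alpha> \<beta> a) + \<i> * (2 * ?I \<alpha> \<beta> (add_mset (axis j \<i>) a) - ?I \<alpha> \<beta> a)"
      "(\<integral>u. cnj (scaled u $ j) * ?f a u \<partial>M) = (2 * ?I \<alpha> \<beta> (add_mset (axis j 1) a) - ?I \<alpha> \<beta> a) - \<i> * (2 * ?I \<alpha> \<beta> (add_mset (axis j \<i>) a) - ?I \<alpha> \<beta> a)"
      unfolding eqs by (rule lin; rule int)+
  qed
  have ax: "axis j 1 \<in> (Basis :: (complex ^ 'd::{finite,linorder}) set)" "axis j \<i> \<in> (Basis :: (complex ^ 'd::{finite,linorder}) set)" for j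
    by (auto simp: Basis_complex_vec)
  \<comment> \<open>The exponent \<alpha> is built up before \<beta>; each step moves one
    \<open>T j\<close> into the second argument, and later steps for \<beta> into the first.\<close>
  have first: "?I \<alpha> 0 a = moment_form B a x (tuple_power T \<alpha> x)" if "set_mset a \<subseteq> Basis" for \<alpha> a
    using that
  proof (induction \<alpha> arbitrary: a rule: index_induct)
    case 1
    have "moment_form B a x x \<in> \<real>\<^sub>\<ge>\<^sub>0"
      using invariant_moment_form[OF B 1] by (auto simp: invariant_form_def positive_form_def)
    \<comment> \<open>The moment problem only knows real parts; nothing is lost, as the moment form
      is positive and therefore real on the diagonal.\<close>
    then have "complex_of_real (Re (moment_form B a x x)) = moment_form B a x x"
      by (auto simp: complex_nonneg_Reals_iff complex_eq_iff)
    then show ?case using moments[OF 1] by (simp add: mixed_monomial_zero)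
  next
    case (2 \<alpha> j)
    have "?I (\<alpha> + axis j 1) 0 a = (\<integral>u. scaled u $ j * (mixed_monomial \<alpha> 0 (scaled u) * complex_of_real (\<Prod>b\<in>#a. u \<bullet> b)) \<partial>M)"
      by (simp only: mixed_monomial_axis mult.assoc)
    moreover have "?I \<alpha> 0 a = moment_form B a x (tuple_power T \<alpha> x)" using 2 by blast
    moreover have "?I \<alpha> 0 (add_mset b a) = coordinate_form T b (moment_form B a) x (tuple_power T \<alpha> x)" if "b \<in> Basis" for b
      using 2(1)[of "add_mset b a"] 2(2) that
      by (simp only: coordinate.fold_mset_add_mset set_mset_add_mset_insert insert_subset simp_thms)
    ultimately show ?case
      by (simp only: step ax tuple_power_axis[OF T] coordinate_form_raise(1)[OF sq[OF 2(2)]])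
  qed
  show ?thesis using a
  proof (induction \<beta> arbitrary: a rule: index_induct)
    case 1
    then show ?case using first by simp
  next
    case (2 \<beta> j)
    have "?I \<alpha> (\<beta> + axis j 1) a = (\<integral>u. cnj (scaled u $ j) * (mixed_monomial \<alpha> \<beta> (scaled u) * complex_of_real (\<Prod>b\<in>#a. u \<bullet> b)) \<partial>M)"
      by (simp only: mixed_monomial_axis mult.assoc)
    moreover have "?I \<alpha> \<beta> a = moment_form B a (tuple_power T \<beta> x) (tuple_power T \<alpha> x)" using 2 by blast
    moreover have "?I \<alpha> \<beta> (add_mset b a) = coordinate_form T b (moment_form B a) (tuple_power T \<beta> x) (tuple_power T \<alpha> x)" if "b \<in> Basis" for b
      using 2(1)[of "add_mset b a"] 2(2) that
      by (simp only: coordinate.fold_mset_add_mset set_mset_add_mset_insert insert_subset simp_thms)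
    ultimately show ?case
      by (simp only: step ax tuple_power_axis[OF T] coordinate_form_raise(2)[OF sq[OF 2(2)]])
  qed
qed

lemma norm_sq_eq_mixed_monomial:
  fixes z :: "complex ^ 'd::{finite,linorder}"
  shows "complex_of_real ((norm z)\<^sup>2) = (\<Sum>j\<in>UNIV. mixed_monomial (axis j 1) (axis j 1) z)"
proof -
  have "mixed_monomial (axis j 1) (axis j 1) z = z $ j * cnj (z $ j)" for j
    using mixed_monomial_axis(1)[of 0 j "axis j 1" z] mixed_monomial_axis(2)[of 0 0 j z]
    by (simp add: mixed_monomial_zero)
  then show ?thesis
    by (simp add: norm_vec_def L2_set_def sum_nonneg complex_norm_square[symmetric] del: of_real_power)
qed

theorem invariant_form_measure:
  assumes B: "invariant_form T B"
  shows "\<exists>M. finite_measure M \<and> sets M = sets borel \<and> emeasure M (- sphere 0 1) = 0 \<and>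
    (\<forall>\<alpha> \<beta>. (\<integral>\<zeta>. mixed_monomial \<alpha> \<beta> \<zeta> \<partial>M) = B (tuple_power T \<beta> x) (tuple_power T \<alpha> x))"
proof -
  interpret completely_monotone "{\<lambda>a. Re (moment_form B a x x) | B. invariant_form T B}"
    by (rule completely_monotone_moments)
  obtain N where N: "finite_measure N" "sets N = sets borel" "emeasure N (- cbox 0 One) = 0"
    "\<And>a. set_mset a \<subseteq> Basis \<Longrightarrow> (\<integral>u. (\<Prod>b\<in>#a. u \<bullet> b) \<partial>N) = Re (moment_form B a x x)"
    using hausdorff_moment_problem[of "\<lambda>a. Re (moment_form B a x x)"] B by blast
  have mom: "(\<integral>u. mixed_monomial \<alpha> \<beta> (scaled u) \<partial>N) = B (tuple_power T \<beta> x) (tuple_power T \<alpha> x)" for \<alpha> \<beta>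
    using moment_integral[OF B N(1-4), of "{#}"] by simp
  have sc: "scaled \<in> borel_measurable N"
    unfolding measurable_cong_sets[OF N(2) refl] scaled_def
    by (intro borel_measurable_continuous_onI continuous_intros)
  define M where "M = distr N borel scaled"
  have M1: "finite_measure M" unfolding M_def by (rule finite_measure.finite_measure_distr[OF N(1) sc])
  have M2: "sets M = sets borel" by (simp add: M_def)
  have momM: "(\<integral>\<zeta>. mixed_monomial \<alpha> \<beta> \<zeta> \<partial>M) = B (tuple_power T \<beta> x) (tuple_power T \<alpha> x)" for \<alpha> \<beta>
    unfolding M_def mom[symmetric]
    by (intro integral_distr[OF sc] borel_measurable_continuous_onI continuous_intros)
  have int: "integrable N (\<lambda>u. mixed_monomial \<alpha> \<beta> (scaled u))" for \<alpha> \<beta>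
    unfolding scaled_def by (intro integrable_continuous[OF N(1-3) compact_cbox] continuous_intros)
  define h where "h u = ((norm (scaled u))\<^sup>2 - 1)\<^sup>2" for u :: "complex ^ 'd::{finite,linorder}"
  \<comment> \<open>The square is written out in mixed monomials so that its integral becomes a
    combination of known values of \<open>B\<close>.\<close>
  have h_eq: "complex_of_real (h u) = 1 - 2 * (\<Sum>j\<in>UNIV. mixed_monomial (axis j 1) (axis j 1) (scaled u))
      + (\<Sum>j\<in>UNIV. \<Sum>k\<in>UNIV. mixed_monomial (axis k 1 + axis j 1) (axis k 1 + axis j 1) (scaled u))" for u
  proof -
    have e: "mixed_monomial (axis j 1) (axis j 1) z = z $ j * cnj (z $ j)" for j and z :: "complex ^ 'd::{finite,linorder}"
      using mixed_monomial_axis(1)[of 0 j "axis j 1" z] mixed_monomial_axis(2)[of 0 0 j z]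
      by (simp add: mixed_monomial_zero)
    have "mixed_monomial (axis k 1 + axis j 1) (axis k 1 + axis j 1) z
        = mixed_monomial (axis j 1) (axis j 1) z * mixed_monomial (axis k 1) (axis k 1) z" for j k and z :: "complex ^ 'd::{finite,linorder}"
      by (simp only: mixed_monomial_axis e) (simp add: mult.assoc mult.left_commute)
    then have "(\<Sum>j\<in>UNIV. \<Sum>k\<in>UNIV. mixed_monomial (axis k 1 + axis j 1) (axis k 1 + axis j 1) (scaled u))
      = (\<Sum>j\<in>UNIV. \<Sum>k\<in>UNIV. mixed_monomial (axis j 1) (axis j 1) (scaled u) * mixed_monomial (axis k 1) (axis k 1) (scaled u))"
      by (intro sum.cong refl)
    also have "\<dots> = complex_of_real ((norm (scaled u))\<^sup>2) * complex_of_real ((norm (scaled u))\<^sup>2)"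
      unfolding norm_sq_eq_mixed_monomial by (rule sum_product[symmetric])
    finally have "(\<Sum>j\<in>UNIV. \<Sum>k\<in>UNIV. mixed_monomial (axis k 1 + axis j 1) (axis k 1 + axis j 1) (scaled u))
      = complex_of_real ((norm (scaled u))\<^sup>2) * complex_of_real ((norm (scaled u))\<^sup>2)" .
    moreover have "complex_of_real (h u) = 1 - 2 * complex_of_real ((norm (scaled u))\<^sup>2)
        + complex_of_real ((norm (scaled u))\<^sup>2) * complex_of_real ((norm (scaled u))\<^sup>2)"
      by (simp add: h_def power2_eq_square algebra_simps)
    ultimately show ?thesis by (simp only: norm_sq_eq_mixed_monomial)
  qed
  have ch: "continuous_on UNIV h" unfolding h_def scaled_def by (intro continuous_intros)
  have ih: "integrable N h" by (rule integrable_continuous[OF N(1-3) compact_cbox ch])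
  have inv: "(\<Sum>j\<in>UNIV. B (T j x) (T j y)) = B x y" for x y
    using B by (auto simp: invariant_form_def)
  have tp: "tuple_power T (axis j 1) x = T j x" for j x
    using tuple_power_axis[OF T, of 0 j x] by simp
  have "complex_of_real (\<integral>u. h u \<partial>N) = (\<integral>u. complex_of_real (h u) \<partial>N)" by simp
  \<comment> \<open>The three terms come from the monomials of degree 0, 2 and 4; invariance is used
    not at all, once and twice to reduce them to \<open>B x x\<close>.\<close>
  also have "\<dots> = B x x - 2 * B x x + B x x"
  proof -
    have "(\<integral>u. mixed_monomial 0 0 (scaled u) \<partial>N) = B x x" using mom[of 0 0] by simp
    moreover have "(\<integral>u. 1 - 2 * (\<Sum>j\<in>UNIV. mixed_monomial (axis j 1) (axis j 1) (scaled u))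
      + (\<Sum>j\<in>UNIV. \<Sum>k\<in>UNIV. mixed_monomial (axis k 1 + axis j 1) (axis k 1 + axis j 1) (scaled u)) \<partial>N)
      = (\<integral>u. mixed_monomial 0 0 (scaled u) \<partial>N) - 2 * (\<Sum>j\<in>UNIV. (\<integral>u. mixed_monomial (axis j 1) (axis j 1) (scaled u) \<partial>N))
      + (\<Sum>j\<in>UNIV. \<Sum>k\<in>UNIV. (\<integral>u. mixed_monomial (axis k 1 + axis j 1) (axis k 1 + axis j 1) (scaled u) \<partial>N))"
      using int int[of 0 0] by (simp add: mixed_monomial_zero)
    moreover have "(\<Sum>j\<in>UNIV. \<Sum>k\<in>UNIV. B (T j (T k x)) (T j (T k x))) = B x x"
      by (subst sum.swap) (simp add: inv)
    ultimately show ?thesis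
      by (simp only: h_eq mom tuple_power_axis[OF T] tp inv)
  qed
  finally have "(\<integral>u. h u \<partial>N) = 0" by (simp add: complex_eq_iff)
  moreover have "AE u in N. 0 \<le> h u" by (simp add: h_def)
  ultimately have "AE u in N. h u = 0"
    using integral_nonneg_eq_0_iff_AE[OF ih] by blast
  then have AE: "AE u in N. scaled u \<in> sphere 0 1"
    by (rule eventually_mono) (auto simp: h_def power2_eq_1_iff dist_norm dest: order_trans[OF norm_ge_zero eq_refl])
  have "emeasure M (- sphere 0 1) = emeasure N (scaled -` (- sphere 0 1) \<inter> space N)"
    unfolding M_def by (intro emeasure_distr[OF sc]) auto
  also have "\<dots> = 0"
    using emeasure_eq_0_AE[of "\<lambda>u. scaled u \<notin> sphere 0 1" N] AE
    by (simp add: vimage_def Int_def conj_commute)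
  finally show ?thesis using M1 M2 momM by blast
qed

end

text \<open>Stated for vanishing linear combinations, so that every linear relation between moments
  becomes one between measures. Stone-Weierstrass leads from monomials to continuous functions,
  distance functions lead to closed sets, and the pi-lambda argument to Borel sets.\<close>

lemma moments_determine_measure:
  fixes M :: "'j \<Rightarrow> (complex ^ 'd::finite) measure" and c :: "'j \<Rightarrow> complex"
  assumes J: "finite J" and K: "compact K"
    and M: "\<And>j. j \<in> J \<Longrightarrow> finite_measure (M j)" "\<And>j. j \<in> J \<Longrightarrow> sets (M j) = sets borel"
      "\<And>j. j \<in> J \<Longrightarrow> emeasure (M j) (- K) = 0"
    and zero: "\<And>\<alpha> \<beta>. (\<Sum>j\<in>J. c j * (\<integral>\<zeta>. mixed_monomial \<alpha> \<beta> \<zeta> \<partial>M j)) = 0"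
    and A: "A \<in> sets borel"
  shows "(\<Sum>j\<in>J. c j * complex_of_real (measure (M j) A)) = 0"
proof -
  \<comment> \<open>The condition ranges over all mixed monomials and is thus stable under
    multiplication by a coordinate or its conjugate.\<close>
  define good where "good g \<longleftrightarrow> continuous_on UNIV g \<and>
      (\<forall>\<alpha> \<beta>. (\<Sum>j\<in>J. c j * (\<integral>\<zeta>. g \<zeta> * mixed_monomial \<alpha> \<beta> \<zeta> \<partial>M j)) = 0)" for g
  have int: "integrable (M j) f" if "j \<in> J" "continuous_on UNIV f" for j and f :: "complex ^ 'd \<Rightarrow> 'b::{banach, second_countable_topology}"
    using integrable_continuous[OF M(1-3)[OF that(1)] K that(2)] .
  have add: "good (\<lambda>z. f z + g z)" if "good f" "good g" for f g
  proof -
    have cf: "continuous_on UNIV f" "continuous_on UNIV g" using that by (auto simp: good_def)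
    have "(\<Sum>j\<in>J. c j * (\<integral>\<zeta>. (f \<zeta> + g \<zeta>) * mixed_monomial \<alpha> \<beta> \<zeta> \<partial>M j))
        = (\<Sum>j\<in>J. c j * (\<integral>\<zeta>. f \<zeta> * mixed_monomial \<alpha> \<beta> \<zeta> \<partial>M j)) + (\<Sum>j\<in>J. c j * (\<integral>\<zeta>. g \<zeta> * mixed_monomial \<alpha> \<beta> \<zeta> \<partial>M j))" for \<alpha> \<beta>
      unfolding sum.distrib[symmetric] distrib_right distrib_left[symmetric]
      by (intro sum.cong refl arg_cong2[where f = "(*)"] Bochner_Integration.integral_add int continuous_intros cf)
    then show ?thesis using that by (auto simp: good_def intro!: continuous_intros)
  qed
  have scale: "good (\<lambda>z. a * f z)" if "good f" for a f
  proof -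
    have "(\<Sum>j\<in>J. c j * (\<integral>\<zeta>. (a * f \<zeta>) * mixed_monomial \<alpha> \<beta> \<zeta> \<partial>M j))
        = a * (\<Sum>j\<in>J. c j * (\<integral>\<zeta>. f \<zeta> * mixed_monomial \<alpha> \<beta> \<zeta> \<partial>M j))" for \<alpha> \<beta>
      by (simp add: sum_distrib_left mult.assoc mult.left_commute)
    then show ?thesis using that by (auto simp: good_def intro!: continuous_intros)
  qed
  have coord: "good (\<lambda>z. z $ k * g z)" "good (\<lambda>z. cnj (z $ k) * g z)" if "good g" for g k
  proof -
    have "(\<Sum>j\<in>J. c j * (\<integral>\<zeta>. g \<zeta> * mixed_monomial (\<alpha> + axis k 1) \<beta> \<zeta> \<partial>M j)) = 0"
      "(\<Sum>j\<in>J. c j * (\<integral>\<zeta>. g \<zeta> * mixed_monomial \<alpha> (\<beta> + axis k 1) \<zeta> \<partial>M j)) = 0" for \<alpha> \<beta>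
      using that unfolding good_def by blast+
    then show "good (\<lambda>z. z $ k * g z)" "good (\<lambda>z. cnj (z $ k) * g z)"
      using that unfolding good_def mixed_monomial_axis
      by (auto intro!: continuous_intros simp: mult_ac)
  qed
  have one: "good (\<lambda>z. 1)" using zero by (simp add: good_def)
  have poly: "good (\<lambda>z. complex_of_real (P z) * g z)" if "real_polynomial_function P" "good g" for P g
    using that
  proof (induction P arbitrary: g)
    case (linear f)
    have Basis: "good (\<lambda>z. complex_of_real (z \<bullet> b) * g z)" if b: "b \<in> Basis" for b :: "complex ^ 'd"
    proof -
      obtain k u where ku: "b = axis k u" using b by (auto simp: Basis_complex_vec)
      \<comment> \<open>The real inner product with \<open>axis k u\<close> is the real part of the
        conjugate of u times the k-th coordinate of z.\<close>
      have eq: "complex_of_real (z \<bullet> b) * g z = (cnj u / 2) * (z $ k * g z) + (u / 2) * (cnj (z $ k) * g z)" for z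
        by (simp add: ku inner_axis inner_complex_def complex_eq_iff field_simps)
      show ?thesis
        using add[OF scale[OF coord(1)[OF \<open>good g\<close>], of "cnj u / 2"] scale[OF coord(2)[OF \<open>good g\<close>], of "u / 2"]]
        by (simp only: eq)
    qed
    have f: "f z = (\<Sum>b\<in>Basis. f b * (z \<bullet> b))" for z
    proof -
      interpret bounded_linear f by (rule linear)
      have "f (\<Sum>b\<in>Basis. (z \<bullet> b) *\<^sub>R b) = (\<Sum>b\<in>Basis. f b * (z \<bullet> b))"
        unfolding sum scaleR by (simp only: real_scaleR_def mult.commute)
      then show ?thesis unfolding euclidean_representation .
    qed
    have zero: "good (\<lambda>z. 0)" using scale[OF one, of 0] by simp
    have "good (\<lambda>z. \<Sum>b\<in>S. complex_of_real (f b) * (complex_of_real (z \<bullet> b) * g z))" if "finite S" "S \<subseteq> Basis" for S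
      using that
    proof (induction S rule: finite_induct)
      case (insert b S)
      then show ?case using add[OF scale[OF Basis[of b], of "complex_of_real (f b)"]] by simp
    qed (simp add: zero)
    moreover have "complex_of_real (f z) * g z = (\<Sum>b\<in>Basis. complex_of_real (f b) * (complex_of_real (z \<bullet> b) * g z))" for z
      by (subst f) (simp add: sum_distrib_right mult.assoc)
    ultimately show ?case by simp
  next
    case (const a)
    then show ?case by (rule scale)
  next
    case (add f f')
    then show ?case using \<open>\<And>f g. good f \<Longrightarrow> good g \<Longrightarrow> good (\<lambda>z. f z + g z)\<close>[OF add.IH(1) add.IH(2)] by (simp add: distrib_right)
  next
    case (mult f f')
    then show ?case using mult.IH(1)[OF mult.IH(2)[OF mult.prems]] by (simp add: mult.assoc)
  qed
  have cont: "(\<Sum>j\<in>J. c j * complex_of_real (\<integral>\<zeta>. f \<zeta> \<partial>M j)) = 0" if f: "continuous_on UNIV f" for f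
  proof (rule ccontr)
    assume ne: "\<not> ?thesis"
    define s where "s = (\<Sum>j\<in>J. cmod (c j) * measure (M j) UNIV)"
    have s0: "0 \<le> s" unfolding s_def by (intro sum_nonneg) auto
    define e where "e = cmod (\<Sum>j\<in>J. c j * complex_of_real (\<integral>\<zeta>. f \<zeta> \<partial>M j))"
    have e: "e > 0" using ne by (simp add: e_def)
    obtain p where p: "real_polynomial_function p" "\<And>z. z \<in> K \<Longrightarrow> \<bar>f z - p z\<bar> < e / (s + 1)"
      using Stone_Weierstrass_real_polynomial_function[OF K continuous_on_subset[OF f], of "e / (s + 1)"] e s0 by auto
    have cp: "continuous_on UNIV p" using p(1) by (simp add: continuous_on_polymonial_function real_polynomial_function_eq)
    have "(\<Sum>j\<in>J. c j * (\<integral>\<zeta>. complex_of_real (p \<zeta>) * 1 * mixed_monomial 0 0 \<zeta> \<partial>M j)) = 0"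
      using poly[OF p(1) one] unfolding good_def by blast
    then have p0: "(\<Sum>j\<in>J. c j * complex_of_real (\<integral>\<zeta>. p \<zeta> \<partial>M j)) = 0" by (simp add: mixed_monomial_zero)
    have "e = cmod (\<Sum>j\<in>J. c j * complex_of_real (\<integral>\<zeta>. f \<zeta> - p \<zeta> \<partial>M j))"
    proof -
      have "(\<Sum>j\<in>J. c j * complex_of_real (\<integral>\<zeta>. f \<zeta> - p \<zeta> \<partial>M j)) =
         (\<Sum>j\<in>J. c j * complex_of_real (\<integral>\<zeta>. f \<zeta> \<partial>M j)) - (\<Sum>j\<in>J. c j * complex_of_real (\<integral>\<zeta>. p \<zeta> \<partial>M j))"
        using int[OF _ f] int[OF _ cp]
        by (simp add: right_diff_distrib sum_subtractf[symmetric] cong: sum.cong)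
      then show ?thesis using p0 by (simp add: e_def)
    qed
    also have "\<dots> \<le> (\<Sum>j\<in>J. cmod (c j * complex_of_real (\<integral>\<zeta>. f \<zeta> - p \<zeta> \<partial>M j)))" by (rule norm_sum)
    also have "\<dots> \<le> (\<Sum>j\<in>J. cmod (c j) * (measure (M j) UNIV * (e / (s + 1))))"
    proof (rule sum_mono)
      fix j assume j: "j \<in> J"
      interpret finite_measure "M j" by (rule M(1)[OF j])
      have sp: "space (M j) = UNIV" using sets_eq_imp_space_eq[OF M(2)[OF j]] by simp
      have "\<bar>\<integral>\<zeta>. f \<zeta> - p \<zeta> \<partial>M j\<bar> \<le> (\<integral>\<zeta>. \<bar>f \<zeta> - p \<zeta>\<bar> \<partial>M j)" by (rule integral_abs_bound)
      also have "\<dots> \<le> (\<integral>\<zeta>. e / (s + 1) \<partial>M j)"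
      proof (rule integral_mono_AE)
        show "integrable (M j) (\<lambda>\<zeta>. \<bar>f \<zeta> - p \<zeta>\<bar>)" by (intro int[OF j] continuous_intros f cp)
        show "AE \<zeta> in M j. \<bar>f \<zeta> - p \<zeta>\<bar> \<le> e / (s + 1)"
          using AE_mem_compact[OF M(2,3)[OF j] K] p(2) by (auto elim!: eventually_mono intro: less_imp_le)
      qed simp
      also have "\<dots> = measure (M j) UNIV * (e / (s + 1))" by (simp add: sp)
      finally show "cmod (c j * complex_of_real (\<integral>\<zeta>. f \<zeta> - p \<zeta> \<partial>M j)) \<le> cmod (c j) * (measure (M j) UNIV * (e / (s + 1)))"
        by (simp add: norm_mult mult_left_mono del: times_divide_eq_right)
    qed
    also have "\<dots> = s * (e / (s + 1))"
      unfolding s_def sum_distrib_right mult.assoc ..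
    also have "\<dots> < e" using e s0 by (simp add: field_simps)
    finally show False by simp
  qed
  have closed: "(\<Sum>j\<in>J. c j * complex_of_real (measure (M j) A)) = 0" if A: "closed A" for A
  proof (cases "A = {}")
    case False
    \<comment> \<open>These functions are bounded by 1 and decrease to the indicator of the closed
      set \<open>A\<close>.\<close>
    define f where "f n z = max 0 (1 - real n * infdist z A)" for n z
    have cf: "continuous_on UNIV (f n)" for n unfolding f_def by (intro continuous_intros)
    have lim: "(\<lambda>n. f n z) \<longlonglongrightarrow> indicator A z" for z
    proof (cases "z \<in> A")
      case True
      then show ?thesis by (simp add: f_def)
    next
      case nz: False
      then have d: "infdist z A > 0"
        using in_closed_iff_infdist_zero[OF A False, of z] infdist_nonneg[of z A] by linarith
      obtain N where N: "1 < real N * infdist z A" using reals_Archimedean3[OF d] by blast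
      have "f n z = 0" if "n \<ge> N" for n
      proof -
        have "real N * infdist z A \<le> real n * infdist z A" using that d by (intro mult_right_mono) auto
        then show ?thesis using N by (simp add: f_def)
      qed
      then have "\<forall>\<^sub>F n in sequentially. f n z = indicator A z"
        using nz by (auto simp: eventually_sequentially)
      then show ?thesis by (rule tendsto_eventually)
    qed
    have "(\<lambda>n. complex_of_real (\<integral>\<zeta>. f n \<zeta> \<partial>M j)) \<longlonglongrightarrow> complex_of_real (measure (M j) A)" if j: "j \<in> J" for j
    proof -
      interpret finite_measure "M j" by (rule M(1)[OF j])
      have sp: "space (M j) = UNIV" using sets_eq_imp_space_eq[OF M(2)[OF j]] by simp
      have "(\<lambda>n. \<integral>\<zeta>. f n \<zeta> \<partial>M j) \<longlonglongrightarrow> (\<integral>\<zeta>. indicator A \<zeta> \<partial>M j)"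
      proof (rule integral_dominated_convergence[where w = "\<lambda>_. 1"])
        show "(indicator A :: _ \<Rightarrow> real) \<in> borel_measurable (M j)"
          using A M(2)[OF j] by (intro borel_measurable_indicator) simp
        show "f n \<in> borel_measurable (M j)" for n using int[OF j cf] by auto
        show "AE x in M j. norm (f n x) \<le> 1" for n by (auto simp: f_def infdist_nonneg)
      qed (auto simp: lim)
      then show ?thesis using A M(2)[OF j] by (intro tendsto_of_real) (simp add: sp)
    qed
    then have "(\<lambda>n. \<Sum>j\<in>J. c j * complex_of_real (\<integral>\<zeta>. f n \<zeta> \<partial>M j)) \<longlonglongrightarrow> (\<Sum>j\<in>J. c j * complex_of_real (measure (M j) A))"
      by (rule tendsto_sum[OF tendsto_mult[OF tendsto_const]])
    then show ?thesis unfolding cont[OF cf] using LIMSEQ_unique tendsto_const by blast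
  qed simp
  have gen: "sets borel = sigma_sets UNIV {S :: (complex ^ 'd) set. closed S}"
    unfolding borel_eq_closed by (simp add: sets_measure_of)
  have meas: "X \<in> sets (M j)" if "X \<in> sigma_sets UNIV {S. closed S}" "j \<in> J" for X j
    using that M(2) gen by simp
  have univ: "measure (M j) (UNIV - X) = measure (M j) UNIV - measure (M j) X" if "X \<in> sigma_sets UNIV {S. closed S}" "j \<in> J" for X j
    using finite_measure.finite_measure_compl[OF M(1) meas, of j X] that sets_eq_imp_space_eq[OF M(2)[OF that(2)]] by simp
  have "Int_stable {S :: (complex ^ 'd) set. closed S}" by (auto simp: Int_stable_def)
  moreover have "{S :: (complex ^ 'd) set. closed S} \<subseteq> Pow UNIV" by simp
  moreover have "A \<in> sigma_sets UNIV {S. closed S}" using A by (simp add: gen)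
  ultimately show ?thesis
  proof (induction A rule: sigma_sets_induct_disjoint)
    case (basic A)
    then show ?case using closed by simp
  next
    case empty
    show ?case by simp
  next
    case (compl A)
    then show ?case using closed[of UNIV] by (simp add: univ right_diff_distrib sum_subtractf)
  next
    case (union A)
    have "(\<lambda>n. complex_of_real (measure (M j) (A n))) sums complex_of_real (measure (M j) (\<Union>n. A n))" if "j \<in> J" for j
      using union meas that by (intro sums_of_real finite_measure.finite_measure_UNION[OF M(1)]) auto
    then have "(\<lambda>n. \<Sum>j\<in>J. c j * complex_of_real (measure (M j) (A n))) sums (\<Sum>j\<in>J. c j * complex_of_real (measure (M j) (\<Union>n. A n)))"
      by (intro sums_sum sums_mult)
    then show ?case unfolding union by (simp add: sums_iff)
  qed
qed

section \<open>Semispectral measures from invariant forms\<close>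

lemma regular_finite_measure:
  fixes M :: "'a::{second_countable_topology, complete_space} measure"
  assumes M: "finite_measure M" "sets M = sets borel" and E: "E \<in> sets borel" and e: "0 < e"
  shows "\<exists>K U. compact K \<and> open U \<and> K \<subseteq> E \<and> E \<subseteq> U \<and> measure M (U - K) < e"
proof -
  interpret finite_measure M by (rule M)
  have fin: "emeasure M (space M) \<noteq> \<infinity>" by (simp add: emeasure_eq_measure)
  have "\<exists>K\<in>{K. K \<subseteq> E \<and> compact K}. emeasure M E < emeasure M K + ennreal (e / 2)"
    using e by (intro SUP_approx_ennreal inner_regular[OF M(2) fin E]) (auto simp: emeasure_eq_measure intro: exI[of _ "{}"])
  then obtain K where K: "K \<subseteq> E" "compact K" "measure M E < measure M K + e / 2"
    using e by (auto simp: emeasure_eq_measure ennreal_less_iff simp flip: ennreal_plus)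
  have "\<exists>U\<in>{U. E \<subseteq> U \<and> open U}. emeasure M U < emeasure M E + ennreal (e / 2)"
    using e by (intro INF_approx_ennreal outer_regular[OF M(2) fin E]) (auto simp: emeasure_eq_measure)
  then obtain U where U: "E \<subseteq> U" "open U" "measure M U < measure M E + e / 2"
    using e by (auto simp: emeasure_eq_measure ennreal_less_iff simp flip: ennreal_plus)
  have "measure M (U - K) = measure M U - measure M K"
    using K U compact_imp_closed[OF K(2)] by (intro finite_measure_Diff) (auto simp: M(2))
  then have "compact K \<and> open U \<and> K \<subseteq> E \<and> E \<subseteq> U \<and> measure M (U - K) < e" using K U by auto
  then show ?thesis by blast
qed

text \<open>Four measures enter a polarized set function at once; union of the compact sets and
  intersection of the open ones serve all of them together.\<close>

lemma regular_finite_measures: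
  fixes M :: "nat \<Rightarrow> 'a::{second_countable_topology, complete_space} measure"
  assumes M: "\<And>k. finite_measure (M k)" "\<And>k. sets (M k) = sets borel" and E: "E \<in> sets borel" and e: "0 < e"
  shows "\<exists>K U. compact K \<and> open U \<and> K \<subseteq> E \<and> E \<subseteq> U \<and> (\<forall>k<n. measure (M k) (U - K) < e)"
proof (induction n)
  case 0
  show ?case by (intro exI[of _ "{}"] exI[of _ UNIV]) auto
next
  case (Suc n)
  then obtain K U where KU: "compact K" "open U" "K \<subseteq> E" "E \<subseteq> U" "\<And>k. k < n \<Longrightarrow> measure (M k) (U - K) < e" by blast
  obtain K' U' where KU': "compact K'" "open U'" "K' \<subseteq> E" "E \<subseteq> U'" "measure (M n) (U' - K') < e"
    using regular_finite_measure[OF M(1)[of n] M(2)[of n] E e] by blast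
  have m: "measure (M k) ((U \<inter> U') - (K \<union> K')) \<le> measure (M k) (U - K)"
    "measure (M k) ((U \<inter> U') - (K \<union> K')) \<le> measure (M k) (U' - K')" for k
    using KU(1,2) KU'(1,2) by (auto intro!: finite_measure.finite_measure_mono[OF M(1)] simp: M(2) compact_imp_closed)
  have "measure (M k) ((U \<inter> U') - (K \<union> K')) < e" if "k < Suc n" for k
    using that m[of k] KU(5)[of k] KU'(5) by (cases "k = n") auto
  moreover have "compact (K \<union> K')" "open (U \<inter> U')" "K \<union> K' \<subseteq> E" "E \<subseteq> U \<inter> U'"
    using KU KU' by (auto intro: open_Int compact_Un)
  ultimately show ?case by blast
qed

text \<open>The factor 1/2 sits inside the vectors, so the only coefficients left are the powers of
  i. This matches the decomposition into four positive measures in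
  \<open>has_complex_measure_integral\<close>.\<close>

lemma polarization:
  assumes b: "sesquilinear b"
  shows "(\<Sum>k<4. \<i> ^ k * b ((1/2) *\<^sub>C (x + \<i> ^ k *\<^sub>C y)) ((1/2) *\<^sub>C (x + \<i> ^ k *\<^sub>C y))) = b x y"
proof -
  have sum4: "(\<Sum>k<4. g k) = g 0 + g 1 + g 2 + g 3" for g :: "nat \<Rightarrow> complex"
    by (simp add: eval_nat_numeral)
  have b4: "b ((1/2) *\<^sub>C (x + c *\<^sub>C y)) ((1/2) *\<^sub>C (x + c *\<^sub>C y))
      = (b x x + cnj c * b x y + c * b y x + c * cnj c * b y y) / 4" for c
    by (simp add: sesquilinear_simps[OF b] field_simps)
  show ?thesis
    unfolding sum4 b4 by (simp add: power3_eq_cube field_simps)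
qed

locale measure_representation = commuting T for T :: "'d::{finite,linorder} \<Rightarrow> 'h::complex_inner \<Rightarrow> 'h" +
  fixes B :: "'h \<Rightarrow> 'h \<Rightarrow> complex" and \<mu> :: "'h \<Rightarrow> (complex ^ 'd::{finite,linorder}) measure"
  assumes sesquilinear_B: "sesquilinear B"
    and finite_measure: "finite_measure (\<mu> x)" and sets: "sets (\<mu> x) = sets borel"
    and null: "emeasure (\<mu> x) (- sphere 0 1) = 0"
    and moments: "(\<integral>\<zeta>. mixed_monomial \<alpha> \<beta> \<zeta> \<partial>\<mu> x) = B (tuple_power T \<beta> x) (tuple_power T \<alpha> x)"
begin

section \<open>Polarized set functions\<close>

definition polar :: "nat \<Rightarrow> 'h \<Rightarrow> 'h \<Rightarrow> 'h" where
  "polar k x y = (1/2) *\<^sub>C (x + \<i> ^ k *\<^sub>C y)"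

definition set_form :: "(complex ^ 'd::{finite,linorder}) set \<Rightarrow> 'h \<Rightarrow> 'h \<Rightarrow> complex" where
  "set_form A x y = (\<Sum>k<4. \<i> ^ k * complex_of_real (measure (\<mu> (polar k x y)) A))"

lemma sesquilinear_power: "sesquilinear (\<lambda>x y. B (tuple_power T \<beta> x) (tuple_power T \<alpha> y))"
  by (intro sesquilinearI)
    (simp_all add: bounded_clinearD(1,2)[OF bounded_clinear_tuple_power[OF T]] sesquilinear_simps[OF sesquilinear_B])

text \<open>Linear relations between the values of \<open>B\<close> pass to the set functions: by
  polarization they are relations between the moments of the measures indexed by pairs (j, k), and
  moments determine measures.\<close>

lemma set_form_eq_zero:
  assumes J: "finite J" and A: "A \<in> sets borel"
    and zero: "\<And>\<alpha> \<beta>. (\<Sum>j\<in>J. d j * B (tuple_power T \<beta> (x j)) (tuple_power T \<alpha> (y j))) = 0"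
  shows "(\<Sum>j\<in>J. d j * set_form A (x j) (y j)) = 0"
proof -
  have "(\<Sum>p\<in>J \<times> {..<4}. (d (fst p) * \<i> ^ snd p) * complex_of_real (measure (\<mu> (polar (snd p) (x (fst p)) (y (fst p)))) A)) = 0"
  proof (rule moments_determine_measure[OF _ compact_sphere finite_measure sets null _ A])
    fix \<alpha> \<beta>
    have "(\<Sum>p\<in>J \<times> {..<4}. d (fst p) * \<i> ^ snd p * (\<integral>\<zeta>. mixed_monomial \<alpha> \<beta> \<zeta> \<partial>\<mu> (polar (snd p) (x (fst p)) (y (fst p)))))
      = (\<Sum>j\<in>J. d j * (\<Sum>k<4. \<i> ^ k * B (tuple_power T \<beta> (polar k (x j) (y j))) (tuple_power T \<alpha> (polar k (x j) (y j)))))"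
      unfolding moments sum_distrib_left sum.cartesian_product by (intro sum.cong) (auto simp: mult.assoc)
    also have "\<dots> = (\<Sum>j\<in>J. d j * B (tuple_power T \<beta> (x j)) (tuple_power T \<alpha> (y j)))"
      unfolding polar_def polarization[OF sesquilinear_power] ..
    finally show "(\<Sum>p\<in>J \<times> {..<4}. d (fst p) * \<i> ^ snd p * (\<integral>\<zeta>. mixed_monomial \<alpha> \<beta> \<zeta> \<partial>\<mu> (polar (snd p) (x (fst p)) (y (fst p))))) = 0"
      using zero by simp
  qed (use J in auto)
  moreover have "(\<Sum>j\<in>J. d j * set_form A (x j) (y j)) =
     (\<Sum>p\<in>J \<times> {..<4}. (d (fst p) * \<i> ^ snd p) * complex_of_real (measure (\<mu> (polar (snd p) (x (fst p)) (y (fst p)))) A))"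
    unfolding set_form_def sum_distrib_left sum.cartesian_product by (intro sum.cong) (auto simp: mult.assoc)
  ultimately show ?thesis by simp
qed

text \<open>The list format allows a concrete identity, such as additivity in one argument, to be
  given as its coefficients and vectors.\<close>

lemma set_form_eq_zero_list:
  assumes A: "A \<in> sets borel"
    and zero: "\<And>\<alpha> \<beta>. (\<Sum>(d, x, y)\<leftarrow>l. d * B (tuple_power T \<beta> x) (tuple_power T \<alpha> y)) = 0"
  shows "(\<Sum>(d, x, y)\<leftarrow>l. d * set_form A x y) = 0"
proof -
  have eq: "(\<Sum>(d, x, y)\<leftarrow>l. d * g x y) = (\<Sum>j<length l. fst (l ! j) * g (fst (snd (l ! j))) (snd (snd (l ! j))))" for g :: "'h \<Rightarrow> 'h \<Rightarrow> complex"
    by (subst sum_list_sum_nth) (auto simp: case_prod_unfold lessThan_atLeast0)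
  show ?thesis
    using zero unfolding eq by (intro set_form_eq_zero A) auto
qed

lemma sesquilinear_set_form:
  assumes A: "A \<in> sets borel"
  shows "sesquilinear (set_form A)"
proof (rule sesquilinearI)
  note lin = sesquilinear_simps[OF sesquilinear_power]
  fix x x' y y' c
  show "set_form A (x + x') y = set_form A x y + set_form A x' y"
    using set_form_eq_zero_list[OF A, of "[(1, x + x', y), (-1, x, y), (-1, x', y)]"] by (simp add: lin algebra_simps)
  show "set_form A (c *\<^sub>C x) y = c * set_form A x y"
    using set_form_eq_zero_list[OF A, of "[(1, c *\<^sub>C x, y), (-c, x, y)]"] by (simp add: lin)
  show "set_form A x (y + y') = set_form A x y + set_form A x y'"
    using set_form_eq_zero_list[OF A, of "[(1, x, y + y'), (-1, x, y), (-1, x, y')]"] by (simp add: lin algebra_simps)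
  show "set_form A x (c *\<^sub>C y) = cnj c * set_form A x y"
    using set_form_eq_zero_list[OF A, of "[(1, x, c *\<^sub>C y), (-cnj c, x, y)]"] by (simp add: lin)
qed

text \<open>Uniqueness gives the measure of \<open>c x\<close> as |c|^2 times that of
  \<open>x\<close>. On the diagonal the polar vectors are (1 + i^k)/2 times \<open>x\<close>, and
  the four contributions 1, i/2, 0, -i/2 add up to 1.\<close>

lemma set_form_self:
  assumes A: "A \<in> sets borel"
  shows "set_form A x x = complex_of_real (measure (\<mu> x) A)"
proof -
  have scale: "complex_of_real (measure (\<mu> (c *\<^sub>C x)) A) = c * cnj c * complex_of_real (measure (\<mu> x) A)" for c
  proof -
    have "(\<Sum>j\<in>{False, True}. (if j then - (c * cnj c) else 1) * complex_of_real (measure (\<mu> (if j then x else c *\<^sub>C x)) A)) = 0"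
      by (rule moments_determine_measure[OF _ compact_sphere finite_measure sets null _ A])
        (auto simp: moments sesquilinear_simps[OF sesquilinear_power])
    then show ?thesis by simp
  qed
  have "polar k x x = ((1 + \<i> ^ k) / 2) *\<^sub>C x" for k
    by (simp add: polar_def scaleC_add_left scaleC_add_right scaleC_scaleC add_divide_distrib)
  then show ?thesis
    unfolding set_form_def by (simp only: scale) (simp add: eval_nat_numeral field_simps)
qed

text \<open>The total mass at v is B(v, v), and every polar vector has norm at most (|x| + |y|)/2,
  so each of the four terms is at most a quarter of the bound.\<close>

lemma set_form_bound:
  assumes A: "A \<in> sets borel" and K: "\<And>x y. cmod (B x y) \<le> K * (norm x * norm y)"
  shows "cmod (set_form A x y) \<le> K * (norm x + norm y)\<^sup>2"
proof -
  \<comment> \<open>The bound on \<open>B\<close> forces \<open>K\<close> to be nonnegative only if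
    there is a nonzero vector.\<close>
  have K0: "0 \<le> K" if "v \<noteq> (0::'h)" for v
    using order_trans[OF norm_ge_zero K[of v v]] that by (auto simp: zero_le_mult_iff mult_le_0_iff)
  have meas: "measure (\<mu> v) A \<le> K * (norm v)\<^sup>2" for v
  proof -
    interpret finite_measure "\<mu> v" by (rule finite_measure)
    have sp: "space (\<mu> v) = UNIV" using sets_eq_imp_space_eq[OF sets] by simp
    have "complex_of_real (measure (\<mu> v) UNIV) = B v v"
      using moments[where x = v and \<alpha> = 0 and \<beta> = 0] by (simp add: mixed_monomial_zero sp scaleR_conv_of_real)
    then have "measure (\<mu> v) UNIV = cmod (B v v)" by (metis abs_of_nonneg measure_nonneg norm_of_real)
    moreover have "measure (\<mu> v) A \<le> measure (\<mu> v) UNIV"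
      using A by (intro finite_measure_mono) (auto simp: sets)
    ultimately show ?thesis using K[of v v] by (simp add: power2_eq_square)
  qed
  have pn: "norm (polar k x y) \<le> (norm x + norm y) / 2" for k
    using norm_triangle_ineq[of x "\<i> ^ k *\<^sub>C y"] by (simp add: polar_def norm_scaleC norm_power)
  have "cmod (set_form A x y) \<le> (\<Sum>k<4. cmod (\<i> ^ k * complex_of_real (measure (\<mu> (polar k x y)) A)))"
    unfolding set_form_def by (rule norm_sum)
  also have "\<dots> \<le> (\<Sum>k<(4::nat). K * (norm x + norm y)\<^sup>2 / 4)"
  proof (rule sum_mono)
    fix k :: nat
    have "measure (\<mu> (polar k x y)) A \<le> K * (norm (polar k x y))\<^sup>2" by (rule meas)
    also have "\<dots> \<le> K * ((norm x + norm y) / 2)\<^sup>2"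
    proof (cases "polar k x y = 0")
      case True
      then show ?thesis
        using K0[of x] K0[of y] by (cases "x = 0"; cases "y = 0") auto
    next
      case False
      then show ?thesis using K0[OF False] pn by (intro mult_left_mono power_mono) auto
    qed
    finally show "cmod (\<i> ^ k * complex_of_real (measure (\<mu> (polar k x y)) A)) \<le> K * (norm x + norm y)\<^sup>2 / 4"
      by (simp add: norm_mult norm_power power_divide)
  qed
  finally show ?thesis by simp
qed

lemma regular_set_form: "regular_complex_measure (sphere 0 1) (\<lambda>A. set_form A x y)"
  unfolding regular_complex_measure_def
proof (intro conjI allI impI ballI)
  let ?S = "sphere 0 1 :: (complex ^ 'd::{finite,linorder}) set"
  have borel: "A \<in> sets borel" "A \<subseteq> ?S" if "A \<in> sets (borel_on ?S)" for A
    using that by (auto simp: sets_restrict_space_iff)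
  fix A :: "nat \<Rightarrow> (complex ^ 'd::{finite,linorder}) set"
  assume A: "range A \<subseteq> sets (borel_on ?S) \<and> disjoint_family A"
  then have "range A \<subseteq> sets borel" using borel by blast
  then have "(\<lambda>n. complex_of_real (measure (\<mu> v) (A n))) sums complex_of_real (measure (\<mu> v) (\<Union>n. A n))" for v
    using A by (intro sums_of_real finite_measure.finite_measure_UNION[OF finite_measure]) (auto simp: sets)
  then show "(\<lambda>n. set_form (A n) x y) sums set_form (\<Union>n. A n) x y"
    unfolding set_form_def by (intro sums_sum sums_mult)
next
  let ?S = "sphere 0 1 :: (complex ^ 'd::{finite,linorder}) set"
  fix E and e :: real assume E: "E \<in> sets (borel_on ?S)" and e: "0 < e"
  have borel: "A \<in> sets borel" "A \<subseteq> ?S" if "A \<in> sets (borel_on ?S)" for A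
    using that by (auto simp: sets_restrict_space_iff)
  obtain K U where KU: "compact K" "open U" "K \<subseteq> E" "E \<subseteq> U"
    "\<And>k. k < 4 \<Longrightarrow> measure (\<mu> (polar k x y)) (U - K) < e / 4"
    using regular_finite_measures[of "\<lambda>k. \<mu> (polar k x y)" E "e / 4" 4] finite_measure sets borel(1)[OF E] e by auto
  show "\<exists>K U. compact K \<and> openin (top_of_set ?S) U \<and> K \<subseteq> E \<and> E \<subseteq> U \<and>
      (\<forall>A\<in>sets (borel_on ?S). A \<subseteq> U - K \<longrightarrow> cmod (set_form A x y) < e)"
  proof (rule exI[of _ K], rule exI[of _ "?S \<inter> U"], intro conjI ballI impI)
    fix A assume A: "A \<in> sets (borel_on ?S)" "A \<subseteq> (?S \<inter> U) - K"
    have "cmod (set_form A x y) \<le> (\<Sum>k<4. cmod (\<i> ^ k * complex_of_real (measure (\<mu> (polar k x y)) A)))"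
      unfolding set_form_def by (rule norm_sum)
    also have "\<dots> < (\<Sum>k<(4::nat). e / 4)"
    proof (rule sum_strict_mono)
      fix k :: nat assume "k \<in> {..<4}"
      have "measure (\<mu> (polar k x y)) A \<le> measure (\<mu> (polar k x y)) (U - K)"
        using A KU(1,2) by (intro finite_measure.finite_measure_mono[OF finite_measure]) (auto simp: sets compact_imp_closed)
      with KU(5)[of k] \<open>k \<in> {..<4}\<close> show "cmod (\<i> ^ k * complex_of_real (measure (\<mu> (polar k x y)) A)) < e / 4"
        by (simp add: norm_mult norm_power)
    qed (auto simp: lessThan_empty_iff)
    finally show "cmod (set_form A x y) < e" by simp
  qed (use KU borel(2)[OF E] in \<open>auto simp: openin_open\<close>)
qed

text \<open>The restrictions of the polar measures to the sphere are the four positive measures of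
  the integral; restricting changes no integral, as the complement is null.\<close>

lemma integral_set_form:
  "has_complex_measure_integral (sphere 0 1) (\<lambda>A. set_form A x y) (mixed_monomial \<alpha> \<beta>)
    (B (tuple_power T \<beta> x) (tuple_power T \<alpha> y))"
proof -
  let ?S = "sphere 0 1 :: (complex ^ 'd::{finite,linorder}) set"
  define \<nu> where "\<nu> k = restrict_space (\<mu> (polar k x y)) ?S" for k
  have S: "?S \<inter> space (\<mu> v) \<in> sets (\<mu> v)" for v
    using sets_eq_imp_space_eq[OF sets[of v]] by (simp add: sets)
  have int: "integrable (\<mu> v) (\<lambda>z. indicator ?S z *\<^sub>R mixed_monomial \<alpha> \<beta> z)" for v
    using S[of v] sets_eq_imp_space_eq[OF sets[of v]]
    by (intro integrable_mult_indicator integrable_continuous[OF finite_measure sets null compact_sphere] continuous_intros) auto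
  have eq: "(\<integral>z. indicator ?S z *\<^sub>R mixed_monomial \<alpha> \<beta> z \<partial>\<mu> v) = (\<integral>z. mixed_monomial \<alpha> \<beta> z \<partial>\<mu> v)" for v
  proof (rule integral_cong_AE)
    show "(\<lambda>z. indicator ?S z *\<^sub>R mixed_monomial \<alpha> \<beta> z) \<in> borel_measurable (\<mu> v)" using int by auto
    show "mixed_monomial \<alpha> \<beta> \<in> borel_measurable (\<mu> v)"
      by (intro borel_measurable_integrable integrable_continuous[OF finite_measure sets null compact_sphere]
          continuous_mixed_monomial continuous_on_id)
    show "AE z in \<mu> v. indicator ?S z *\<^sub>R mixed_monomial \<alpha> \<beta> z = mixed_monomial \<alpha> \<beta> z"
      using AE_mem_compact[OF sets null compact_sphere] by (rule eventually_mono) simp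
  qed
  show ?thesis
    unfolding has_complex_measure_integral_def
  proof (intro exI[of _ \<nu>] conjI allI impI ballI)
    fix k :: nat assume "k < 4"
    show "finite_measure (\<nu> k)"
      unfolding \<nu>_def by (intro finite_measure_restrict_space finite_measure) (simp add: sets)
    show "sets (\<nu> k) = sets (borel_on ?S)"
      unfolding \<nu>_def by (intro sets_restrict_space_cong sets)
    show "integrable (\<nu> k) (mixed_monomial \<alpha> \<beta>)"
      unfolding \<nu>_def using int by (simp add: integrable_restrict_space[OF S])
  next
    fix A assume "A \<in> sets (borel_on ?S)"
    then have "A \<subseteq> ?S" by (auto simp: sets_restrict_space_iff)
    then show "set_form A x y = (\<Sum>k<4. \<i> ^ k * complex_of_real (measure (\<nu> k) A))"
      unfolding set_form_def \<nu>_def by (simp add: measure_restrict_space[OF S])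
  next
    have "(\<Sum>k<4. \<i> ^ k * (\<integral>z. mixed_monomial \<alpha> \<beta> z \<partial>\<nu> k)) =
      (\<Sum>k<4. \<i> ^ k * B (tuple_power T \<beta> (polar k x y)) (tuple_power T \<alpha> (polar k x y)))"
      unfolding \<nu>_def integral_restrict_space[OF S] eq moments ..
    then show "B (tuple_power T \<beta> x) (tuple_power T \<alpha> y) = (\<Sum>k<4. \<i> ^ k * (\<integral>z. mixed_monomial \<alpha> \<beta> z \<partial>\<nu> k))"
      unfolding polar_def polarization[OF sesquilinear_power] by simp
  qed
qed

text \<open>\<open>F A\<close> is the operator of the bounded form \<open>set_form A\<close> pulled
  back along \<open>V\<close>, so positivity, additivity and regularity are inherited from the
  scalar set functions.\<close>

theorem semispectral_measure_exists:
  fixes V :: "'m::chilbert_space \<Rightarrow> 'h"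
  assumes K: "\<And>x y. cmod (B x y) \<le> K * (norm x * norm y)" and V: "bounded_clinear V"
  shows "\<exists>F :: (complex ^ 'd::{finite,linorder}) set \<Rightarrow> 'm \<Rightarrow> 'm. semispectral_measure (sphere 0 1) F \<and>
    (\<forall>\<alpha> \<beta> R. (\<forall>x y. cinner (R x) y = B (tuple_power T \<beta> (V x)) (tuple_power T \<alpha> (V y))) \<longrightarrow>
      has_weak_integral (sphere 0 1) F (mixed_monomial \<alpha> \<beta>) R)"
proof -
  let ?S = "sphere 0 1 :: (complex ^ 'd::{finite,linorder}) set"
  have borel: "A \<in> sets borel" if "A \<in> sets (borel_on ?S)" for A
    using that by (auto simp: sets_restrict_space_iff)
  have "\<forall>A. \<exists>M. A \<in> sets borel \<longrightarrow> bounded_clinear M \<and> (\<forall>x y. set_form A (V x) (V y) = cinner (M x) y)"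
    using bounded_sesquilinear_operator[OF bounded_sesquilinear_compose[OF
      bounded_sesquilinearI[OF sesquilinear_set_form set_form_bound[OF _ K]] V V]] by blast
  then obtain F where F: "\<And>A. A \<in> sets borel \<Longrightarrow> bounded_clinear (F A)"
    "\<And>A x y. A \<in> sets borel \<Longrightarrow> set_form A (V x) (V y) = cinner (F A x) y"
    by metis
  \<comment> \<open>The operators \<open>F A\<close> are tied to \<open>set_form A\<close> on Borel
    sets only, so regularity has to be transferred between set functions that agree there.\<close>
  have cong1: "regular_complex_measure ?S g" if "regular_complex_measure ?S f" "\<And>A. A \<in> sets (borel_on ?S) \<Longrightarrow> f A = g A" for f g
  proof -
    have "(\<lambda>n. g (A n)) sums g (\<Union>n. A n)" if A: "range A \<subseteq> sets (borel_on ?S)" "disjoint_family A" for A :: "nat \<Rightarrow> _"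
    proof -
      have "(\<Union>n. A n) \<in> sets (borel_on ?S)" using A by (intro sets.countable_UN) auto
      moreover have "A n \<in> sets (borel_on ?S)" for n using A by auto
      ultimately show ?thesis using \<open>regular_complex_measure ?S f\<close> A that
        unfolding regular_complex_measure_def by (simp add: \<open>\<And>A. A \<in> sets (borel_on ?S) \<Longrightarrow> f A = g A\<close>[symmetric])
    qed
    moreover have "\<exists>K U. compact K \<and> openin (top_of_set ?S) U \<and> K \<subseteq> E \<and> E \<subseteq> U \<and>
      (\<forall>A\<in>sets (borel_on ?S). A \<subseteq> U - K \<longrightarrow> cmod (g A) < e)" if "E \<in> sets (borel_on ?S)" "e > 0" for E e
      using \<open>regular_complex_measure ?S f\<close> that \<open>\<And>A. A \<in> sets (borel_on ?S) \<Longrightarrow> f A = g A\<close>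
      unfolding regular_complex_measure_def by simp
    ultimately show ?thesis unfolding regular_complex_measure_def by blast
  qed
  have "semispectral_measure ?S F"
    unfolding semispectral_measure_def
  proof (intro conjI ballI impI allI)
    fix A assume A: "A \<in> sets (borel_on ?S)"
    show "positive_operator (F A)"
      unfolding positive_operator_def
      using F(1)[OF borel[OF A]] F(2)[OF borel[OF A], symmetric] by (simp add: set_form_self[OF borel[OF A]])
    fix A' x assume A': "A' \<in> sets (borel_on ?S)" and disj: "A \<inter> A' = {}"
    have "set_form (A \<union> A') u v = set_form A u v + set_form A' u v" for u v
      unfolding set_form_def using borel[OF A] borel[OF A'] disj
      by (simp add: finite_measure.finite_measure_Union[OF finite_measure] sets distrib_left sum.distrib)
    then show "F (A \<union> A') x = F A x + F A' x"
      using borel[OF A] borel[OF A'] by (intro cinner_ext) (simp add: F(2)[symmetric] cinner_add_left)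
  next
    fix x y
    show "regular_complex_measure ?S (\<lambda>A. cinner (F A x) y)"
      by (rule cong1[OF regular_set_form]) (rule F(2)[OF borel])
  qed
  moreover have "has_weak_integral ?S F (mixed_monomial \<alpha> \<beta>) R"
    if R: "\<And>x y. cinner (R x) y = B (tuple_power T \<beta> (V x)) (tuple_power T \<alpha> (V y))" for \<alpha> \<beta> R
    unfolding has_weak_integral_def
  proof (intro allI)
    fix x y
    from integral_set_form[of "V x" "V y" \<alpha> \<beta>] F(2)[OF borel, of _ x y]
    show "has_complex_measure_integral ?S (\<lambda>A. cinner (F A x) y) (mixed_monomial \<alpha> \<beta>) (cinner (R x) y)"
      unfolding has_complex_measure_integral_def R by simp
  qed
  ultimately show ?thesis by blast
qed

end

section \<open>Binomial differences of matrix arrays\<close>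

lemma index_fact_axis: "index_fact (\<gamma> + axis j 1) = Suc (\<gamma> $ j) * index_fact \<gamma>"
proof -
  have "index_fact (\<gamma> + axis j 1) = (\<Prod>k\<in>UNIV. (if k = j then Suc (\<gamma> $ j) else 1) * fact (\<gamma> $ k))"
    unfolding index_fact_def by (rule prod.cong) (auto simp: axis_def)
  then show ?thesis by (simp add: prod.distrib index_fact_def)
qed

lemma index_abs_axis: "index_abs (\<gamma> + axis j 1) = Suc (index_abs \<gamma>)"
  by (simp add: index_abs_def sum.distrib axis_def)

text \<open>Pascal's rule for multinomial coefficients: one factor k + 1 of (k + 1)! is the sum of
  the entries of \<gamma>, and the part belonging to \<gamma>_j cancels against \<gamma>! and lowers
  that entry by one.\<close>

lemma multinomial_sum_Suc:
  fixes g :: "nat ^ 'd::finite \<Rightarrow> complex"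
  shows "(\<Sum>\<gamma> | index_abs \<gamma> = Suc k. of_nat (fact (index_abs \<gamma>)) / of_nat (index_fact \<gamma>) * g \<gamma>)
    = (\<Sum>j\<in>UNIV. \<Sum>\<gamma> | index_abs \<gamma> = k. of_nat (fact (index_abs \<gamma>)) / of_nat (index_fact \<gamma>) * g (\<gamma> + axis j 1))"
proof -
  let ?h = "\<lambda>j \<gamma>. of_nat (fact k) * of_nat (\<gamma> $ j) / of_nat (index_fact \<gamma>) * g \<gamma>"
  have "(\<Sum>\<gamma> | index_abs \<gamma> = k. of_nat (fact (index_abs \<gamma>)) / of_nat (index_fact \<gamma>) * g (\<gamma> + axis j 1))
      = (\<Sum>\<gamma> | index_abs \<gamma> = Suc k. ?h j \<gamma>)" for j
  proof -
    have inv: "\<gamma> - axis j 1 + axis j 1 = \<gamma>" if "\<gamma> $ j > 0" for \<gamma> :: "nat ^ 'd"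
      using that by (auto simp: vec_eq_iff axis_def)
    have inv': "\<gamma> + axis j 1 - axis j 1 = \<gamma>" for \<gamma> :: "nat ^ 'd"
      by (auto simp: vec_eq_iff axis_def)
    \<comment> \<open>Terms with vanishing j-th entry are zero; on the others, subtracting the unit
      index is a bijection.\<close>
    have "(\<Sum>\<gamma> | index_abs \<gamma> = Suc k. ?h j \<gamma>) = (\<Sum>\<gamma> | index_abs \<gamma> = Suc k \<and> \<gamma> $ j > 0. ?h j \<gamma>)"
      by (rule sum.mono_neutral_right) (auto simp: finite_index_abs_eq)
    also have "\<dots> = (\<Sum>\<gamma> | index_abs \<gamma> = k. of_nat (fact (index_abs \<gamma>)) / of_nat (index_fact \<gamma>) * g (\<gamma> + axis j 1))"
    proof (rule sum.reindex_bij_witness[of _ "\<lambda>\<gamma>. \<gamma> + axis j 1" "\<lambda>\<gamma>. \<gamma> - axis j 1"])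
      fix \<gamma> :: "nat ^ 'd" assume "\<gamma> \<in> {\<gamma>. index_abs \<gamma> = Suc k \<and> \<gamma> $ j > 0}"
      then have \<gamma>: "index_abs \<gamma> = Suc k" "\<gamma> $ j > 0" by auto
      show 1: "\<gamma> - axis j 1 + axis j 1 = \<gamma>" by (rule inv[OF \<gamma>(2)])
      show 2: "\<gamma> - axis j 1 \<in> {\<gamma>. index_abs \<gamma> = k}"
        using index_abs_axis[of "\<gamma> - axis j 1" j] 1 \<gamma>(1) by simp
      have "index_fact \<gamma> = \<gamma> $ j * index_fact (\<gamma> - axis j 1)"
        using index_fact_axis[of "\<gamma> - axis j 1" j] \<gamma>(2) unfolding 1 by (simp add: axis_def)
      then show "of_nat (fact (index_abs (\<gamma> - axis j 1))) / of_nat (index_fact (\<gamma> - axis j 1)) * g (\<gamma> - axis j 1 + axis j 1) = ?h j \<gamma>"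
        using 1 2 \<gamma>(2) by simp
    next
      fix \<gamma> :: "nat ^ 'd" assume "\<gamma> \<in> {\<gamma>. index_abs \<gamma> = k}"
      then show "\<gamma> + axis j 1 - axis j 1 = \<gamma>" "\<gamma> + axis j 1 \<in> {\<gamma>. index_abs \<gamma> = Suc k \<and> \<gamma> $ j > 0}"
        using inv' index_abs_axis[of \<gamma> j] by (auto simp: axis_def)
    qed
    finally show ?thesis ..
  qed
  then have "(\<Sum>j\<in>UNIV. \<Sum>\<gamma> | index_abs \<gamma> = k. of_nat (fact (index_abs \<gamma>)) / of_nat (index_fact \<gamma>) * g (\<gamma> + axis j 1))
      = (\<Sum>\<gamma> | index_abs \<gamma> = Suc k. \<Sum>j\<in>UNIV. ?h j \<gamma>)"
    by (simp only: sum.swap[of _ _ UNIV])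
  also have "\<dots> = (\<Sum>\<gamma> | index_abs \<gamma> = Suc k. of_nat (fact (index_abs \<gamma>)) / of_nat (index_fact \<gamma>) * g \<gamma>)"
  proof (rule sum.cong[OF refl])
    fix \<gamma> :: "nat ^ 'd" assume "\<gamma> \<in> {\<gamma>. index_abs \<gamma> = Suc k}"
    then have "index_abs \<gamma> = Suc k" by simp
    then have "(\<Sum>j\<in>UNIV. of_nat (\<gamma> $ j)) = (of_nat (Suc k) :: complex)"
      unfolding index_abs_def by (metis of_nat_sum)
    then have "(\<Sum>j\<in>UNIV. ?h j \<gamma>) = of_nat (fact k) * of_nat (Suc k) / of_nat (index_fact \<gamma>) * g \<gamma>"
      by (simp only: sum_distrib_right[symmetric] sum_divide_distrib[symmetric] sum_distrib_left[symmetric])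
    then show "(\<Sum>j\<in>UNIV. ?h j \<gamma>) = of_nat (fact (index_abs \<gamma>)) / of_nat (index_fact \<gamma>) * g \<gamma>"
      using \<open>index_abs \<gamma> = Suc k\<close> by (simp add: algebra_simps)
  qed
  finally show ?thesis ..
qed

lemma shift_sum_zero: "shift_sum 0 A \<alpha> \<beta> i l = A \<alpha> \<beta> i l"
proof -
  have "{\<gamma> :: nat ^ 'a. index_abs \<gamma> = 0} = {0}" by (auto simp: index_abs_def vec_eq_iff)
  then show ?thesis by (simp add: shift_sum_def backward_shift_power_def index_fact_def index_abs_def)
qed

text \<open>Hence \<open>shift_sum k\<close> is the k-th power of the sum of the backward shifts,
  used from here on instead of the multinomial formula.\<close>

lemma shift_sum_Suc:
  "shift_sum (Suc k) A \<alpha> \<beta> i l = (\<Sum>j\<in>UNIV. shift_sum k A (\<alpha> + axis j 1) (\<beta> + axis j 1) i l)"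
  unfolding shift_sum_def backward_shift_power_def multinomial_sum_Suc by (simp add: add_ac)

section \<open>Forward differences and Newton expansion\<close>

definition binomial_difference :: "(nat \<Rightarrow> complex) \<Rightarrow> nat \<Rightarrow> complex" where
  "binomial_difference s n = (\<Sum>j\<le>n. (- 1) ^ (j + n) * of_nat (n choose j) * s j)"

lemma binomial_difference_Suc:
  "binomial_difference s (Suc n) = binomial_difference (\<lambda>k. s (Suc k)) n - binomial_difference s n"
proof -
  have "binomial_difference s (Suc n) =
      (- 1) ^ Suc n * s 0 + (\<Sum>j\<le>n. (- 1) ^ (j + n) * of_nat (Suc n choose Suc j) * s (Suc j))"
    unfolding binomial_difference_def by (subst sum.atMost_Suc_shift) simp
  also have "\<dots> = (\<Sum>j\<le>n. (- 1) ^ (j + n) * of_nat (n choose j) * s (Suc j)) +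
      ((- 1) ^ Suc n * s 0 + (\<Sum>j\<le>n. (- 1) ^ (j + n) * of_nat (n choose Suc j) * s (Suc j)))"
    by (simp add: algebra_simps sum.distrib)
  also have "(- 1) ^ Suc n * s 0 + (\<Sum>j\<le>n. (- 1) ^ (j + n) * of_nat (n choose Suc j) * s (Suc j))
      = - (\<Sum>j\<le>Suc n. (- 1) ^ (j + n) * of_nat (n choose j) * s j)"
    by (subst sum.atMost_Suc_shift) (simp add: sum_negf[symmetric])
  also have "(\<Sum>j\<le>Suc n. (- 1) ^ (j + n) * of_nat (n choose j) * s j) = binomial_difference s n"
    by (simp add: binomial_difference_def binomial_eq_0)
  finally show ?thesis by (simp add: binomial_difference_def)
qed

text \<open>Newton's forward difference formula: the shift of a sequence is the identity plus the
  difference operator.\<close>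

lemma binomial_difference_inverse: "s k = (\<Sum>j\<le>k. of_nat (k choose j) * binomial_difference s j)"
proof (induction k arbitrary: s)
  case 0
  show ?case by (simp add: binomial_difference_def)
next
  case (Suc k)
  have "s (Suc k) = (\<Sum>j\<le>k. of_nat (k choose j) * (binomial_difference s (Suc j) + binomial_difference s j))"
    using Suc[of "\<lambda>k. s (Suc k)"] by (simp add: binomial_difference_Suc)
  also have "\<dots> = (\<Sum>j\<le>k. of_nat (k choose j) * binomial_difference s (Suc j)) + (\<Sum>j\<le>Suc k. of_nat (k choose j) * binomial_difference s j)"
    by (simp add: distrib_left sum.distrib binomial_eq_0)
  also have "(\<Sum>j\<le>Suc k. of_nat (k choose j) * binomial_difference s j)
      = binomial_difference s 0 + (\<Sum>j\<le>k. of_nat (k choose Suc j) * binomial_difference s (Suc j))"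
    by (subst sum.atMost_Suc_shift) simp
  also have "(\<Sum>j\<le>k. of_nat (k choose j) * binomial_difference s (Suc j)) + (binomial_difference s 0 + (\<Sum>j\<le>k. of_nat (k choose Suc j) * binomial_difference s (Suc j)))
      = (\<Sum>j\<le>Suc k. of_nat (Suc k choose j) * binomial_difference s j)"
    by (subst sum.atMost_Suc_shift) (simp add: algebra_simps sum.distrib)
  finally show ?case .
qed

lemma triangle_eq: "triangle A n \<alpha> \<beta> i l = binomial_difference (\<lambda>k. shift_sum k A \<alpha> \<beta> i l) n"
  by (simp add: triangle_def binomial_difference_def)

lemma binomial_difference_sum: "binomial_difference (\<lambda>k. \<Sum>i\<in>I. s i k) n = (\<Sum>i\<in>I. binomial_difference (s i) n)"
  unfolding binomial_difference_def sum_distrib_left by (rule sum.swap)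

text \<open>The next triangle arises by applying the sum of the shifts minus the identity;
  conditions (ii) and (iv) are two readings of this, and vanishing persists to all higher
  orders.\<close>

lemma triangle_Suc:
  "triangle A (Suc n) \<alpha> \<beta> i l =
    (\<Sum>j\<in>UNIV. triangle A n (\<alpha> + axis j 1) (\<beta> + axis j 1) i l) - triangle A n \<alpha> \<beta> i l"
  by (simp add: triangle_eq binomial_difference_Suc shift_sum_Suc binomial_difference_sum del: One_nat_def)

lemma triangle_eq_zero_mono:
  assumes "\<forall>\<alpha> \<beta> i l. triangle A m \<alpha> \<beta> i l = 0" "m \<le> n"
  shows "triangle A n \<alpha> \<beta> i l = 0"
  using assms(2) by (induction n arbitrary: \<alpha> \<beta> rule: dec_induct) (use assms(1) in \<open>auto simp: triangle_Suc\<close>)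

text \<open>The right-hand side is Newton's formula cut off at \<open>m\<close>. Conversely, at
  \<open>k = m\<close> the only missing term is the triangle of order m with coefficient 1.\<close>

lemma triangle_eq_zero_iff_expansion:
  "(\<forall>\<alpha> \<beta> i l. triangle A m \<alpha> \<beta> i l = 0) \<longleftrightarrow>
    (\<forall>k \<alpha> \<beta> i l. shift_sum k A \<alpha> \<beta> i l = (\<Sum>j<m. of_nat (k choose j) * triangle A j \<alpha> \<beta> i l))"
proof (intro iffI allI)
  fix k \<alpha> \<beta> i l
  assume zero: "\<forall>\<alpha> \<beta> i l. triangle A m \<alpha> \<beta> i l = 0"
  have "shift_sum k A \<alpha> \<beta> i l = (\<Sum>j\<le>k. of_nat (k choose j) * triangle A j \<alpha> \<beta> i l)"
    unfolding triangle_eq by (rule binomial_difference_inverse)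
  also have "\<dots> = (\<Sum>j<max m (Suc k). of_nat (k choose j) * triangle A j \<alpha> \<beta> i l)"
    by (rule sum.mono_neutral_left) (auto simp: binomial_eq_0)
  also have "\<dots> = (\<Sum>j<m. of_nat (k choose j) * triangle A j \<alpha> \<beta> i l)"
    by (rule sum.mono_neutral_right) (auto simp: triangle_eq_zero_mono[OF zero])
  finally show "shift_sum k A \<alpha> \<beta> i l = (\<Sum>j<m. of_nat (k choose j) * triangle A j \<alpha> \<beta> i l)" .
next
  fix \<alpha> \<beta> i l
  assume "\<forall>k \<alpha> \<beta> i l. shift_sum k A \<alpha> \<beta> i l = (\<Sum>j<m. of_nat (k choose j) * triangle A j \<alpha> \<beta> i l)"
  then have "shift_sum m A \<alpha> \<beta> i l = (\<Sum>j<m. of_nat (m choose j) * triangle A j \<alpha> \<beta> i l)"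
    by blast
  moreover have "shift_sum m A \<alpha> \<beta> i l = (\<Sum>j\<le>m. of_nat (m choose j) * triangle A j \<alpha> \<beta> i l)"
    unfolding triangle_eq by (rule binomial_difference_inverse)
  ultimately have "(\<Sum>j\<le>m. of_nat (m choose j) * triangle A j \<alpha> \<beta> i l) = (\<Sum>j<m. of_nat (m choose j) * triangle A j \<alpha> \<beta> i l)"
    by (simp only:)
  then show "triangle A m \<alpha> \<beta> i l = 0"
    by (simp add: lessThan_Suc_atMost[symmetric])
qed

text \<open>As a function of k the top term grows like k^n, the others at most like k^(n-1), so a
  negative \<open>b n\<close> would make the sum negative for large k.\<close>

lemma binomial_leading_coefficient_nonneg:
  fixes b :: "nat \<Rightarrow> real"
  assumes "\<And>k. 0 \<le> (\<Sum>j\<le>n. of_nat (k choose j) * b j)"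
  shows "0 \<le> b n"
proof (rule ccontr)
  assume "\<not> 0 \<le> b n"
  then have neg: "b n < 0" by simp
  define C where "C = (\<Sum>j<n. \<bar>b j\<bar>)"
  \<comment> \<open>Chosen so that the lower bound (k/n)^n for the top binomial coefficient,
    multiplied by \<open>b n\<close>, outweighs the bound C k^(n-1) for all lower terms.\<close>
  obtain k :: nat where k: "k > n" "C * real n ^ n < - b n * real k"
  proof -
    obtain k0 :: nat where k0: "C * real n ^ n < real k0 * (- b n)" using neg reals_Archimedean3[of "- b n"] by auto
    have "real k0 * (- b n) \<le> real (k0 + Suc n) * (- b n)" using neg by (intro mult_right_mono) auto
    then show ?thesis using that[of "k0 + Suc n"] k0 by (simp add: mult.commute)
  qed
  then have kp: "real k > 0" by simp
  have "0 \<le> (\<Sum>j\<le>n. of_nat (k choose j) * b j)" by (rule assms)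
  also have "\<dots> = (\<Sum>j<n. of_nat (k choose j) * b j) + of_nat (k choose n) * b n"
    by (simp add: lessThan_Suc_atMost[symmetric])
  also have "(\<Sum>j<n. of_nat (k choose j) * b j) \<le> (\<Sum>j<n. real k ^ (n - 1) * \<bar>b j\<bar>)"
  proof (rule sum_mono)
    fix j assume "j \<in> {..<n}"
    have "real (k choose j) \<le> real k ^ j"
      using binomial_le_pow[of j k] k(1) \<open>j \<in> {..<n}\<close> by (simp flip: of_nat_power)
    also have "\<dots> \<le> real k ^ (n - 1)"
      using \<open>j \<in> {..<n}\<close> k(1) by (intro power_increasing) auto
    finally have "real (k choose j) * \<bar>b j\<bar> \<le> real k ^ (n - 1) * \<bar>b j\<bar>" by (intro mult_right_mono) auto
    moreover have "real (k choose j) * b j \<le> real (k choose j) * \<bar>b j\<bar>" by (intro mult_left_mono) auto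
    ultimately show "of_nat (k choose j) * b j \<le> real k ^ (n - 1) * \<bar>b j\<bar>" by linarith
  qed
  also have "\<dots> = real k ^ (n - 1) * C" by (simp add: C_def sum_distrib_left)
  also have "of_nat (k choose n) * b n \<le> (real k / real n) ^ n * b n"
    using binomial_ge_n_over_k_pow_k[of n k, where 'a = real] k(1) neg by (intro mult_right_mono_neg) auto
  finally have 1: "0 \<le> real k ^ (n - 1) * C + (real k / real n) ^ n * b n" by simp
  show False
  proof (cases n)
    case 0
    then show ?thesis using 1 neg by (simp add: C_def)
  next
    case (Suc n')
    then have np: "real n ^ n > 0" by simp
    have "0 \<le> (real k ^ (n - 1) * C + (real k / real n) ^ n * b n) * real n ^ n"
      using 1 np by (intro mult_nonneg_nonneg) auto
    also have "\<dots> = real k ^ n' * (C * real n ^ n + real k * b n)"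
      using np Suc by (simp add: power_divide field_simps)
    finally have "0 \<le> C * real n ^ n + real k * b n"
      using zero_less_power[OF kp, of n'] by (simp add: zero_le_mult_iff)
    then show False using k(2) by (simp add: mult.commute)
  qed
qed

section \<open>Defect forms and Gramian matrices\<close>

lemma bounded_sesquilinear_add:
  assumes "bounded_sesquilinear b" "bounded_sesquilinear b'"
  shows "bounded_sesquilinear (\<lambda>x y. b x y + b' x y)"
proof -
  obtain K K' where K: "\<And>x y. cmod (b x y) \<le> K * (norm x * norm y)" "\<And>x y. cmod (b' x y) \<le> K' * (norm x * norm y)"
    using assms by (auto simp: bounded_sesquilinear_def)
  have "cmod (b x y + b' x y) \<le> (K + K') * (norm x * norm y)" for x y
    using norm_triangle_ineq[of "b x y" "b' x y"] K(1)[of x y] K(2)[of x y] by (simp add: distrib_right)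
  moreover have "sesquilinear (\<lambda>x y. b x y + b' x y)"
    using assms by (auto simp: bounded_sesquilinear_def sesquilinear_def algebra_simps)
  ultimately show ?thesis by (auto simp: bounded_sesquilinear_def)
qed

lemma bounded_sesquilinear_scale:
  assumes "bounded_sesquilinear b"
  shows "bounded_sesquilinear (\<lambda>x y. c * b x y)"
proof -
  obtain K where K: "\<And>x y. cmod (b x y) \<le> K * (norm x * norm y)"
    using assms by (auto simp: bounded_sesquilinear_def)
  have "cmod (c * b x y) \<le> (cmod c * K) * (norm x * norm y)" for x y
    using mult_left_mono[OF K[of x y], of "cmod c"] by (simp add: norm_mult mult.assoc)
  moreover have "sesquilinear (\<lambda>x y. c * b x y)"
    using assms by (auto simp: bounded_sesquilinear_def sesquilinear_def algebra_simps)
  ultimately show ?thesis by (auto simp: bounded_sesquilinear_def)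
qed

lemma bounded_sesquilinear_sum:
  assumes "\<And>i. i \<in> I \<Longrightarrow> bounded_sesquilinear (b i)"
  shows "bounded_sesquilinear (\<lambda>x y. \<Sum>i\<in>I. b i x y)"
  using assms
proof (induction I rule: infinite_finite_induct)
  case (insert i I)
  then show ?case by (simp add: bounded_sesquilinear_add)
qed (auto simp: bounded_sesquilinear_def sesquilinear_def intro: exI[of _ 0])

lemma bounded_sesquilinear_continuous:
  assumes "bounded_sesquilinear b"
  shows "continuous_on UNIV (\<lambda>x. b x y)" "continuous_on UNIV (b x)"
proof -
  obtain K where K: "\<And>x y. cmod (b x y) \<le> K * (norm x * norm y)"
    using assms by (auto simp: bounded_sesquilinear_def)
  note bs = sesquilinear_simps[OF assms[unfolded bounded_sesquilinear_def, THEN conjunct1]]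
  have "bounded_linear (\<lambda>x. b x y)"
  proof (rule bounded_linear_intro)
    show "b (r *\<^sub>R x) y = r *\<^sub>R b x y" for r x
      using bs(2)[of "complex_of_real r" x y] by (simp add: scaleC_of_real scaleR_conv_of_real)
    show "norm (b x y) \<le> norm x * (K * norm y)" for x using K[of x y] by (simp add: algebra_simps)
  qed (rule bs)
  then show "continuous_on UNIV (\<lambda>x. b x y)" by (rule linear_continuous_on)
  have "bounded_linear (b x)"
  proof (rule bounded_linear_intro)
    show "b x (r *\<^sub>R y) = r *\<^sub>R b x y" for r y
      using bs(4)[of x "complex_of_real r" y] by (simp add: scaleC_of_real scaleR_conv_of_real)
    show "norm (b x y) \<le> norm y * (K * norm x)" for y using K[of x y] by (simp add: algebra_simps)
  qed (rule bs)
  then show "continuous_on UNIV (b x)" by (rule linear_continuous_on)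
qed

text \<open>For one fixed argument the zero set in the other is a closed subspace; the two arguments
  are treated one after the other.\<close>

lemma bounded_sesquilinear_zero_on_closure:
  assumes b: "bounded_sesquilinear b" and zero: "\<And>x y. x \<in> X \<Longrightarrow> y \<in> Y \<Longrightarrow> b x y = 0"
    and x: "x \<in> closure (cspan X)" and y: "y \<in> closure (cspan Y)"
  shows "b x y = 0"
proof -
  note bs = sesquilinear_simps[OF b[unfolded bounded_sesquilinear_def, THEN conjunct1]]
  have 1: "b x y = 0" if "x \<in> closure (cspan X)" "y \<in> Y" for x y
  proof -
    have "cspan X \<subseteq> {x. b x y = 0}"
      using zero \<open>y \<in> Y\<close> by (intro complex_vector.span_minimal) (auto simp: complex_vector.subspace_def bs)
    then have "closure (cspan X) \<subseteq> {x. b x y = 0}"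
      by (rule closure_minimal) (intro closed_Collect_eq bounded_sesquilinear_continuous[OF b] continuous_on_const)
    then show ?thesis using that by blast
  qed
  have "cspan Y \<subseteq> {y. b x y = 0}"
    using 1[OF x] by (intro complex_vector.span_minimal) (auto simp: complex_vector.subspace_def bs)
  then have "closure (cspan Y) \<subseteq> {y. b x y = 0}"
    by (rule closure_minimal) (intro closed_Collect_eq bounded_sesquilinear_continuous[OF b] continuous_on_const)
  then show ?thesis using y by blast
qed

section \<open>Defect forms of a commuting tuple\<close>

definition power_form :: "('d::finite \<Rightarrow> 'h \<Rightarrow> 'h::complex_inner) \<Rightarrow> nat \<Rightarrow> 'h \<Rightarrow> 'h \<Rightarrow> complex" where
  "power_form T n x y = cinner ((Q_map T ^^ n) id x) y"

definition defect_form :: "('d::finite \<Rightarrow> 'h \<Rightarrow> 'h::complex_inner) \<Rightarrow> nat \<Rightarrow> 'h \<Rightarrow> 'h \<Rightarrow> complex" where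
  "defect_form T n x y = binomial_difference (\<lambda>k. power_form T k x y) n"

lemma power_form_zero: "power_form T 0 x y = cinner x y"
  by (simp add: power_form_def)

lemma power_form_Suc:
  fixes T :: "'d::finite \<Rightarrow> 'h::chilbert_space \<Rightarrow> 'h"
  assumes T: "commuting_tuple T"
  shows "power_form T (Suc n) x y = (\<Sum>j\<in>UNIV. power_form T n (T j x) (T j y))"
proof -
  have "cinner (cadjoint (T j) u) y = cinner u (T j y)" for j u
    using cadjoint[OF commuting_tupleD(1)[OF T], of j y u] cinner_commute by metis
  then show ?thesis by (simp add: power_form_def Q_map_def cinner_sum_left)
qed

lemma defect_form_Suc:
  fixes T :: "'d::finite \<Rightarrow> 'h::chilbert_space \<Rightarrow> 'h"
  assumes T: "commuting_tuple T"
  shows "defect_form T (Suc n) x y = (\<Sum>j\<in>UNIV. defect_form T n (T j x) (T j y)) - defect_form T n x y"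
  by (simp add: defect_form_def binomial_difference_Suc power_form_Suc[OF T] binomial_difference_sum)

lemma bounded_sesquilinear_power_form:
  fixes T :: "'d::finite \<Rightarrow> 'h::chilbert_space \<Rightarrow> 'h"
  assumes T: "commuting_tuple T"
  shows "bounded_sesquilinear (power_form T n)"
proof (induction n)
  case 0
  have "power_form T 0 = cinner" by (intro ext power_form_zero)
  then show ?case by (simp add: bounded_sesquilinear_cinner)
next
  case (Suc n)
  have "power_form T (Suc n) = (\<lambda>x y. \<Sum>j\<in>UNIV. power_form T n (T j x) (T j y))"
    by (intro ext power_form_Suc T)
  then show ?case using Suc commuting_tupleD(1)[OF T] by (simp add: bounded_sesquilinear_sum bounded_sesquilinear_compose)
qed

lemma bounded_sesquilinear_defect_form:
  fixes T :: "'d::finite \<Rightarrow> 'h::chilbert_space \<Rightarrow> 'h"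
  assumes T: "commuting_tuple T"
  shows "bounded_sesquilinear (defect_form T n)"
proof -
  have "defect_form T n = (\<lambda>x y. \<Sum>j\<le>n. ((- 1) ^ (j + n) * of_nat (n choose j)) * power_form T j x y)"
    by (intro ext) (simp add: defect_form_def binomial_difference_def)
  then show ?thesis
    by (simp add: bounded_sesquilinear_sum bounded_sesquilinear_scale bounded_sesquilinear_power_form[OF T])
qed

text \<open>The two sign conventions differ by the global factor (-1)^m.\<close>

lemma joint_isometry_iff_defect_form:
  fixes T :: "'d::finite \<Rightarrow> 'h::complex_inner \<Rightarrow> 'h"
  shows "joint_isometry m T \<longleftrightarrow> (\<forall>x y. defect_form T m x y = 0)"
proof -
  have "defect_form T m x y = (- 1) ^ m * cinner (\<Sum>n\<le>m. ((- 1) ^ n * of_nat (m choose n)) *\<^sub>C ((Q_map T ^^ n) id) x) y" for x y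
    by (simp add: defect_form_def binomial_difference_def power_form_def cinner_sum_left cinner_scaleC_left
        sum_distrib_left power_add mult_ac)
  moreover have "z = 0 \<longleftrightarrow> (\<forall>y. cinner z y = 0)" for z :: 'h
    using cinner_ext[of z 0] by auto
  ultimately show ?thesis by (simp add: joint_isometry_def)
qed

lemma power_form_nonneg:
  fixes T :: "'d::finite \<Rightarrow> 'h::chilbert_space \<Rightarrow> 'h"
  assumes T: "commuting_tuple T"
  shows "power_form T n x x \<in> \<real>\<^sub>\<ge>\<^sub>0"
  by (induction n arbitrary: x)
    (simp_all add: power_form_zero cinner_self power_form_Suc[OF T] complex_nonneg_Reals_sum)

text \<open>All defects of order above \<open>n\<close> vanish, so Newton's formula writes the
  nonnegative numbers \<open>power_form T k x x\<close> as a polynomial in k whose top coefficient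
  is the defect of order \<open>n\<close>.\<close>

lemma defect_form_nonneg:
  fixes T :: "'d::finite \<Rightarrow> 'h::chilbert_space \<Rightarrow> 'h"
  assumes T: "commuting_tuple T" and zero: "\<And>x y. defect_form T (Suc n) x y = 0"
  shows "defect_form T n x x \<in> \<real>\<^sub>\<ge>\<^sub>0"
proof -
  have zero': "defect_form T j x x = 0" if "Suc n \<le> j" for j x
  proof -
    have "defect_form T j x y = 0" for x y
      using that
    proof (induction j arbitrary: x y rule: dec_induct)
      case (step j)
      then show ?case by (subst defect_form_Suc[OF T]) simp
    qed (rule zero)
    then show ?thesis .
  qed
  have real: "power_form T k x x = complex_of_real (Re (power_form T k x x))" for k
    using power_form_nonneg[OF T, of k x] by (auto simp: complex_nonneg_Reals_iff complex_eq_iff)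
  have dreal: "defect_form T j x x = complex_of_real (Re (defect_form T j x x))" for j
  proof -
    have "defect_form T j x x = (\<Sum>i\<le>j. complex_of_real ((- 1) ^ (i + j) * of_nat (j choose i) * Re (power_form T i x x)))"
      unfolding defect_form_def binomial_difference_def by (subst real) simp
    also have "\<dots> = complex_of_real (\<Sum>i\<le>j. (- 1) ^ (i + j) * of_nat (j choose i) * Re (power_form T i x x))"
      by (rule of_real_sum[symmetric])
    finally show ?thesis by simp
  qed
  have "0 \<le> (\<Sum>j\<le>n. of_nat (k choose j) * Re (defect_form T j x x))" for k
  proof -
    have "power_form T k x x = (\<Sum>j\<le>k. of_nat (k choose j) * defect_form T j x x)"
      unfolding defect_form_def by (rule binomial_difference_inverse)
    also have "\<dots> = (\<Sum>j\<le>max k n. of_nat (k choose j) * defect_form T j x x)"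
      by (rule sum.mono_neutral_left) (auto simp: binomial_eq_0)
    also have "\<dots> = (\<Sum>j\<le>n. of_nat (k choose j) * defect_form T j x x)"
      by (rule sum.mono_neutral_right) (auto simp: zero')
    finally have "Re (power_form T k x x) = (\<Sum>j\<le>n. of_nat (k choose j) * Re (defect_form T j x x))"
      by simp
    then show ?thesis using power_form_nonneg[OF T, of k x] by (simp add: complex_nonneg_Reals_iff)
  qed
  then have "0 \<le> Re (defect_form T n x x)" by (rule binomial_leading_coefficient_nonneg)
  then show ?thesis by (subst dreal) simp
qed

lemma invariant_defect_form:
  fixes T :: "'d::finite \<Rightarrow> 'h::chilbert_space \<Rightarrow> 'h"
  assumes T: "commuting_tuple T" and zero: "\<And>x y. defect_form T (Suc n) x y = 0"
  shows "invariant_form T (defect_form T n)"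
  unfolding invariant_form_def positive_form_def
  using bounded_sesquilinear_defect_form[OF T, where n = n] defect_form_nonneg[OF T zero] zero
  by (auto simp: bounded_sesquilinear_def defect_form_Suc[OF T])

text \<open>Both sides obey the same recursion: a backward shift by the unit index of j raises both
  powers, which is an application of \<open>T j\<close> in both arguments.\<close>

lemma shift_sum_gramian:
  fixes T :: "'d::{finite,linorder} \<Rightarrow> 'h::chilbert_space \<Rightarrow> 'h"
  assumes T: "commuting_tuple T"
  shows "shift_sum n (gramian T f) \<alpha> \<beta> i l = power_form T n (tuple_power T \<beta> (f l)) (tuple_power T \<alpha> (f i))"
proof (induction n arbitrary: \<alpha> \<beta>)
  case 0
  show ?case by (simp add: shift_sum_zero power_form_zero gramian_def)
next
  case (Suc n)
  then show ?case
    by (simp only: shift_sum_Suc power_form_Suc[OF T] tuple_power_axis[OF T])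
qed

lemma triangle_gramian:
  fixes T :: "'d::{finite,linorder} \<Rightarrow> 'h::chilbert_space \<Rightarrow> 'h"
  assumes T: "commuting_tuple T"
  shows "triangle (gramian T f) n = (\<lambda>\<alpha> \<beta> i l. defect_form T n (tuple_power T \<beta> (f l)) (tuple_power T \<alpha> (f i)))"
  by (intro ext) (simp add: triangle_eq shift_sum_gramian[OF T] defect_form_def)

text \<open>Density is used twice: from the basis \<open>f\<close> to the joint kernel inside each
  pair of powers, then from the powers of kernel vectors to the whole space.\<close>

lemma joint_isometry_iff_triangle:
  fixes T :: "'d::{finite,linorder} \<Rightarrow> 'h::chilbert_space \<Rightarrow> 'h"
  assumes T: "commuting_tuple T" and f: "orthonormal_basis_of f (joint_kernel_adjoint T)"
    and wandering: "wandering_subspace_property T"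
  shows "joint_isometry m T \<longleftrightarrow> (\<forall>\<alpha> \<beta> i l. triangle (gramian T f) m \<alpha> \<beta> i l = 0)"
proof
  assume "joint_isometry m T"
  then show "\<forall>\<alpha> \<beta> i l. triangle (gramian T f) m \<alpha> \<beta> i l = 0"
    by (simp add: joint_isometry_iff_defect_form triangle_gramian[OF T])
next
  assume zero: "\<forall>\<alpha> \<beta> i l. triangle (gramian T f) m \<alpha> \<beta> i l = 0"
  note b = bounded_sesquilinear_defect_form[OF T, where n = m]
  have ker: "closure (cspan (range f)) = joint_kernel_adjoint T"
    using f by (simp add: orthonormal_basis_of_def)
  have 1: "defect_form T m (tuple_power T \<beta> h) (tuple_power T \<alpha> h') = 0"
    if "h \<in> joint_kernel_adjoint T" "h' \<in> joint_kernel_adjoint T" for \<alpha> \<beta> h h'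
  proof -
    have "defect_form T m (tuple_power T \<beta> x) (tuple_power T \<alpha> y) = 0" if "x \<in> range f" "y \<in> range f" for x y
      using that zero by (auto simp: triangle_gramian[OF T])
    from bounded_sesquilinear_zero_on_closure[OF bounded_sesquilinear_compose[OF b
        bounded_clinear_tuple_power[OF T] bounded_clinear_tuple_power[OF T]] this]
    show ?thesis using that by (simp only: ker)
  qed
  have "defect_form T m x y = 0" for x y
  proof (rule bounded_sesquilinear_zero_on_closure[OF b])
    let ?X = "{tuple_power T \<alpha> h | \<alpha> h. h \<in> joint_kernel_adjoint T}"
    show "x \<in> closure (cspan ?X)" "y \<in> closure (cspan ?X)"
      using wandering by (simp_all add: wandering_subspace_property_def)
    show "defect_form T m x y = 0" if "x \<in> ?X" "y \<in> ?X" for x y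
      using that 1 by blast
  qed
  then show "joint_isometry m T" by (simp add: joint_isometry_iff_defect_form)
qed

section \<open>Orthonormal families and the synthesis map\<close>

lemma bessel_inequality:
  fixes f :: "'i \<Rightarrow> 'h::complex_inner"
  assumes f: "\<And>i j. cinner (f i) (f j) = (if i = j then 1 else 0)" and F: "finite F"
  shows "(\<Sum>i\<in>F. (cmod (cinner h (f i)))\<^sup>2) \<le> (norm h)\<^sup>2"
proof -
  define p where "p = (\<Sum>i\<in>F. cinner h (f i) *\<^sub>C f i)"
  define s where "s = (\<Sum>i\<in>F. (cmod (cinner h (f i)))\<^sup>2)"
  have hp: "cinner h p = complex_of_real s"
    by (simp add: p_def s_def cinner_sum_right cinner_scaleC_right complex_norm_square mult.commute del: of_real_power)
  have pf: "cinner p (f i) = cinner h (f i)" if "i \<in> F" for i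
    using F that by (simp add: p_def cinner_sum_left cinner_scaleC_left f if_distrib cong: if_cong)
  have "cinner p p = (\<Sum>i\<in>F. cnj (cinner h (f i)) * cinner p (f i))"
    by (subst (2) p_def) (simp add: cinner_sum_right cinner_scaleC_right)
  also have "\<dots> = complex_of_real s"
    using pf by (simp add: s_def complex_norm_square mult.commute del: of_real_power)
  finally have pp: "cinner p p = complex_of_real s" .
  have "cinner p h = complex_of_real s" using hp cinner_commute[of p h] by simp
  then have "cinner (h - p) (h - p) = cinner h h - complex_of_real s"
    using hp pp by (simp add: cinner_diff_left cinner_diff_right)
  then have "(norm (h - p))\<^sup>2 = (norm h)\<^sup>2 - s"
    by (simp only: cinner_self of_real_diff[symmetric] of_real_eq_iff)
  then show ?thesis using zero_le_power2[of "norm (h - p)"] by (simp add: s_def)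
qed

definition analysis_map :: "('i \<Rightarrow> 'h::complex_inner) \<Rightarrow> 'h \<Rightarrow> 'i ell2" where
  "analysis_map f h = Abs_ell2 (\<lambda>i. cinner h (f i))"

lemma ell2_nth_analysis_map:
  assumes f: "\<And>i j. cinner (f i) (f j) = (if i = j then 1 else 0)"
  shows "ell2_nth (analysis_map f h) i = cinner h (f i)"
proof -
  have "(\<lambda>i. (cmod (cinner h (f i)))\<^sup>2) summable_on UNIV"
    by (rule nonneg_bdd_above_summable_on) (auto intro!: bdd_aboveI2 bessel_inequality[OF f])
  then show ?thesis by (simp add: analysis_map_def Abs_ell2_inverse)
qed

lemma bounded_clinear_analysis_map:
  assumes f: "\<And>i j. cinner (f i) (f j) = (if i = j then 1 else 0)"
  shows "bounded_clinear (analysis_map f)"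
proof (rule bounded_clinearI[of _ 1])
  show "norm (analysis_map f h) \<le> 1 * norm h" for h
    using bessel_inequality[OF f] by (auto intro!: ell2_norm_leI simp: ell2_nth_analysis_map[OF f])
qed (auto intro!: ell2_eqI simp: ell2_nth_analysis_map[OF f] cinner_add_left cinner_scaleC_left)

text \<open>V is the adjoint of the analysis map; it sends the unit vector at index i to
  \<open>f i\<close>.\<close>

lemma synthesis_map_exists:
  fixes f :: "'i \<Rightarrow> 'h::chilbert_space"
  assumes f: "\<And>i j. cinner (f i) (f j) = (if i = j then 1 else 0)"
  shows "\<exists>V :: 'i ell2 \<Rightarrow> 'h. bounded_clinear V \<and> (\<forall>x h. cinner x (analysis_map f h) = cinner (V x) h)"
proof -
  have "bounded_clinear (\<lambda>x :: 'i ell2. x)" by (rule bounded_clinearI[of _ 1]) auto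
  from bounded_sesquilinear_operator[OF bounded_sesquilinear_compose[OF bounded_sesquilinear_cinner this bounded_clinear_analysis_map[OF f]]]
  show ?thesis .
qed

text \<open>If M represents \<open>b\<close>, the matrix of \<open>b\<close> with respect to
  \<open>f\<close> is that of M compressed by V and its adjoint, the analysis map. This also shows
  that its row sums define an \<open>ell2\<close> vector.\<close>

lemma cinner_matrix_operator:
  fixes f :: "'i \<Rightarrow> 'h::chilbert_space"
  assumes f: "\<And>i j. cinner (f i) (f j) = (if i = j then 1 else 0)"
    and V: "\<And>x h. cinner x (analysis_map f h) = cinner (V x) h"
    and b: "bounded_sesquilinear b"
  shows "cinner (matrix_operator (\<lambda>i l. b (f l) (f i)) x) y = b (V x) (V y)"
proof -
  obtain M where M: "bounded_clinear M" "\<And>u v. b u v = cinner (M u) v"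
    using bounded_sesquilinear_operator[OF b] by blast
  have "(\<Sum>\<^sub>\<infinity>l. b (f l) (f i) * ell2_nth x l) = ell2_nth (analysis_map f (M (V x))) i" for i
  proof -
    \<comment> \<open>With the adjoint moved onto \<open>f i\<close>, the i-th row sum becomes an
      \<open>ell2\<close> inner product of \<open>x\<close> with the coefficients of
      \<open>z\<close>.\<close>
    define z where "z = cadjoint M (f i)"
    have z: "cinner (M u) (f i) = cinner u z" for u unfolding z_def by (rule cadjoint[OF M(1)])
    have "ell2_nth (analysis_map f (M (V x))) i = cinner x (analysis_map f z)"
      by (simp add: ell2_nth_analysis_map[OF f] z V)
    also have "\<dots> = (\<Sum>\<^sub>\<infinity>l. ell2_nth x l * cnj (cinner z (f l)))"
      by (simp add: cinner_ell2_def ell2_nth_analysis_map[OF f])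
    also have "\<dots> = (\<Sum>\<^sub>\<infinity>l. b (f l) (f i) * ell2_nth x l)"
      unfolding M(2) z cinner_commute[of _ z, symmetric] by (simp add: mult.commute)
    finally show ?thesis ..
  qed
  then have "matrix_operator (\<lambda>i l. b (f l) (f i)) x = analysis_map f (M (V x))"
    by (simp add: matrix_operator_def ell2_nth_inverse)
  then have "cinner (matrix_operator (\<lambda>i l. b (f l) (f i)) x) y = cnj (cinner y (analysis_map f (M (V x))))"
    by (simp add: cinner_commute[symmetric])
  also have "\<dots> = b (V x) (V y)" by (simp add: V M(2) cinner_commute[symmetric])
  finally show ?thesis .
qed

theorem theorem5p3:
  fixes T :: "'d::{finite,linorder} \<Rightarrow> 'h::chilbert_space \<Rightarrow> 'h"
    and f :: "'i::preorder \<Rightarrow> 'h"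
    and G :: "('d, 'i) matrix_array"
    and m :: nat
  assumes "m \<ge> 1"
    and "separable_space (euclidean :: 'h topology)"
    and "commuting_tuple T"
    and "\<And>i j :: 'i. \<exists>k. i \<le> k \<and> j \<le> k"
    and "orthonormal_basis_of f (joint_kernel_adjoint T)"
    and "G = gramian T f"
    and "wandering_subspace_property T"
  shows
    "(joint_isometry m T \<longleftrightarrow>
        (\<forall>\<alpha> \<beta> i l. triangle G m \<alpha> \<beta> i l = 0)) \<and>
     (joint_isometry m T \<longleftrightarrow>
        (\<forall>k \<alpha> \<beta> i l. shift_sum k G \<alpha> \<beta> i l =
          (\<Sum>j<m. of_nat (k choose j) * triangle G j \<alpha> \<beta> i l))) \<and>
     (joint_isometry m T \<longleftrightarrow>
        (\<forall>\<alpha> \<beta> i l. (\<Sum>j\<in>UNIV. backward_shift j (triangle G (m - 1)) \<alpha> \<beta> i l) =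
          triangle G (m - 1) \<alpha> \<beta> i l)) \<and>
     (joint_isometry m T \<longrightarrow>
        nonneg_array (triangle G (m - 1)) \<and>
        (\<exists>F :: (complex ^ 'd::{finite,linorder}) set \<Rightarrow> 'i ell2 \<Rightarrow> 'i ell2.
          semispectral_measure (sphere 0 1) F \<and>
          (\<forall>\<alpha> \<beta>. has_weak_integral (sphere 0 1) F
            (\<lambda>\<zeta>. (\<Prod>j\<in>UNIV. (\<zeta> $ j) ^ (\<alpha> $ j)) * (\<Prod>j\<in>UNIV. cnj (\<zeta> $ j) ^ (\<beta> $ j)))
            (matrix_operator (\<lambda>i l. \<Sum>j\<le>m - 1. (- 1) ^ (j + (m - 1)) * of_nat ((m - 1) choose j) *
              (\<Sum>\<gamma> | index_abs \<gamma> = j. of_nat (fact (index_abs \<gamma>)) / of_nat (index_fact \<gamma>) *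
                G (\<alpha> + \<gamma>) (\<beta> + \<gamma>) i l))))))"
proof -
  note T = assms(3)
  obtain n where m: "m = Suc n" using assms(1) by (cases m) auto
  have f: "cinner (f i) (f j) = (if i = j then 1 else 0)" for i j
    using assms(5) by (simp add: orthonormal_basis_of_def)
  have iff: "joint_isometry m T \<longleftrightarrow> (\<forall>\<alpha> \<beta> i l. triangle G m \<alpha> \<beta> i l = 0)"
    unfolding assms(6) by (rule joint_isometry_iff_triangle[OF T assms(5,7)])
  have "(\<forall>\<alpha> \<beta> i l. triangle G m \<alpha> \<beta> i l = 0) \<longleftrightarrow>
      (\<forall>\<alpha> \<beta> i l. (\<Sum>j\<in>UNIV. backward_shift j (triangle G (m - 1)) \<alpha> \<beta> i l) = triangle G (m - 1) \<alpha> \<beta> i l)"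
    by (simp add: m triangle_Suc backward_shift_def)
  moreover have "nonneg_array (triangle G (m - 1)) \<and>
        (\<exists>F :: (complex ^ 'd::{finite,linorder}) set \<Rightarrow> 'i ell2 \<Rightarrow> 'i ell2.
          semispectral_measure (sphere 0 1) F \<and>
          (\<forall>\<alpha> \<beta>. has_weak_integral (sphere 0 1) F (mixed_monomial \<alpha> \<beta>) (matrix_operator (triangle G (m - 1) \<alpha> \<beta>))))"
    if iso: "joint_isometry m T"
  proof -
    interpret commuting T by unfold_locales (rule T)
    let ?B = "defect_form T n"
    have zero: "defect_form T (Suc n) x y = 0" for x y
      using iso by (simp add: m joint_isometry_iff_defect_form)
    have inv: "invariant_form T ?B"
      by (rule invariant_defect_form[OF T zero])
    then have pos: "?B x x \<in> \<real>\<^sub>\<ge>\<^sub>0" and sq: "sesquilinear ?B" for x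
      by (auto simp: invariant_form_def positive_form_def)
    have bB: "bounded_sesquilinear ?B"
      by (rule bounded_sesquilinear_defect_form[OF T])
    then obtain K where K: "\<And>x y. cmod (?B x y) \<le> K * (norm x * norm y)"
      by (auto simp: bounded_sesquilinear_def)
    obtain V :: "'i ell2 \<Rightarrow> 'h" where V: "bounded_clinear V" "\<And>x h. cinner x (analysis_map f h) = cinner (V x) h"
      using synthesis_map_exists[of f] f by blast
    \<comment> \<open>Every block is identified with a form on the original space; the column index
      \<beta> belongs to the linear argument and the row index \<alpha> to the conjugate-linear
      one.\<close>
    have op: "cinner (matrix_operator (triangle G (m - 1) \<alpha> \<beta>) x) y = ?B (tuple_power T \<beta> (V x)) (tuple_power T \<alpha> (V y))" for \<alpha> \<beta> x y
      unfolding assms(6) triangle_gramian[OF T]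
      using cinner_matrix_operator[OF f V(2) bounded_sesquilinear_compose[OF bB bounded_clinear_tuple_power[OF T] bounded_clinear_tuple_power[OF T]]]
      by (simp add: m)
    have "nonneg_array (triangle G (m - 1))"
      unfolding nonneg_array_def
    proof (intro allI impI)
      fix S :: "(nat ^ 'd::{finite,linorder}) set" and C :: "nat ^ 'd::{finite,linorder} \<Rightarrow> 'i ell2"
      let ?u = "\<Sum>\<alpha>\<in>S. tuple_power T \<alpha> (V (C \<alpha>))"
      \<comment> \<open>The double sum is the defect form on the diagonal, at the single vector
        \<open>?u\<close> that collects all \<open>C \<alpha>\<close>.\<close>
      have "(\<Sum>\<alpha>\<in>S. \<Sum>\<beta>\<in>S. cinner (matrix_operator (triangle G (m - 1) \<alpha> \<beta>) (C \<beta>)) (C \<alpha>)) = ?B ?u ?u"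
        unfolding op sesquilinear_sum[OF sq] ..
      then show "(\<Sum>\<alpha>\<in>S. \<Sum>\<beta>\<in>S. cinner (matrix_operator (triangle G (m - 1) \<alpha> \<beta>) (C \<beta>)) (C \<alpha>)) \<in> \<real>\<^sub>\<ge>\<^sub>0"
        using pos by simp
    qed
    \<comment> \<open>One measure is chosen for each vector independently;
      \<open>measure_representation\<close> asks for no linearity of this choice.\<close>
    moreover obtain \<mu> where \<mu>: "\<And>x. finite_measure (\<mu> x)" "\<And>x. sets (\<mu> x) = sets borel"
        "\<And>x. emeasure (\<mu> x) (- sphere 0 1) = 0"
        "\<And>\<alpha> \<beta> x. (\<integral>\<zeta>. mixed_monomial \<alpha> \<beta> \<zeta> \<partial>\<mu> x) = ?B (tuple_power T \<beta> x) (tuple_power T \<alpha> x)"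
      using invariant_form_measure[OF inv] by metis
    interpret measure_representation T ?B \<mu>
      by (intro measure_representation.intro measure_representation_axioms.intro commuting_axioms sq \<mu>)
    obtain F :: "(complex ^ 'd::{finite,linorder}) set \<Rightarrow> 'i ell2 \<Rightarrow> 'i ell2" where
      "semispectral_measure (sphere 0 1) F"
      "\<And>\<alpha> \<beta> R. (\<forall>x y. cinner (R x) y = ?B (tuple_power T \<beta> (V x)) (tuple_power T \<alpha> (V y))) \<Longrightarrow>
        has_weak_integral (sphere 0 1) F (mixed_monomial \<alpha> \<beta>) R"
      using semispectral_measure_exists[OF K V(1)] by blast
    ultimately show ?thesis using op by blast
  qed
  moreover have "triangle G (m - 1) \<alpha> \<beta> = (\<lambda>i l. \<Sum>j\<le>m - 1. (- 1) ^ (j + (m - 1)) * of_nat ((m - 1) choose j) *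
              (\<Sum>\<gamma> | index_abs \<gamma> = j. of_nat (fact (index_abs \<gamma>)) / of_nat (index_fact \<gamma>) *
                G (\<alpha> + \<gamma>) (\<beta> + \<gamma>) i l))" for \<alpha> \<beta>
    by (simp add: triangle_def shift_sum_def backward_shift_power_def)
  ultimately show ?thesis
    using iff triangle_eq_zero_iff_expansion[of G m] unfolding mixed_monomial_def[abs_def] by simp
qed

end
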